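(* Let $\Omega$ be the Lie ball of dimension $3$, with generic norm $N$, and for an integer $m\ge1$ and a real number $\mu>0$ let $$\widehat{\Omega}_{m}(\mu)=\{(z,Z)\in\Omega\times\mathbb{C}^{m}:\|Z\|^{2}<N(z,z)^{\mu}\}.$$ For $1\le m\le5$, let $\mu_m$ be the unique positive root of the polynomial $$q_m(\mu)=\tfrac{(m-1)(m^{2}-5m-2)}{8}\mu^{3}+\tfrac{9m(m-3)}{8}\mu^{2}+\tfrac{13(m-1)}{4}\mu+3.$$ If $m\ge6$, the domain $\widehat{\Omega}_{m}(\mu)$ is a Lu Qikeng domain for every $\mu\in\,]0,+\infty[$. If $1\le m\le5$, the domain $\widehat{\Omega}_{m}(\mu)$ is a Lu Qikeng domain if and only if $0<\mu\le\mu_m$.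
   Context: A domain $U\subset\mathbb{C}^n$ is called a Lu Qikeng domain if its Bergman kernel $K_U(z,w)$ has no zero on $U\times U$. $\|\cdot\|$ denotes the standard Hermitian norm. The Lie ball of dimension $n$ (domain of type $IV_n$) is $\Omega=\{z\in\mathbb{C}^{n}: \|z\|<1,\ 1-2\|z\|^{2}+|z\cdot z|^{2}>0\}$, where $z\cdot z=\sum_i z_i^2$; its generic norm satisfies $N(z,z)=1-2\|z\|^2+|z\cdot z|^2$. For $n=3$, it is isomorphic to the domain $\{z : I-zz^*>0\}$ in the space of complex symmetric $2\times2$ matrices. The polynomial $q_m$ is $q_m(\mu)=P_{\mu}^{m}(\frac12)$, where $$P_{\mu}^{m}(\eta)=(1-\mu)(2-\mu)\left(\tfrac32-\mu\right)+(m+1)\mu(1-\mu)\left(\tfrac{13}{2}-7\mu\right)\eta+3(m+1)(m+2)\left(\tfrac32-2\mu\right)\mu^{2}\eta^{2}+(m+1)(m+2)(m+3)\mu^{3}\eta^{3}.$$ For $1\le m\le5$ it has exactly one positive root. *)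

theory Defs
  imports "HOL-Analysis.Analysis"
begin

(* C^n x C^m plays the role of C^(n+m): its product norm is the Hermitian norm and
   lborel is Lebesgue measure.  HOL-Analysis has no complex vector spaces, so complex
   linearity of the Frechet derivative is spelled out. *)
definition holomorphic_sev ::
    "((complex^'n) \<times> (complex^'m) \<Rightarrow> complex) \<Rightarrow> ((complex^'n) \<times> (complex^'m)) set \<Rightarrow> bool"
  where "holomorphic_sev f U \<longleftrightarrow>
    (\<forall>x\<in>U. \<exists>D. (f has_derivative D) (at x) \<and>
       (\<forall>c v V. D (c *s v, c *s V) = c * D (v, V)))"

definition bergman_space ::
    "((complex^'n) \<times> (complex^'m)) set \<Rightarrow> ((complex^'n) \<times> (complex^'m) \<Rightarrow> complex) set"
  where "bergman_space U =
    {f. holomorphic_sev f U \<and> set_integrable lborel U (\<lambda>x. (cmod (f x))\<^sup>2)}"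

definition is_bergman_kernel ::
    "((complex^'n) \<times> (complex^'m)) set \<Rightarrow>
     ((complex^'n) \<times> (complex^'m) \<Rightarrow> (complex^'n) \<times> (complex^'m) \<Rightarrow> complex) \<Rightarrow> bool"
  where "is_bergman_kernel U K \<longleftrightarrow>
    (\<forall>w\<in>U. (\<lambda>z. K z w) \<in> bergman_space U \<and>
       (\<forall>f\<in>bergman_space U. f w = (LINT z:U|lborel. f z * cnj (K z w))))"

(* The reproducing property determines K only on U x U; the value 0 elsewhere is a
   convention that makes the description definite. *)
definition bergman_kernel ::
    "((complex^'n) \<times> (complex^'m)) set \<Rightarrow>
     (complex^'n) \<times> (complex^'m) \<Rightarrow> (complex^'n) \<times> (complex^'m) \<Rightarrow> complex"
  where "bergman_kernel U =
    (THE K. is_bergman_kernel U K \<and> (\<forall>z w. z \<notin> U \<or> w \<notin> U \<longrightarrow> K z w = 0))"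

definition Lu_Qikeng_domain :: "((complex^'n) \<times> (complex^'m)) set \<Rightarrow> bool"
  where "Lu_Qikeng_domain U \<longleftrightarrow>
    open U \<and> connected U \<and> U \<noteq> {} \<and> (\<forall>z\<in>U. \<forall>w\<in>U. bergman_kernel U z w \<noteq> 0)"

(* The diagonal value N(z,z) of the generic norm.  The sum is the bilinear z . z,
   not the (real) inner product of HOL-Analysis. *)
definition lie_norm :: "complex^'n \<Rightarrow> real"
  where "lie_norm z = 1 - 2 * (norm z)\<^sup>2 + (cmod (\<Sum>i\<in>UNIV. (z $ i)\<^sup>2))\<^sup>2"

definition lie_ball :: "(complex^'n) set"
  where "lie_ball = {z. norm z < 1 \<and> lie_norm z > 0}"

definition hartogs_lie :: "real \<Rightarrow> ((complex^'n) \<times> (complex^'m)) set"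
  where "hartogs_lie \<mu> = {(z, Z). z \<in> lie_ball \<and> (norm Z)\<^sup>2 < lie_norm z powr \<mu>}"

definition q_poly :: "nat \<Rightarrow> real \<Rightarrow> real"
  where "q_poly m \<mu> =
    (real m - 1) * ((real m)\<^sup>2 - 5 * real m - 2) / 8 * \<mu> ^ 3
    + 9 * real m * (real m - 3) / 8 * \<mu>\<^sup>2
    + 13 * (real m - 1) / 4 * \<mu> + 3"

definition mu_root :: "nat \<Rightarrow> real"
  where "mu_root m = (THE \<mu>. \<mu> > 0 \<and> q_poly m \<mu> = 0)"

end

theory Submission
  imports Defs "HOL-Complex_Analysis.Complex_Analysis" "HOL-Probability.Distributions" "HOL-Real_Asymp.Real_Asymp"
begin

text \<open>
Let m be the dimension of the fibres, and write U for the Hartogs domain over the Lie ball.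

The zeros of a Bergman kernel need to be studied at one point of each orbit of the automorphism group
only: if k reproduces the value at F y, then x \<mapsto> k (F x) J x cnj (J y) reproduces the value at y, where
J is the Jacobian of the automorphism F, and J has no zeros (\<open>reproduces_pullback\<close>). The Lie ball is
homogeneous, and its automorphisms lift to U. Hence every orbit contains a point (0, \<omega> e_i), where
e_i is a unit vector of the fibre and |\<omega>| < 1 (\<open>kernel_via_series_all\<close>). Two kinds of
automorphisms suffice: linear isometries, all of them phases and Householder reflections, and the Moebius
transformations of one diagonal entry of the symmetric matrix that corresponds to a point of the ball
(\<open>bihol_aut_hartogs_moebius\<close>). As the kernel is transported
point by point, only the diagonal values N(z,z) of the generic norm occur.

At a base point, the torus action on U reduces the reproducing property to one variable. Averaging
shows that only the restriction of f to the slice {(0, \<zeta> e_i)} matters and that the monomials are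
orthogonal, so the reproducing function is the sum of (cnj \<omega> Z_i)^n / M_n with M_n the integral of
|Z_i|^(2n) over U (\<open>base_reproduces\<close>). By Fubini, M_n is n! / (n + m)! times the integral of
N(z,z)^\<sigma> over the ball for \<sigma> = \<mu> (n + m), up to a constant, and the latter is a
constant over (\<sigma> + 1) (\<sigma> + 2) (2 \<sigma> + 3) (\<open>hartogs_moment\<close>). Since
cnj \<omega> Z_i takes every value of the unit disc, U is a Lu Qikeng domain if and only if the sum of
X^n / M_n has no zero for |X| < 1 (\<open>Lu_Qikeng_iff_series\<close>).

With \<eta> = 1 / (1 - X) this series is a power of \<eta> times a cubic P(\<eta>)
(\<open>ker_coeff_sums\<close>), the disc becomes the half-plane Re \<eta> > 1/2, and q_m(\<mu>) = P(1/2). If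
q_m(\<mu>) is negative, then P has a real zero greater than 1/2. If it is nonnegative, then
P(1/2 + \<xi>) satisfies the Routh-Hurwitz conditions and has no zero with Re \<xi> > 0
(\<open>P_poly_no_zero\<close>). It remains to determine the sign of q_m: it is positive for m \<ge> 6, and for
m \<le> 5 the function q_m(\<mu>) / \<mu>^2 is strictly decreasing, so q_m changes sign exactly once
(\<open>q_poly_root\<close>).
\<close>

section \<open>Lebesgue measure under linear maps\<close>

lemma mult_swap_right: "a * b * c = a * c * (b::'a::comm_semiring_1)"
  by (simp add: mult_ac)

lemma ennreal_mult_right_cancel:
  fixes a b w :: ennreal
  assumes "a * w = b * w" "w \<noteq> 0" "w \<noteq> \<infinity>"
  shows "a = b"
proof -
  have "a = a * w / w" "b = b * w / w"
    using assms(2,3) by (simp_all add: mult_divide_eq_ennreal)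
  then show ?thesis using assms(1) by simp
qed

lemma linear_inv_of_bij:
  fixes L :: "'a::euclidean_space \<Rightarrow> 'b::euclidean_space"
  assumes "linear L" "bij L"
  shows "linear (inv L)"
proof (rule linearI)
  have 1: "L (inv L y) = y" for y
    using assms(2) by (simp add: bij_is_surj surj_f_inv_f)
  have 2: "inv L (L x) = x" for x
    using assms(2) by (simp add: bij_is_inj)
  show "inv L (x + y) = inv L x + inv L y" for x y
  proof -
    have "inv L (x + y) = inv L (L (inv L x + inv L y))"
      by (simp only: linear_add[OF assms(1)] 1)
    then show ?thesis by (simp only: 2)
  qed
  show "inv L (r *\<^sub>R x) = r *\<^sub>R inv L x" for r x
  proof -
    have "inv L (r *\<^sub>R x) = inv L (L (r *\<^sub>R inv L x))"
      by (simp only: linear_scale[OF assms(1)] 1)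
    then show ?thesis by (simp only: 2)
  qed
qed

lemma borel_measurable_linear:
  fixes L :: "'a::euclidean_space \<Rightarrow> 'b::euclidean_space"
  assumes "linear L"
  shows "L \<in> borel_measurable borel"
  using assms by (intro borel_measurable_continuous_onI linear_continuous_on) (simp add: linear_linear)

lemma nn_integral_lborel_plus:
  fixes g :: "'a::euclidean_space \<Rightarrow> ennreal"
  assumes [measurable]: "g \<in> borel_measurable borel"
  shows "(\<integral>\<^sup>+x. g (c + x) \<partial>lborel) = (\<integral>\<^sup>+x. g x \<partial>lborel)"
proof -
  have "(\<integral>\<^sup>+x. g x \<partial>lborel) = (\<integral>\<^sup>+x. g x \<partial>distr lborel borel ((+) c))"
    by (simp add: lborel_distr_plus)
  also have "\<dots> = (\<integral>\<^sup>+x. g (c + x) \<partial>lborel)"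
    by (subst nn_integral_distr) auto
  finally show ?thesis by simp
qed

lemma nn_integral_lborel_diff:
  fixes g :: "'a::euclidean_space \<Rightarrow> ennreal"
  assumes [measurable]: "g \<in> borel_measurable borel"
  shows "(\<integral>\<^sup>+x. g (x - c) \<partial>lborel) = (\<integral>\<^sup>+x. g x \<partial>lborel)"
  using nn_integral_lborel_plus[of g "- c"] by simp

lemma nn_integral_lborel_reflect:
  fixes g :: "'a::euclidean_space \<Rightarrow> ennreal"
  assumes [measurable]: "g \<in> borel_measurable borel"
  shows "(\<integral>\<^sup>+x. g (c - x) \<partial>lborel) = (\<integral>\<^sup>+x. g x \<partial>lborel)"
proof -
  have "(lborel :: 'a measure) = distr lborel borel (\<lambda>x. c - x)"
    using lborel_affine[of "-1" c] by (simp add: density_1)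
  then have "(\<integral>\<^sup>+x. g x \<partial>lborel) = (\<integral>\<^sup>+x. g x \<partial>distr lborel borel (\<lambda>x. c - x))"
    by simp
  also have "\<dots> = (\<integral>\<^sup>+x. g (c - x) \<partial>lborel)"
    by (subst nn_integral_distr) auto
  finally show ?thesis by simp
qed

text \<open>Uniqueness of translation invariant measures in disguise: the double integral of g (L x) b (L x + y),
with b the indicator of the unit ball, is computed once by integrating over y first and once
after the substitution x \<mapsto> x - inv L y, which moves y from b to g.\<close>
lemma nn_integral_linear_bij_unit_ball:
  fixes L :: "'a::euclidean_space \<Rightarrow> 'b::euclidean_space"
  assumes L: "linear L" "bij L" and [measurable]: "g \<in> borel_measurable borel"
  shows "(\<integral>\<^sup>+x. g (L x) \<partial>lborel) * emeasure lborel (ball (0::'b) 1)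
       = emeasure lborel (L -` ball (0::'b) 1) * (\<integral>\<^sup>+y. g y \<partial>lborel)"
proof -
  have [measurable]: "L \<in> borel_measurable borel"
    by (rule borel_measurable_linear[OF L(1)])
  define M where "M = inv L"
  have LM: "L (M y) = y" for y
    unfolding M_def using L(2) by (simp add: bij_is_surj surj_f_inv_f)
  have Ldiff: "L (x - y) = L x - L y" for x y
    by (rule linear_diff[OF L(1)])
  define b where "b = (indicator (ball (0::'b) 1) :: 'b \<Rightarrow> ennreal)"
  have [measurable]: "b \<in> borel_measurable borel"
    unfolding b_def by (intro borel_measurable_indicator) auto
  have b_int: "(\<integral>\<^sup>+y. b y \<partial>lborel) = emeasure lborel (ball (0::'b) 1)"
    unfolding b_def by simp
  have bL_int: "(\<integral>\<^sup>+x. b (L x) \<partial>lborel) = emeasure lborel (L -` ball (0::'b) 1)"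
  proof -
    have "L -` ball (0::'b) 1 \<in> sets borel"
      using measurable_sets[of L borel borel "ball 0 1"] by simp
    have "(\<integral>\<^sup>+x. b (L x) \<partial>lborel) = (\<integral>\<^sup>+x. indicator (L -` ball 0 1) x \<partial>lborel)"
      unfolding b_def by (intro nn_integral_cong) (simp add: indicator_def)
    also have "\<dots> = emeasure lborel (L -` ball (0::'b) 1)"
      by (rule nn_integral_indicator) (use \<open>L -` ball (0::'b) 1 \<in> sets borel\<close> in simp)
    finally show ?thesis .
  qed
  have "(\<integral>\<^sup>+x. g (L x) \<partial>lborel) * emeasure lborel (ball (0::'b) 1)
      = (\<integral>\<^sup>+x. g (L x) * (\<integral>\<^sup>+y. b (L x + y) \<partial>lborel) \<partial>lborel)"
    by (subst nn_integral_lborel_plus) (simp_all add: b_int nn_integral_multc)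
  also have "\<dots> = (\<integral>\<^sup>+x. \<integral>\<^sup>+y. g (L x) * b (L x + y) \<partial>lborel \<partial>lborel)"
    by (intro nn_integral_cong nn_integral_cmult[symmetric]) measurable
  also have "\<dots> = (\<integral>\<^sup>+y. \<integral>\<^sup>+x. g (L x) * b (L x + y) \<partial>lborel \<partial>lborel)"
    by (rule lborel_pair.Fubini') measurable
  also have "\<dots> = (\<integral>\<^sup>+y. \<integral>\<^sup>+x. g (L x - y) * b (L x) \<partial>lborel \<partial>lborel)"
  proof (rule nn_integral_cong)
    fix y :: 'b
    have "(\<integral>\<^sup>+x. g (L x) * b (L x + y) \<partial>lborel)
        = (\<integral>\<^sup>+x. g (L (x - M y)) * b (L (x - M y) + y) \<partial>lborel)"
      by (rule nn_integral_lborel_diff[symmetric]) measurable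
    also have "\<dots> = (\<integral>\<^sup>+x. g (L x - y) * b (L x) \<partial>lborel)"
      by (simp add: Ldiff LM)
    finally show "(\<integral>\<^sup>+x. g (L x) * b (L x + y) \<partial>lborel) = (\<integral>\<^sup>+x. g (L x - y) * b (L x) \<partial>lborel)" .
  qed
  also have "\<dots> = (\<integral>\<^sup>+x. \<integral>\<^sup>+y. g (L x - y) * b (L x) \<partial>lborel \<partial>lborel)"
    by (rule lborel_pair.Fubini') measurable
  also have "\<dots> = (\<integral>\<^sup>+x. (\<integral>\<^sup>+y. g y \<partial>lborel) * b (L x) \<partial>lborel)"
    by (intro nn_integral_cong) (simp add: nn_integral_multc nn_integral_lborel_reflect)
  also have "\<dots> = emeasure lborel (L -` ball (0::'b) 1) * (\<integral>\<^sup>+y. g y \<partial>lborel)"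
    by (simp add: nn_integral_cmult bL_int mult.commute)
  finally show ?thesis .
qed

lemma emeasure_unit_ball_pos_finite:
  "emeasure lborel (ball (0::'b::euclidean_space) 1) \<noteq> 0"
  "emeasure lborel (ball (0::'b::euclidean_space) 1) \<noteq> \<infinity>"
proof -
  show "emeasure lborel (ball (0::'b::euclidean_space) 1) \<noteq> \<infinity>"
    using emeasure_lborel_ball_finite[of "0::'b" 1] by simp
  have "measure lborel (ball (0::'b) 1) > 0" by (intro content_ball_pos) auto
  then show "emeasure lborel (ball (0::'b::euclidean_space) 1) \<noteq> 0"
    unfolding measure_def by (metis enn2real_0 less_irrefl)
qed

text \<open>The constant is the quotient of the volumes of the preimage of the unit ball and of the unit ball.\<close>
lemma nn_integral_linear_bij:
  fixes L :: "'a::euclidean_space \<Rightarrow> 'b::euclidean_space"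
  assumes L: "linear L" "bij L"
  obtains C :: real where "C > 0"
    "\<And>g. g \<in> borel_measurable borel \<Longrightarrow>
        (\<integral>\<^sup>+x. g (L x) \<partial>lborel) = ennreal C * (\<integral>\<^sup>+y. g y \<partial>lborel)"
proof -
  let ?v = "L -` ball (0::'b) 1"
  define v where "v = emeasure lborel ?v"
  define w where "w = emeasure lborel (ball (0::'b) 1)"
  have w: "w \<noteq> 0" "w \<noteq> \<infinity>" unfolding w_def by (rule emeasure_unit_ball_pos_finite)+
  have cont: "continuous_on UNIV L" using L(1) by (simp add: linear_continuous_on linear_linear)
  have "open ?v" using cont by (intro open_vimage) auto
  moreover have "0 \<in> ?v" using L(1) by (simp add: linear_0)
  ultimately obtain e where e: "e > 0" "ball 0 e \<subseteq> ?v" by (meson open_contains_ball)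
  have "linear (inv L)" using L by (intro linear_inv_of_bij)
  moreover have "?v = inv L ` ball 0 1" using L(2) by (simp add: bij_vimage_eq_inv_image)
  ultimately have "bounded ?v" by (simp add: bounded_linear_image linear_linear)
  then obtain r where r: "?v \<subseteq> ball 0 r" using bounded_subset_ballD by blast
  have vm: "?v \<in> sets borel" using \<open>open ?v\<close> by auto
  have "v \<noteq> \<infinity>"
    unfolding v_def using emeasure_mono[OF r, of lborel] emeasure_lborel_ball_finite[of "0::'a" r] by (auto simp: top_unique)
  moreover have "v \<noteq> 0"
  proof
    assume "v = 0"
    then have "emeasure lborel (ball (0::'a) e) = 0"
      using emeasure_mono[OF e(2), of lborel] vm unfolding v_def by auto
    moreover have "measure lborel (ball (0::'a) e) > 0" using e by (intro content_ball_pos) auto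
    ultimately show False unfolding measure_def by simp
  qed
  ultimately obtain v' w' where vw: "v = ennreal v'" "v' > 0" "w = ennreal w'" "w' > 0"
    using w by (cases v; cases w) (auto simp: ennreal_eq_0_iff)
  show ?thesis
  proof (rule that[of "v' / w'"])
    show "v' / w' > 0" using vw by simp
    fix g :: "'b \<Rightarrow> ennreal" assume g: "g \<in> borel_measurable borel"
    have "(\<integral>\<^sup>+x. g (L x) \<partial>lborel) * w = v * (\<integral>\<^sup>+y. g y \<partial>lborel)"
      unfolding v_def w_def by (rule nn_integral_linear_bij_unit_ball[OF L g])
    also have "v = ennreal (v' / w') * w"
      using vw by (simp flip: ennreal_mult)
    finally have "(\<integral>\<^sup>+x. g (L x) \<partial>lborel) * w = (ennreal (v' / w') * (\<integral>\<^sup>+y. g y \<partial>lborel)) * w"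
      by (simp only: mult_swap_right[of _ w])
    then show "(\<integral>\<^sup>+x. g (L x) \<partial>lborel) = ennreal (v' / w') * (\<integral>\<^sup>+y. g y \<partial>lborel)"
      using w by (rule ennreal_mult_right_cancel)
  qed
qed

text \<open>The preimage of the unit ball is a ball, whence the explicit constant.\<close>
lemma nn_integral_linear_similarity:
  fixes L :: "'a::euclidean_space \<Rightarrow> 'a"
  assumes L: "linear L" "\<And>x. norm (L x) = r * norm x" "r > 0" and g: "g \<in> borel_measurable borel"
  shows "(\<integral>\<^sup>+x. g (L x) \<partial>lborel) = ennreal ((1 / r) ^ DIM('a)) * (\<integral>\<^sup>+y. g y \<partial>lborel)"
proof -
  have "x = 0" if "L x = 0" for x
    using L(2)[of x] L(3) that by simp
  then have "inj L"
    using linear_injective_0[OF L(1)] by blast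
  then have bij: "bij L"
    using linear_injective_imp_surjective[OF L(1)] by (simp add: bij_def)
  define w where "w = emeasure lborel (ball (0::'a) 1)"
  have w: "w \<noteq> 0" "w \<noteq> \<infinity>" unfolding w_def by (rule emeasure_unit_ball_pos_finite)+
  have "L -` ball 0 1 = ball 0 (1 / r)"
  proof (rule set_eqI)
    fix x show "x \<in> L -` ball 0 1 \<longleftrightarrow> x \<in> ball 0 (1 / r)"
      using L(3) by (simp add: L(2) field_simps)
  qed
  moreover have "emeasure lborel (ball (0::'a) (1 / r)) = ennreal ((1 / r) ^ DIM('a)) * w"
  proof -
    have "emeasure lborel (ball (0::'a) (1 / r)) = ennreal ((1 / r) ^ DIM('a) * unit_ball_vol (DIM('a)))"
      using L(3) by (subst emeasure_ball) (simp_all add: mult.commute)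
    also have "\<dots> = ennreal ((1 / r) ^ DIM('a)) * w"
      using L(3) unfolding w_def by (subst emeasure_ball, simp) (subst ennreal_mult', simp_all)
    finally show ?thesis .
  qed
  ultimately have "(\<integral>\<^sup>+x. g (L x) \<partial>lborel) * w = ennreal ((1 / r) ^ DIM('a)) * w * (\<integral>\<^sup>+y. g y \<partial>lborel)"
    using nn_integral_linear_bij_unit_ball[OF L(1) bij g] unfolding w_def by simp
  also have "\<dots> = (ennreal ((1 / r) ^ DIM('a)) * (\<integral>\<^sup>+y. g y \<partial>lborel)) * w"
    by (rule mult_swap_right)
  finally show ?thesis
    using w by (rule ennreal_mult_right_cancel)
qed

lemma nn_integral_linear_isometry:
  fixes L :: "'a::euclidean_space \<Rightarrow> 'a"
  assumes "linear L" "\<And>x. norm (L x) = norm x" "g \<in> borel_measurable borel"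
  shows "(\<integral>\<^sup>+x. g (L x) \<partial>lborel) = (\<integral>\<^sup>+y. g y \<partial>lborel)"
  using nn_integral_linear_similarity[OF assms(1), of 1 g] assms(2,3) by simp

section \<open>Integrals over the plane and over the disc\<close>

text \<open>The squared modulus turns area into a constant multiple of length; in this form every radial
integral over the plane becomes a one-dimensional integral without polar coordinates.\<close>
lemma lborel_distr_norm_sq_complex:
  "distr lborel borel (\<lambda>z::complex. (cmod z)\<^sup>2)
     = density lborel (\<lambda>u::real. ennreal pi * indicator {0..} u)"
proof (rule measure_eqI_generator_eq)
  let ?E = "range (\<lambda>a::real. {..<a})"
  show "Int_stable ?E"
  proof (rule Int_stableI)
    fix A B assume "A \<in> ?E" "B \<in> ?E"
    then obtain a b where "A = {..<a}" "B = {..<b}" by auto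
    then have "A \<inter> B = {..<min a b}" by auto
    then show "A \<inter> B \<in> ?E" by auto
  qed
  show "?E \<subseteq> Pow UNIV" by auto
  show "sets (distr lborel borel (\<lambda>z::complex. (cmod z)\<^sup>2)) = sigma_sets UNIV ?E"
    by (simp add: borel_Iio)
  show "sets (density lborel (\<lambda>u::real. ennreal pi * indicator {0..} u)) = sigma_sets UNIV ?E"
    by (simp add: borel_Iio)
  let ?A = "\<lambda>n::nat. {..<real n}"
  show "range ?A \<subseteq> ?E" by auto
  show "(\<Union>i. ?A i) = UNIV" using reals_Archimedean2 by auto
  have em: "emeasure (distr lborel borel (\<lambda>z::complex. (cmod z)\<^sup>2)) {..<a} = ennreal pi * ennreal a" for a
  proof (cases "a > 0")
    case True
    have "(\<lambda>z::complex. (cmod z)\<^sup>2) -` {..<a} = ball 0 (sqrt a)"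
    proof (rule set_eqI)
      fix z :: complex
      have "(cmod z)\<^sup>2 < a \<longleftrightarrow> sqrt ((cmod z)\<^sup>2) < sqrt a" by (simp only: real_sqrt_less_iff)
      then show "z \<in> (\<lambda>z::complex. (cmod z)\<^sup>2) -` {..<a} \<longleftrightarrow> z \<in> ball 0 (sqrt a)" by simp
    qed
    then have "emeasure (distr lborel borel (\<lambda>z::complex. (cmod z)\<^sup>2)) {..<a} = emeasure lborel (ball (0::complex) (sqrt a))"
      by (subst emeasure_distr) auto
    also have "\<dots> = ennreal pi * ennreal a"
      using True by (subst emeasure_ball) (auto simp: unit_ball_vol_2 ennreal_mult')
    finally show ?thesis .
  next
    case False
    then have "(\<lambda>z::complex. (cmod z)\<^sup>2) -` {..<a} = {}"
      by (auto simp: not_less) (smt (verit) zero_le_power2)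
    then show ?thesis using False by (subst emeasure_distr) (auto simp: ennreal_neg)
  qed
  show "emeasure (distr lborel borel (\<lambda>z::complex. (cmod z)\<^sup>2)) (?A i) \<noteq> \<infinity>" for i
    unfolding em by (simp add: ennreal_mult_eq_top_iff)
  fix X assume "X \<in> ?E"
  then obtain a where X: "X = {..<a}" by auto
  have "emeasure (density lborel (\<lambda>u::real. ennreal pi * indicator {0..} u)) {..<a}
      = (\<integral>\<^sup>+u. ennreal pi * indicator {0..<a} u \<partial>lborel)"
    by (subst emeasure_density) (auto intro!: nn_integral_cong split: split_indicator)
  also have "\<dots> = ennreal pi * ennreal a"
    by (subst nn_integral_cmult_indicator, simp, cases "a \<ge> 0") (simp_all add: ennreal_neg)
  finally show "emeasure (distr lborel borel (\<lambda>z::complex. (cmod z)\<^sup>2)) X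
      = emeasure (density lborel (\<lambda>u::real. ennreal pi * indicator {0..} u)) X"
    unfolding X em ..
qed

lemma nn_integral_radial_complex:
  assumes [measurable]: "g \<in> borel_measurable borel"
  shows "(\<integral>\<^sup>+z. g ((cmod z)\<^sup>2) \<partial>(lborel :: complex measure))
       = ennreal pi * (\<integral>\<^sup>+u. g u * indicator {0..} u \<partial>(lborel :: real measure))"
proof -
  have "(\<integral>\<^sup>+z. g ((cmod z)\<^sup>2) \<partial>(lborel :: complex measure)) = (\<integral>\<^sup>+u. g u \<partial>distr lborel borel (\<lambda>z::complex. (cmod z)\<^sup>2))"
    by (subst nn_integral_distr) auto
  also have "\<dots> = (\<integral>\<^sup>+u. ennreal pi * (g u * indicator {0..} u) \<partial>lborel)"
    unfolding lborel_distr_norm_sq_complex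
    by (subst nn_integral_density) (auto intro!: nn_integral_cong simp: mult_ac)
  finally show ?thesis by (simp add: nn_integral_cmult)
qed

text \<open>The only explicit integral behind the moments of the domain: each of the three fibrations of the
Lie ball below is by discs and contributes one such factor.\<close>
lemma nn_integral_disc_powr:
  assumes "\<sigma> \<ge> 0" "R \<ge> 0"
  shows "(\<integral>\<^sup>+z. ennreal ((R - (cmod z)\<^sup>2) powr \<sigma>) * indicator {z. (cmod z)\<^sup>2 < R} z \<partial>(lborel :: complex measure))
       = ennreal (pi * R powr (\<sigma> + 1) / (\<sigma> + 1))"
proof -
  define g where "g = (\<lambda>u::real. ennreal ((R - u) powr \<sigma>) * indicator {..<R} u)"
  have [measurable]: "g \<in> borel_measurable borel" unfolding g_def by auto
  have hi: "((\<lambda>u. u powr \<sigma>) has_integral R powr (\<sigma> + 1) / (\<sigma> + 1)) {0..R}"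
    using assms by (intro has_integral_powr_from_0) auto
  have "(\<integral>\<^sup>+z. ennreal ((R - (cmod z)\<^sup>2) powr \<sigma>) * indicator {z. (cmod z)\<^sup>2 < R} z \<partial>(lborel :: complex measure))
      = (\<integral>\<^sup>+z. g ((cmod z)\<^sup>2) \<partial>(lborel :: complex measure))"
    unfolding g_def by (intro nn_integral_cong) (auto split: split_indicator)
  also have "\<dots> = ennreal pi * (\<integral>\<^sup>+u. g u * indicator {0..} u \<partial>(lborel :: real measure))"
    by (rule nn_integral_radial_complex) measurable
  also have "(\<integral>\<^sup>+u. g u * indicator {0..} u \<partial>(lborel :: real measure)) = (\<integral>\<^sup>+u. g (R - u) * indicator {0..} (R - u) \<partial>(lborel :: real measure))"
    by (rule nn_integral_lborel_reflect[symmetric]) measurable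
  also have "\<dots> = (\<integral>\<^sup>+u. ennreal (u powr \<sigma>) * indicator {0..R} u \<partial>(lborel :: real measure))"
    by (rule nn_integral_cong_AE, rule AE_mp[OF AE_lborel_singleton[of 0]])
       (auto simp: g_def split: split_indicator)
  also have "\<dots> = ennreal (R powr (\<sigma> + 1) / (\<sigma> + 1))"
    using hi by (intro nn_integral_has_integral_lebesgue') auto
  finally show ?thesis
    by (simp flip: ennreal_mult add: assms)
qed

definition complex_of_vec :: "real^2 \<Rightarrow> complex" where "complex_of_vec v = Complex (v $ 1) (v $ 2)"
definition vec_of_complex :: "complex \<Rightarrow> real^2" where "vec_of_complex z = vector [Re z, Im z]"

lemma complex_of_vec_of_complex [simp]: "complex_of_vec (vec_of_complex z) = z"
  by (simp add: complex_of_vec_def vec_of_complex_def)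

lemma vec_of_complex_of_vec [simp]: "vec_of_complex (complex_of_vec v) = v"
  by (simp add: complex_of_vec_def vec_of_complex_def vec_eq_iff forall_2)

lemma linear_vec_of_complex: "linear vec_of_complex"
  by (rule linearI) (simp_all add: vec_of_complex_def vec_eq_iff forall_2)

lemma linear_complex_of_vec: "linear complex_of_vec"
  by (rule linearI) (simp_all add: complex_of_vec_def complex_eq_iff)

lemma bij_vec_of_complex: "bij vec_of_complex"
  by (rule o_bij[of complex_of_vec]) (auto simp: fun_eq_iff)

lemma det_matrix_complex_mult:
  "det (matrix (\<lambda>h. vec_of_complex (d * complex_of_vec h))) = (cmod d)\<^sup>2"
  by (simp add: det_2 matrix_def vec_of_complex_def complex_of_vec_def axis_def cmod_power2) (simp add: power2_eq_square)

text \<open>The change of variables theorem for differentiable maps of the real plane applies because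
multiplication by a complex number d has real determinant |d|^2.\<close>
lemma emeasure_conformal_image:
  assumes f: "\<And>z. z \<in> S \<Longrightarrow> (f has_field_derivative f' z) (at z)" "inj_on f S"
    and S: "S \<in> sets borel" and fS: "f ` S \<in> sets borel" "bounded (f ` S)"
    and [measurable]: "(\<lambda>z. (cmod (f' z))\<^sup>2 * indicator S z) \<in> borel_measurable borel"
  shows "(\<integral>\<^sup>+z. ennreal ((cmod (f' z))\<^sup>2) * indicator S z \<partial>lborel) = emeasure lborel (f ` S)"
proof -
  let ?M = complex_of_vec and ?L = vec_of_complex
  obtain C where C: "C > 0" "\<And>g. g \<in> borel_measurable borel \<Longrightarrow>
        (\<integral>\<^sup>+x. g (?L x) \<partial>lborel) = ennreal C * (\<integral>\<^sup>+y. g y \<partial>lborel)"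
    using nn_integral_linear_bij[OF linear_vec_of_complex bij_vec_of_complex] by blast
  have [measurable]: "?M \<in> borel_measurable borel"
    by (rule borel_measurable_linear[OF linear_complex_of_vec])
  have Lim: "?L ` A = ?M -` A" for A
    by (auto simp: image_iff) (metis vec_of_complex_of_vec)
  have Lset: "?L ` A \<in> sets borel" if "A \<in> sets borel" for A
    unfolding Lim using measurable_sets[of ?M borel borel A] that by simp
  define F where "F = (\<lambda>v. ?L (f (?M v)))"
  define F' where "F' = (\<lambda>v h. ?L (f' (?M v) * ?M h))"
  have derF: "(F has_derivative F' v) (at v within ?L ` S)" if "v \<in> ?L ` S" for v
  proof -
    have "?M v \<in> S" using that by auto
    then have 1: "(f has_derivative (\<lambda>h. f' (?M v) * h)) (at (?M v))"
      using f(1) by (simp add: has_field_derivative_def)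
    have 2: "(?M has_derivative ?M) (at v within ?L ` S)"
      using linear_complex_of_vec by (intro bounded_linear_imp_has_derivative) (simp add: linear_linear)
    have 3: "((\<lambda>v. f (?M v)) has_derivative (\<lambda>h. f' (?M v) * ?M h)) (at v within ?L ` S)"
      by (rule has_derivative_compose[OF 2 1])
    have "bounded_linear ?L" using linear_vec_of_complex by (simp add: linear_linear)
    from bounded_linear.has_derivative[OF this 3] show ?thesis
      unfolding F_def F'_def .
  qed
  have injF: "inj_on F (?L ` S)"
    unfolding F_def using f(2) by (auto simp: inj_on_def) (metis complex_of_vec_of_complex)
  have Fim: "F ` ?L ` S = ?L ` f ` S"
    unfolding F_def by (auto simp: image_iff)
  have det: "\<bar>det (matrix (F' v))\<bar> = (cmod (f' (?M v)))\<^sup>2" for v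
    unfolding F'_def by (simp add: det_matrix_complex_mult)
  have bnd: "bounded (?L ` f ` S)"
    by (rule bounded_linear_image[OF fS(2)]) (use linear_vec_of_complex in \<open>simp add: linear_linear\<close>)
  have lm: "F ` ?L ` S \<in> lmeasurable"
    unfolding Fim by (rule bounded_set_imp_lmeasurable[OF bnd]) (use Lset[OF fS(1)] in simp)
  define m where "m = measure lebesgue (?L ` f ` S)"
  have LS: "?L ` S \<in> sets lebesgue" using Lset[OF S] by simp
  have "((\<lambda>x. \<bar>det (matrix (F' x))\<bar>) has_integral m) (?L ` S)"
    using has_measure_differentiable_image[of "?L ` S" F F' m, OF LS derF injF] lm
    unfolding m_def Fim by blast
  then have "((\<lambda>x. (cmod (f' (?M x)))\<^sup>2) has_integral m) (?L ` S)"
    unfolding det .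
  then have 1: "(\<integral>\<^sup>+x. ennreal ((cmod (f' (?M x)))\<^sup>2) * indicator (?L ` S) x \<partial>lborel) = ennreal m"
    by (rule nn_integral_has_integral_lebesgue'[rotated]) simp
  have 2: "ennreal m = emeasure lborel (?L ` f ` S)"
  proof -
    have "ennreal m = emeasure lebesgue (?L ` f ` S)"
      unfolding m_def by (rule emeasure_eq_ennreal_measure[symmetric])
        (use fmeasurableD2[OF lm] in \<open>simp add: Fim\<close>)
    then show ?thesis using Lset[OF fS(1)] by simp
  qed
  have ind: "indicator (?L ` A) (?L z) = (indicator A z :: ennreal)" for A z
    by (auto simp: indicator_def image_iff) (metis complex_of_vec_of_complex)
  have "(\<lambda>v. ennreal ((cmod (f' (?M v)))\<^sup>2 * indicator S (?M v))) \<in> borel_measurable borel"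
    by measurable
  also have "(\<lambda>v. ennreal ((cmod (f' (?M v)))\<^sup>2 * indicator S (?M v)))
      = (\<lambda>v. ennreal ((cmod (f' (?M v)))\<^sup>2) * indicator (?L ` S) v)"
    by (auto simp: fun_eq_iff Lim indicator_def)
  finally have m1: "(\<lambda>v. ennreal ((cmod (f' (?M v)))\<^sup>2) * indicator (?L ` S) v) \<in> borel_measurable borel" .
  have "(\<integral>\<^sup>+z. ennreal ((cmod (f' z))\<^sup>2) * indicator S z \<partial>lborel) = ennreal C * emeasure lborel (?L ` f ` S)"
    using C(2)[OF m1] unfolding 1 2 by (simp add: ind)
  also have "\<dots> = (\<integral>\<^sup>+x. indicator (?L ` f ` S) (?L x) \<partial>lborel)"
    using Lset[OF fS(1)] by (subst C(2)) auto
  also have "\<dots> = emeasure lborel (f ` S)"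
    using fS(1) by (simp add: ind)
  finally show ?thesis .
qed

text \<open>The formula for measures of images determines the image measure, hence the formula for all
nonnegative integrands.\<close>
lemma nn_integral_conformal_substitution:
  assumes f: "\<And>z. z \<in> S \<Longrightarrow> (f has_field_derivative f' z) (at z)" "bij_betw f S T"
    and S: "open S" and T: "open T" "bounded T" and f': "continuous_on S f'"
    and g [measurable]: "g \<in> borel_measurable borel"
  shows "(\<integral>\<^sup>+z. ennreal ((cmod (f' z))\<^sup>2) * g (f z) * indicator S z \<partial>lborel)
       = (\<integral>\<^sup>+w. g w * indicator T w \<partial>lborel)"
proof -
  have [measurable]: "S \<in> sets borel" "T \<in> sets borel" using S T by auto
  define h where "h = (\<lambda>z. if z \<in> S then f z else 0)"
  have contf: "continuous_on S f"
    using f(1) by (meson DERIV_continuous_on has_field_derivative_at_within)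
  have [measurable]: "h \<in> borel_measurable borel"
    unfolding h_def using contf by (intro borel_measurable_continuous_on_if) auto
  define J where "J = (\<lambda>z. (cmod (f' z))\<^sup>2 * indicator S z)"
  have [measurable]: "J \<in> borel_measurable borel"
  proof -
    have "(\<lambda>z. if z \<in> S then f' z else 0) \<in> borel_measurable borel"
      using f' by (intro borel_measurable_continuous_on_if) auto
    then have "(\<lambda>z. (cmod (if z \<in> S then f' z else 0))\<^sup>2) \<in> borel_measurable borel" by measurable
    also have "(\<lambda>z. (cmod (if z \<in> S then f' z else 0))\<^sup>2) = J" by (auto simp: J_def)
    finally show ?thesis .
  qed
  have eq: "distr (density lborel (\<lambda>z. ennreal (J z))) borel h = density lborel (indicator T)"
  proof (rule measure_eqI)
    fix B assume "B \<in> sets (distr (density lborel (\<lambda>z. ennreal (J z))) borel h)"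
    then have B [measurable]: "B \<in> sets borel" by simp
    define S' where "S' = h -` B \<inter> S"
    have S'm [measurable]: "S' \<in> sets borel"
      unfolding S'_def using measurable_sets[of h borel borel B] by auto
    have im: "f ` S' = B \<inter> T"
      using f(2) unfolding S'_def h_def bij_betw_def by (auto split: if_splits)
    have "emeasure (distr (density lborel (\<lambda>z. ennreal (J z))) borel h) B
        = (\<integral>\<^sup>+z. ennreal (J z) * indicator (h -` B) z \<partial>lborel)"
      using measurable_sets[of h borel borel B] by (subst emeasure_distr) (auto simp: emeasure_density)
    also have "\<dots> = (\<integral>\<^sup>+z. ennreal ((cmod (f' z))\<^sup>2) * indicator S' z \<partial>lborel)"
      by (intro nn_integral_cong) (auto simp: J_def S'_def split: split_indicator)
    also have "\<dots> = emeasure lborel (f ` S')"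
    proof (rule emeasure_conformal_image[where f = f and f' = f' and S = S'])
      show "(f has_field_derivative f' z) (at z)" if "z \<in> S'" for z using that f(1) by (auto simp: S'_def)
      show "inj_on f S'" using f(2) unfolding bij_betw_def S'_def by (auto intro: inj_on_subset)
      show "bounded (f ` S')" unfolding im using T by (auto intro: bounded_subset)
      have "(\<lambda>z. J z * indicator S' z) \<in> borel_measurable borel" by measurable
      also have "(\<lambda>z. J z * indicator S' z) = (\<lambda>z. (cmod (f' z))\<^sup>2 * indicator S' z)"
        by (auto simp: J_def S'_def split: split_indicator)
      finally show "(\<lambda>z. (cmod (f' z))\<^sup>2 * indicator S' z) \<in> borel_measurable borel" .
      show "f ` S' \<in> sets borel" unfolding im by measurable
    qed (rule S'm)
    also have "\<dots> = emeasure (density lborel (indicator T)) B"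
    proof -
      have "emeasure (density lborel (indicator T)) B = (\<integral>\<^sup>+w. indicator (B \<inter> T) w \<partial>lborel)"
        by (subst emeasure_density, simp, simp) (intro nn_integral_cong, auto split: split_indicator)
      also have "\<dots> = emeasure lborel (B \<inter> T)"
        by (rule nn_integral_indicator) simp
      finally show ?thesis unfolding im by simp
    qed
    finally show "emeasure (distr (density lborel (\<lambda>z. ennreal (J z))) borel h) B = emeasure (density lborel (indicator T)) B" .
  qed simp
  have "(\<integral>\<^sup>+z. ennreal ((cmod (f' z))\<^sup>2) * g (f z) * indicator S z \<partial>lborel)
      = (\<integral>\<^sup>+z. ennreal (J z) * g (h z) \<partial>lborel)"
    by (intro nn_integral_cong) (auto simp: J_def h_def split: split_indicator)
  also have "\<dots> = (\<integral>\<^sup>+w. g w \<partial>distr (density lborel (\<lambda>z. ennreal (J z))) borel h)"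
    by (subst nn_integral_distr) (auto simp: nn_integral_density)
  also have "\<dots> = (\<integral>\<^sup>+w. g w * indicator T w \<partial>lborel)"
    unfolding eq by (subst nn_integral_density) (auto intro!: nn_integral_cong simp: mult.commute)
  finally show ?thesis .
qed

definition moebius :: "real \<Rightarrow> complex \<Rightarrow> complex" where
  "moebius a p = (p - of_real a) / (1 - of_real a * p)"

lemma moebius_denom_nonzero:
  assumes "\<bar>a\<bar> < 1" "cmod p < 1"
  shows "1 - of_real a * p \<noteq> 0"
proof -
  have "cmod (of_real a * p) < 1"
    using assms mult_strict_mono'[of "\<bar>a\<bar>" 1 "cmod p" 1] by (auto simp: norm_mult)
  then show ?thesis by auto
qed

lemma moebius_denom_Re_pos:
  assumes "\<bar>a\<bar> < 1" "cmod p < 1"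
  shows "Re (1 - of_real a * p) > 0"
proof -
  have "cmod (of_real a * p) < 1"
    using assms mult_strict_mono'[of "\<bar>a\<bar>" 1 "cmod p" 1] by (auto simp: norm_mult)
  then show ?thesis using complex_Re_le_cmod[of "of_real a * p"] by simp
qed

text \<open>Up to the denominator this says how far the image point is from the unit circle.\<close>
lemma moebius_norm_identity:
  "(cmod (1 - of_real a * p))\<^sup>2 - (cmod (p - of_real a))\<^sup>2 = (1 - a\<^sup>2) * (1 - (cmod p)\<^sup>2)"
  by (simp add: cmod_power2) (simp add: power2_eq_square algebra_simps)

lemma moebius_in_disc:
  assumes "\<bar>a\<bar> < 1" "cmod p < 1"
  shows "cmod (moebius a p) < 1"
proof -
  have "(1 - a\<^sup>2) * (1 - (cmod p)\<^sup>2) > 0"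
    using assms by (intro mult_pos_pos) (simp_all add: abs_square_less_1 power_less_one_iff)
  then have "(cmod (p - of_real a))\<^sup>2 < (cmod (1 - of_real a * p))\<^sup>2"
    using moebius_norm_identity[of a p] by linarith
  then have "cmod (p - of_real a) < cmod (1 - of_real a * p)"
    by (rule power_less_imp_less_base) simp
  then show ?thesis
    using moebius_denom_nonzero[OF assms] by (simp add: moebius_def norm_divide)
qed

lemma moebius_inverse:
  assumes "\<bar>a\<bar> < 1" "cmod p < 1"
  shows "moebius (- a) (moebius a p) = p"
proof -
  have n: "1 - of_real a * p \<noteq> 0" using moebius_denom_nonzero[OF assms] .
  have "a\<^sup>2 < 1" using assms by (simp add: abs_square_less_1)
  then have a: "(1 - of_real a ^ 2 :: complex) \<noteq> 0"
    by (metis eq_iff_diff_eq_0 less_irrefl of_real_1 of_real_eq_iff of_real_power)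
  have 1: "1 + of_real a * moebius a p = (1 - of_real a ^ 2) / (1 - of_real a * p)"
    using n by (simp add: moebius_def field_simps power2_eq_square)
  have 2: "moebius a p + of_real a = p * (1 - of_real a ^ 2) / (1 - of_real a * p)"
    using n by (simp add: moebius_def field_simps power2_eq_square)
  have "moebius (- a) (moebius a p) = (moebius a p + of_real a) / (1 + of_real a * moebius a p)"
    by (simp add: moebius_def[of "-a"])
  also have "\<dots> = p" unfolding 1 2 using n a by simp
  finally show ?thesis .
qed

lemma moebius_bij: "\<bar>a\<bar> < 1 \<Longrightarrow> bij_betw (moebius a) (ball 0 1) (ball 0 1)"
  by (rule bij_betw_byWitness[of _ "moebius (- a)"])
     (use moebius_inverse[of a] moebius_inverse[of "-a"] moebius_in_disc[of a] moebius_in_disc[of "-a"] in auto)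

definition moebius_deriv :: "real \<Rightarrow> complex \<Rightarrow> complex" where
  "moebius_deriv a p = of_real (1 - a\<^sup>2) / (1 - of_real a * p)\<^sup>2"

lemma moebius_has_field_derivative:
  assumes "\<bar>a\<bar> < 1" "cmod p < 1"
  shows "(moebius a has_field_derivative moebius_deriv a p) (at p)"
  unfolding moebius_def[abs_def] moebius_deriv_def
  by (rule derivative_eq_intros refl moebius_denom_nonzero[OF assms])+
     (simp add: power2_eq_square algebra_simps)

lemma nn_integral_moebius:
  assumes a: "\<bar>a\<bar> < 1" and g: "g \<in> borel_measurable borel"
  shows "(\<integral>\<^sup>+z. ennreal ((cmod (moebius_deriv a z))\<^sup>2) * g (moebius a z) * indicator (ball 0 1) z \<partial>lborel)
       = (\<integral>\<^sup>+w. g w * indicator (ball 0 1) w \<partial>lborel)"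
proof (rule nn_integral_conformal_substitution[OF _ moebius_bij[OF a] _ _ _ _ g])
  show "continuous_on (ball 0 1) (moebius_deriv a)"
    unfolding moebius_deriv_def using moebius_denom_nonzero[OF a] by (intro continuous_intros) auto
qed (use moebius_has_field_derivative[OF a] in auto)

section \<open>Holomorphic functions of several variables\<close>

definition cscale :: "complex \<Rightarrow> (complex^'n) \<times> (complex^'m) \<Rightarrow> (complex^'n) \<times> (complex^'m)" where
  "cscale c x = (c *s fst x, c *s snd x)"

lemma cscale_Pair [simp]: "cscale c (v, V) = (c *s v, c *s V)"
  by (simp add: cscale_def)

lemma holomorphic_sev_cscale:
  "holomorphic_sev f U \<longleftrightarrow>
    (\<forall>x\<in>U. \<exists>D. (f has_derivative D) (at x) \<and> (\<forall>c x. D (cscale c x) = c * D x))"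
  unfolding holomorphic_sev_def by (simp add: cscale_def)

definition holo_map ::
  "((complex^'n) \<times> (complex^'m) \<Rightarrow> (complex^'n) \<times> (complex^'m)) \<Rightarrow> ((complex^'n) \<times> (complex^'m)) set \<Rightarrow> bool" where
  "holo_map F U \<longleftrightarrow>
    (\<forall>x\<in>U. \<exists>D. (F has_derivative D) (at x) \<and> (\<forall>c x. D (cscale c x) = cscale c (D x)))"

lemma holomorphic_sev_const: "holomorphic_sev (\<lambda>x. c) U"
  unfolding holomorphic_sev_cscale by (intro ballI exI[of _ "\<lambda>x. 0"]) auto

lemma holomorphic_sev_fst_nth: "holomorphic_sev (\<lambda>x. fst x $ i) U"
  unfolding holomorphic_sev_cscale
  by (intro ballI exI[of _ "\<lambda>x. fst x $ i"])
     (auto intro!: bounded_linear_imp_has_derivative bounded_linear_compose[OF bounded_linear_vec_nth bounded_linear_fst] simp: cscale_def)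

lemma holomorphic_sev_snd_nth: "holomorphic_sev (\<lambda>x. snd x $ i) U"
  unfolding holomorphic_sev_cscale
  by (intro ballI exI[of _ "\<lambda>x. snd x $ i"])
     (auto intro!: bounded_linear_imp_has_derivative bounded_linear_compose[OF bounded_linear_vec_nth bounded_linear_snd] simp: cscale_def)

lemma holomorphic_sev_add:
  assumes "holomorphic_sev f U" "holomorphic_sev g U"
  shows "holomorphic_sev (\<lambda>x. f x + g x) U"
  unfolding holomorphic_sev_cscale
proof
  fix x assume "x \<in> U"
  with assms obtain D E where
    "(f has_derivative D) (at x)" "\<And>c x. D (cscale c x) = c * D x"
    "(g has_derivative E) (at x)" "\<And>c x. E (cscale c x) = c * E x"
    unfolding holomorphic_sev_cscale by metis
  then show "\<exists>D. ((\<lambda>x. f x + g x) has_derivative D) (at x) \<and> (\<forall>c x. D (cscale c x) = c * D x)"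
    by (intro exI[of _ "\<lambda>h. D h + E h"] conjI has_derivative_add) (auto simp: algebra_simps)
qed

lemma holomorphic_sev_mult:
  assumes "holomorphic_sev f U" "holomorphic_sev g U"
  shows "holomorphic_sev (\<lambda>x. f x * g x) U"
  unfolding holomorphic_sev_cscale
proof
  fix x assume "x \<in> U"
  with assms obtain D E where
    "(f has_derivative D) (at x)" "\<And>c x. D (cscale c x) = c * D x"
    "(g has_derivative E) (at x)" "\<And>c x. E (cscale c x) = c * E x"
    unfolding holomorphic_sev_cscale by metis
  then show "\<exists>D. ((\<lambda>x. f x * g x) has_derivative D) (at x) \<and> (\<forall>c x. D (cscale c x) = c * D x)"
    by (intro exI[of _ "\<lambda>h. f x * E h + D h * g x"] conjI has_derivative_mult) (auto simp: algebra_simps)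
qed

lemma holomorphic_sev_compose_field:
  assumes "holomorphic_sev f U" "\<And>x. x \<in> U \<Longrightarrow> (g has_field_derivative g' x) (at (f x))"
  shows "holomorphic_sev (\<lambda>x. g (f x)) U"
  unfolding holomorphic_sev_cscale
proof
  fix x assume x: "x \<in> U"
  with assms obtain D where
    D: "(f has_derivative D) (at x)" "\<And>c x. D (cscale c x) = c * D x"
    unfolding holomorphic_sev_cscale by metis
  have "((\<lambda>x. g (f x)) has_derivative (\<lambda>h. g' x * D h)) (at x)"
    using assms(2)[OF x] D(1) unfolding has_field_derivative_def
    by (metis (no_types) has_derivative_compose[of f D x UNIV g])
  then show "\<exists>D. ((\<lambda>x. g (f x)) has_derivative D) (at x) \<and> (\<forall>c x. D (cscale c x) = c * D x)"
    by (intro exI[of _ "\<lambda>h. g' x * D h"]) (auto simp: D(2))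
qed

lemma holomorphic_sev_cmult: "holomorphic_sev f U \<Longrightarrow> holomorphic_sev (\<lambda>x. c * f x) U"
  by (intro holomorphic_sev_mult holomorphic_sev_const)

lemma holomorphic_sev_diff:
  assumes "holomorphic_sev f U" "holomorphic_sev g U"
  shows "holomorphic_sev (\<lambda>x. f x - g x) U"
  using holomorphic_sev_add[OF assms(1) holomorphic_sev_cmult[OF assms(2), of "-1"]] by simp

lemma holomorphic_sev_power:
  assumes "holomorphic_sev f U"
  shows "holomorphic_sev (\<lambda>x. f x ^ n) U"
  by (induction n) (auto intro: holomorphic_sev_const holomorphic_sev_mult assms)

lemma holomorphic_sev_sum:
  assumes "\<And>i. i \<in> A \<Longrightarrow> holomorphic_sev (f i) U"
  shows "holomorphic_sev (\<lambda>x. \<Sum>i\<in>A. f i x) U"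
  using assms by (induction A rule: infinite_finite_induct)
    (auto intro: holomorphic_sev_const holomorphic_sev_add)

lemma holomorphic_sev_inverse:
  assumes "holomorphic_sev f U" "\<And>x. x \<in> U \<Longrightarrow> f x \<noteq> 0"
  shows "holomorphic_sev (\<lambda>x. inverse (f x)) U"
  by (rule holomorphic_sev_compose_field[OF assms(1)]) (use assms(2) in \<open>auto intro: DERIV_inverse\<close>)

lemma holomorphic_sev_divide:
  assumes "holomorphic_sev f U" "holomorphic_sev g U" "\<And>x. x \<in> U \<Longrightarrow> g x \<noteq> 0"
  shows "holomorphic_sev (\<lambda>x. f x / g x) U"
  unfolding divide_inverse using assms by (intro holomorphic_sev_mult holomorphic_sev_inverse)

lemmas holomorphic_sev_intros =
  holomorphic_sev_const holomorphic_sev_fst_nth holomorphic_sev_snd_nth holomorphic_sev_add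
  holomorphic_sev_diff holomorphic_sev_mult holomorphic_sev_power holomorphic_sev_sum
  holomorphic_sev_divide

lemma holomorphic_sev_cong:
  assumes "open U" "\<And>x. x \<in> U \<Longrightarrow> f x = g x" "holomorphic_sev f U"
  shows "holomorphic_sev g U"
  unfolding holomorphic_sev_def
proof
  fix x assume x: "x \<in> U"
  then obtain D where D: "(f has_derivative D) (at x)" "\<forall>c v V. D (c *s v, c *s V) = c * D (v, V)"
    using assms(3) unfolding holomorphic_sev_def by blast
  have "(g has_derivative D) (at x)"
    by (rule has_derivative_transform_within_open[OF D(1) assms(1) x assms(2)])
  with D show "\<exists>D. (g has_derivative D) (at x) \<and> (\<forall>c v V. D (c *s v, c *s V) = c * D (v, V))" by blast
qed

lemma holomorphic_sev_imp_continuous_on: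
  assumes "holomorphic_sev f U" shows "continuous_on U f"
  using assms unfolding holomorphic_sev_def
  by (meson continuous_at_imp_continuous_on has_derivative_continuous)

lemma holo_map_imp_continuous_on:
  assumes "holo_map f U" shows "continuous_on U f"
  using assms unfolding holo_map_def
  by (meson continuous_at_imp_continuous_on has_derivative_continuous)

lemma has_derivative_vec_lambda:
  fixes g :: "'i::finite \<Rightarrow> 'a::real_normed_vector \<Rightarrow> complex"
  assumes "\<And>i. (g i has_derivative g' i) (at x)"
  shows "((\<lambda>x. \<chi> i. g i x) has_derivative (\<lambda>h. \<chi> i. g' i h)) (at x)"
  unfolding has_derivative_componentwise_within[where f="\<lambda>x. \<chi> i. g i x"]
proof
  fix b :: "complex^'i" assume "b \<in> Basis"
  then obtain i u where b: "b = axis i u" by (auto simp: Basis_vec_def)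
  show "((\<lambda>x. (\<chi> i. g i x) \<bullet> b) has_derivative (\<lambda>h. (\<chi> i. g' i h) \<bullet> b)) (at x)"
    unfolding b inner_axis using has_derivative_inner_left[OF assms[of i], of u] by simp
qed

lemma holo_mapI:
  fixes F :: "(complex^'n) \<times> (complex^'m) \<Rightarrow> (complex^'n) \<times> (complex^'m)"
  assumes 1: "\<And>i. holomorphic_sev (\<lambda>x. fst (F x) $ i) U" and 2: "\<And>j. holomorphic_sev (\<lambda>x. snd (F x) $ j) U"
  shows "holo_map F U"
  unfolding holo_map_def
proof
  fix x assume x: "x \<in> U"
  have "\<exists>D. \<forall>i. ((\<lambda>x. fst (F x) $ i) has_derivative D i) (at x) \<and> (\<forall>c x. D i (cscale c x) = c * D i x)"
    using 1 x unfolding holomorphic_sev_cscale by (intro choice) blast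
  then obtain D where D: "\<And>i. ((\<lambda>x. fst (F x) $ i) has_derivative D i) (at x)" "\<And>i c x. D i (cscale c x) = c * D i x"
    by blast
  have "\<exists>E. \<forall>i. ((\<lambda>x. snd (F x) $ i) has_derivative E i) (at x) \<and> (\<forall>c x. E i (cscale c x) = c * E i x)"
    using 2 x unfolding holomorphic_sev_cscale by (intro choice) blast
  then obtain E where E: "\<And>i. ((\<lambda>x. snd (F x) $ i) has_derivative E i) (at x)" "\<And>i c x. E i (cscale c x) = c * E i x"
    by blast
  have "((\<lambda>x. (\<chi> i. fst (F x) $ i, \<chi> i. snd (F x) $ i)) has_derivative (\<lambda>h. (\<chi> i. D i h, \<chi> i. E i h))) (at x)"
    by (intro has_derivative_Pair has_derivative_vec_lambda D E)
  then have "(F has_derivative (\<lambda>h. (\<chi> i. D i h, \<chi> i. E i h))) (at x)" by simp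
  then show "\<exists>D. (F has_derivative D) (at x) \<and> (\<forall>c x. D (cscale c x) = cscale c (D x))"
    by (intro exI[of _ "\<lambda>h. (\<chi> i. D i h, \<chi> i. E i h)"]) (auto simp: D(2) E(2) vec_eq_iff)
qed

lemma holomorphic_sev_compose_map:
  assumes "holomorphic_sev f U" "holo_map F U" "\<And>x. x \<in> U \<Longrightarrow> F x \<in> U"
  shows "holomorphic_sev (\<lambda>x. f (F x)) U"
  unfolding holomorphic_sev_cscale
proof
  fix x assume x: "x \<in> U"
  obtain D where D: "(F has_derivative D) (at x)" "\<forall>c x. D (cscale c x) = cscale c (D x)"
    using assms(2) x unfolding holo_map_def by blast
  obtain E where E: "(f has_derivative E) (at (F x))" "\<forall>c x. E (cscale c x) = c * E x"
    using assms(1) assms(3)[OF x] unfolding holomorphic_sev_cscale by blast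
  show "\<exists>D. ((\<lambda>x. f (F x)) has_derivative D) (at x) \<and> (\<forall>c x. D (cscale c x) = c * D x)"
    by (intro exI[of _ "\<lambda>h. E (D h)"] conjI has_derivative_compose[OF D(1) E(1)]) (auto simp: D(2) E(2))
qed

text \<open>Restriction to an affine complex line; this is how one-variable function theory enters.\<close>
lemma holomorphic_sev_line:
  fixes f :: "(complex^'n) \<times> (complex^'m) \<Rightarrow> complex"
  assumes f: "holomorphic_sev f U" and T: "open T" "\<And>l. l \<in> T \<Longrightarrow> a + cscale l b \<in> U"
  shows "(\<lambda>l. f (a + cscale l b)) holomorphic_on T"
  unfolding holomorphic_on_def
proof
  fix l assume l: "l \<in> T"
  obtain D where D: "(f has_derivative D) (at (a + cscale l b))" "\<And>c x. D (cscale c x) = c * D x"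
    using f T(2)[OF l] unfolding holomorphic_sev_cscale by blast
  have lin: "bounded_linear (\<lambda>l. cscale l b)"
    unfolding linear_conv_bounded_linear[symmetric]
    by (rule linearI) (auto simp: cscale_def vec_eq_iff algebra_simps)
  have "((\<lambda>l. a + cscale l b) has_derivative (\<lambda>h. cscale h b)) (at l)"
    using has_derivative_add[OF has_derivative_const bounded_linear_imp_has_derivative[OF lin], of a] by simp
  from has_derivative_compose[OF this D(1)]
  have "((\<lambda>l. f (a + cscale l b)) has_derivative (\<lambda>h. D (cscale h b))) (at l)" .
  moreover have "(\<lambda>h. D (cscale h b)) = (*) (D b)" by (auto simp: D(2))
  ultimately have "((\<lambda>l. f (a + cscale l b)) has_field_derivative D b) (at l)"
    by (simp add: has_field_derivative_def)
  then show "(\<lambda>l. f (a + cscale l b)) field_differentiable at l within T"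
    using field_differentiable_at_within field_differentiable_def by blast
qed

section \<open>Bergman kernels and automorphisms\<close>

lemma bergman_space_iff:
  assumes "open U"
  shows "f \<in> bergman_space U \<longleftrightarrow>
    holomorphic_sev f U \<and> integrable (restrict_space lborel U) (\<lambda>x. (cmod (f x))\<^sup>2)"
  using assms unfolding bergman_space_def set_integrable_def by (simp add: integrable_restrict_space)

lemma set_integral_restrict_space:
  fixes f :: "'a::euclidean_space \<Rightarrow> complex"
  assumes "open U"
  shows "(LINT z:U|lborel. f z) = (\<integral>z. f z \<partial>restrict_space lborel U)"
  using assms unfolding set_lebesgue_integral_def by (simp add: integral_restrict_space)

lemma continuous_on_imp_measurable_restrict:
  fixes f :: "'a::euclidean_space \<Rightarrow> 'b::topological_space"
  assumes "continuous_on U f"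
  shows "f \<in> borel_measurable (restrict_space lborel U)"
  using borel_measurable_continuous_on_restrict[OF assms]
  by (simp add: measurable_def sets_restrict_space space_restrict_space)

text \<open>The Bergman kernel at w, one point at a time. Working with single points allows the kernel to be
transported along automorphisms without ever writing it down on the whole domain.\<close>
definition reproduces ::
  "((complex^'n) \<times> (complex^'m)) set \<Rightarrow> (complex^'n) \<times> (complex^'m) \<Rightarrow>
     ((complex^'n) \<times> (complex^'m) \<Rightarrow> complex) \<Rightarrow> bool" where
  "reproduces U w k \<longleftrightarrow> k \<in> bergman_space U \<and>
     (\<forall>f\<in>bergman_space U. f w = (LINT z:U|lborel. f z * cnj (k z)))"

lemma bergman_space_cong:
  assumes "open U" "\<And>x. x \<in> U \<Longrightarrow> f x = g x" "f \<in> bergman_space U"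
  shows "g \<in> bergman_space U"
proof -
  have "integrable (restrict_space lborel U) (\<lambda>x. (cmod (g x))\<^sup>2) \<longleftrightarrow> integrable (restrict_space lborel U) (\<lambda>x. (cmod (f x))\<^sup>2)"
    using assms by (intro Bochner_Integration.integrable_cong) (auto simp: space_restrict_space)
  then show ?thesis
    using assms holomorphic_sev_cong[OF assms(1,2)] by (simp add: bergman_space_iff)
qed

lemma bergman_space_cmult:
  assumes "open U" "f \<in> bergman_space U"
  shows "(\<lambda>x. f x * c) \<in> bergman_space U"
  using assms by (auto simp: bergman_space_iff norm_mult power_mult_distrib intro!: holomorphic_sev_mult holomorphic_sev_const)

text \<open>Both kernels reproduce, so each side is the inner product of K' at w with K at z. Taking K' = K
first and arbitrary K' afterwards yields uniqueness of the kernel with no further analysis.\<close>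
lemma bergman_kernel_hermitian:
  assumes "is_bergman_kernel U K" "is_bergman_kernel U K'" "z \<in> U" "w \<in> U"
  shows "K' z w = cnj (K w z)"
proof -
  have K: "(\<lambda>x. K x z) \<in> bergman_space U" "\<forall>f\<in>bergman_space U. f z = (LINT x:U|lborel. f x * cnj (K x z))"
    using assms(1,3) unfolding is_bergman_kernel_def by blast+
  have K': "(\<lambda>x. K' x w) \<in> bergman_space U" "\<forall>f\<in>bergman_space U. f w = (LINT x:U|lborel. f x * cnj (K' x w))"
    using assms(2,4) unfolding is_bergman_kernel_def by blast+
  have 1: "K' z w = (LINT x:U|lborel. K' x w * cnj (K x z))"
    using bspec[OF K(2) K'(1)] .
  have "K w z = (LINT x:U|lborel. K x z * cnj (K' x w))"
    using bspec[OF K'(2) K(1)] .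
  then have "cnj (K w z) = cnj (LINT x|lborel. indicator U x *\<^sub>R (K x z * cnj (K' x w)))"
    unfolding set_lebesgue_integral_def by simp
  also have "\<dots> = (LINT x|lborel. cnj (indicator U x *\<^sub>R (K x z * cnj (K' x w))))"
    by (rule Bochner_Integration.integral_cnj[symmetric])
  also have "\<dots> = (LINT x:U|lborel. K' x w * cnj (K x z))"
    unfolding set_lebesgue_integral_def by (simp add: mult.commute)
  finally show ?thesis using 1 by simp
qed

lemma bergman_kernel_eqI:
  assumes U: "open U" and k: "\<And>w. w \<in> U \<Longrightarrow> reproduces U w (k w)" and zw: "z \<in> U" "w \<in> U"
  shows "bergman_kernel U z w = k w z"
proof -
  define K where "K = (\<lambda>z w. if z \<in> U \<and> w \<in> U then k w z else 0)"
  have K: "is_bergman_kernel U K"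
    unfolding is_bergman_kernel_def
  proof (intro ballI conjI)
    fix w assume w: "w \<in> U"
    show "(\<lambda>z. K z w) \<in> bergman_space U"
      using bergman_space_cong[OF U, of "k w" "\<lambda>z. K z w"] k[OF w] w by (auto simp: K_def reproduces_def)
    fix f assume "f \<in> bergman_space U"
    then have "f w = (LINT z:U|lborel. f z * cnj (k w z))" using k[OF w] by (auto simp: reproduces_def)
    also have "\<dots> = (LINT z:U|lborel. f z * cnj (K z w))"
      using U w by (intro set_lebesgue_integral_cong) (auto simp: K_def)
    finally show "f w = (LINT z:U|lborel. f z * cnj (K z w))" .
  qed
  have "bergman_kernel U = K"
    unfolding bergman_kernel_def
  proof (rule the_equality)
    show "is_bergman_kernel U K \<and> (\<forall>z w. z \<notin> U \<or> w \<notin> U \<longrightarrow> K z w = 0)"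
      using K by (auto simp: K_def)
    fix K' assume K': "is_bergman_kernel U K' \<and> (\<forall>z w. z \<notin> U \<or> w \<notin> U \<longrightarrow> K' z w = 0)"
    show "K' = K"
    proof (intro ext)
      fix z w show "K' z w = K z w"
      proof (cases "z \<in> U \<and> w \<in> U")
        case True
        then show ?thesis
          using bergman_kernel_hermitian[OF K, of K' z w] bergman_kernel_hermitian[OF K K, of z w] K' by simp
      next
        case False
        then have "K' z w = 0" "K z w = 0" using K' by (blast, auto simp: K_def)
        then show ?thesis by simp
      qed
    qed
  qed
  then show ?thesis using zw by (simp add: K_def)
qed

text \<open>The integral identity says that |J|^2 is the real Jacobian of F without mentioning determinants.\<close>
definition bihol_aut ::
  "((complex^'n) \<times> (complex^'m)) set \<Rightarrow> ((complex^'n) \<times> (complex^'m) \<Rightarrow> (complex^'n) \<times> (complex^'m)) \<Rightarrow>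
   ((complex^'n) \<times> (complex^'m) \<Rightarrow> (complex^'n) \<times> (complex^'m)) \<Rightarrow> ((complex^'n) \<times> (complex^'m) \<Rightarrow> complex) \<Rightarrow> bool" where
  "bihol_aut U F G J \<longleftrightarrow>
     (\<forall>x\<in>U. F x \<in> U \<and> G (F x) = x \<and> J x \<noteq> 0) \<and> (\<forall>x\<in>U. G x \<in> U \<and> F (G x) = x) \<and>
     holo_map F U \<and> holo_map G U \<and> holomorphic_sev J U \<and>
     (\<forall>g\<in>borel_measurable borel. (\<integral>\<^sup>+x. ennreal ((cmod (J x))\<^sup>2) * g (F x) * indicator U x \<partial>lborel)
        = (\<integral>\<^sup>+x. g x * indicator U x \<partial>lborel))"

lemma bihol_aut_inverse:
  assumes U: "open U" and aut: "bihol_aut U F G J"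
  shows "bihol_aut U G F (\<lambda>x. inverse (J (G x)))"
  unfolding bihol_aut_def
proof (intro conjI ballI)
  have F: "\<And>x. x \<in> U \<Longrightarrow> F x \<in> U" "\<And>x. x \<in> U \<Longrightarrow> G (F x) = x" "\<And>x. x \<in> U \<Longrightarrow> J x \<noteq> 0"
    and G: "\<And>x. x \<in> U \<Longrightarrow> G x \<in> U" "\<And>x. x \<in> U \<Longrightarrow> F (G x) = x"
    and hol: "holo_map F U" "holo_map G U" "holomorphic_sev J U"
    and int: "\<And>g. g \<in> borel_measurable borel \<Longrightarrow>
      (\<integral>\<^sup>+x. ennreal ((cmod (J x))\<^sup>2) * g (F x) * indicator U x \<partial>lborel) = (\<integral>\<^sup>+x. g x * indicator U x \<partial>lborel)"
    using aut unfolding bihol_aut_def by blast+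
  show "holo_map F U" "holo_map G U" by fact+
  have JG: "holomorphic_sev (\<lambda>x. J (G x)) U"
    by (rule holomorphic_sev_compose_map[OF hol(3) hol(2) G(1)])
  show hJG: "holomorphic_sev (\<lambda>x. inverse (J (G x))) U"
    by (rule holomorphic_sev_inverse[OF JG]) (use F G in auto)
  fix g :: "(complex^'a) \<times> (complex^'b) \<Rightarrow> ennreal" assume g [measurable]: "g \<in> borel_measurable borel"
  have [measurable]: "U \<in> sets borel" using U by auto
  define G' where "G' = (\<lambda>x. if x \<in> U then G x else 0)"
  have [measurable]: "G' \<in> borel_measurable borel"
    unfolding G'_def using holo_map_imp_continuous_on[OF hol(2)] by (intro borel_measurable_continuous_on_if) auto
  define J' where "J' = (\<lambda>x. if x \<in> U then inverse (J (G x)) else 0)"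
  have [measurable]: "J' \<in> borel_measurable borel"
    unfolding J'_def using holomorphic_sev_imp_continuous_on[OF hJG] by (intro borel_measurable_continuous_on_if) auto
  \<comment> \<open>apply the substitution rule of F to the integrand on the other side\<close>
  define h where "h = (\<lambda>x. ennreal ((cmod (J' x))\<^sup>2) * g (G' x))"
  have hm: "h \<in> borel_measurable borel" unfolding h_def by measurable
  have "(\<integral>\<^sup>+x. ennreal ((cmod (inverse (J (G x))))\<^sup>2) * g (G x) * indicator U x \<partial>lborel)
      = (\<integral>\<^sup>+x. h x * indicator U x \<partial>lborel)"
    by (intro nn_integral_cong) (auto simp: h_def J'_def G'_def split: split_indicator)
  also have "\<dots> = (\<integral>\<^sup>+x. ennreal ((cmod (J x))\<^sup>2) * h (F x) * indicator U x \<partial>lborel)"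
    by (rule int[OF hm, symmetric])
  also have "\<dots> = (\<integral>\<^sup>+x. g x * indicator U x \<partial>lborel)"
  proof (intro nn_integral_cong)
    fix x
    show "ennreal ((cmod (J x))\<^sup>2) * h (F x) * indicator U x = g x * indicator U x"
    proof (cases "x \<in> U")
      case True
      have "ennreal ((cmod (J x))\<^sup>2) * (ennreal ((cmod (inverse (J x)))\<^sup>2) * g x)
          = ennreal ((cmod (J x))\<^sup>2 * (cmod (inverse (J x)))\<^sup>2) * g x"
        by (simp only: ennreal_mult' zero_le_power2 mult.assoc)
      also have "(cmod (J x))\<^sup>2 * (cmod (inverse (J x)))\<^sup>2 = 1"
        using F(3)[OF True] by (simp add: norm_inverse power_mult_distrib[symmetric])
      finally show ?thesis using True F by (simp add: h_def J'_def G'_def)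
    qed simp
  qed
  finally show "(\<integral>\<^sup>+x. ennreal ((cmod (inverse (J (G x))))\<^sup>2) * g (G x) * indicator U x \<partial>lborel)
      = (\<integral>\<^sup>+x. g x * indicator U x \<partial>lborel)" .
next
  show "\<And>x. x \<in> U \<Longrightarrow> G x \<in> U" "\<And>x. x \<in> U \<Longrightarrow> F (G x) = x" "\<And>x. x \<in> U \<Longrightarrow> F x \<in> U" "\<And>x. x \<in> U \<Longrightarrow> G (F x) = x"
    "\<And>x. x \<in> U \<Longrightarrow> inverse (J (G x)) \<noteq> 0"
    using aut unfolding bihol_aut_def by auto
qed

text \<open>The substitution rule as an identity of measures, which makes it available for integrals of
arbitrary integrable functions.\<close>
lemma bihol_aut_distr:
  assumes U: "open U" and aut: "bihol_aut U F G J"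
  defines "M \<equiv> restrict_space lborel U"
  shows "distr (density M (\<lambda>x. ennreal ((cmod (J x))\<^sup>2))) M F = M"
    and "F \<in> measurable M M" and "J \<in> borel_measurable M"
proof -
  have F: "\<And>x. x \<in> U \<Longrightarrow> F x \<in> U"
    and hol: "holo_map F U" "holomorphic_sev J U"
    and int: "\<And>g. g \<in> borel_measurable borel \<Longrightarrow>
      (\<integral>\<^sup>+x. ennreal ((cmod (J x))\<^sup>2) * g (F x) * indicator U x \<partial>lborel) = (\<integral>\<^sup>+x. g x * indicator U x \<partial>lborel)"
    using aut unfolding bihol_aut_def by blast+
  have Um: "U \<in> sets lborel" using U by auto
  show Jm [measurable]: "J \<in> borel_measurable M"
    unfolding M_def using holomorphic_sev_imp_continuous_on[OF hol(2)] by (rule continuous_on_imp_measurable_restrict)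
  show Fm [measurable]: "F \<in> measurable M M"
    unfolding M_def
  proof (rule measurable_restrict_space2)
    show "F \<in> space (restrict_space lborel U) \<rightarrow> U" using F by (auto simp: space_restrict_space)
    have "F \<in> borel_measurable (restrict_space lborel U)"
      using holo_map_imp_continuous_on[OF hol(1)] by (rule continuous_on_imp_measurable_restrict)
    then show "F \<in> restrict_space lborel U \<rightarrow>\<^sub>M lborel" by simp
  qed
  show "distr (density M (\<lambda>x. ennreal ((cmod (J x))\<^sup>2))) M F = M"
  proof (rule measure_eqI)
    fix A assume "A \<in> sets (distr (density M (\<lambda>x. ennreal ((cmod (J x))\<^sup>2))) M F)"
    then have A: "A \<in> sets M" by simp
    then have A': "A \<in> sets borel" "A \<subseteq> U"
      using U unfolding M_def by (auto simp: sets_restrict_space_iff)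
    have "emeasure (distr (density M (\<lambda>x. ennreal ((cmod (J x))\<^sup>2))) M F) A
        = (\<integral>\<^sup>+x. ennreal ((cmod (J x))\<^sup>2) * indicator (F -` A \<inter> space M) x \<partial>M)"
      using A measurable_sets[OF Fm A] by (subst emeasure_distr) (auto simp: emeasure_density)
    also have "\<dots> = (\<integral>\<^sup>+x. ennreal ((cmod (J x))\<^sup>2) * indicator A (F x) \<partial>M)"
      by (intro nn_integral_cong) (auto split: split_indicator)
    also have "\<dots> = (\<integral>\<^sup>+x. ennreal ((cmod (J x))\<^sup>2) * indicator A (F x) * indicator U x \<partial>lborel)"
      unfolding M_def using Um by (subst nn_integral_restrict_space) auto
    also have "\<dots> = (\<integral>\<^sup>+x. indicator A x * indicator U x \<partial>lborel)"
      by (rule int) (use A' in auto)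
    also have "\<dots> = (\<integral>\<^sup>+x. indicator A x \<partial>lborel)"
      using A' by (intro nn_integral_cong) (auto split: split_indicator)
    also have "\<dots> = emeasure lborel A"
      by (rule nn_integral_indicator) (use A' in simp)
    also have "\<dots> = emeasure M A"
      unfolding M_def using A' Um by (subst emeasure_restrict_space) auto
    finally show "emeasure (distr (density M (\<lambda>x. ennreal ((cmod (J x))\<^sup>2))) M F) A = emeasure M A" .
  qed simp
qed

lemma bihol_aut_integral:
  fixes f :: "(complex^'n) \<times> (complex^'m) \<Rightarrow> 'b::{banach, second_countable_topology}"
  assumes U: "open U" and aut: "bihol_aut U F G J"
  defines "M \<equiv> restrict_space lborel U"
  assumes f [measurable]: "f \<in> borel_measurable M"
  shows "integrable M (\<lambda>x. (cmod (J x))\<^sup>2 *\<^sub>R f (F x)) \<longleftrightarrow> integrable M f"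
    and "(\<integral>x. (cmod (J x))\<^sup>2 *\<^sub>R f (F x) \<partial>M) = (\<integral>x. f x \<partial>M)"
proof -
  note d = bihol_aut_distr[OF U aut, folded M_def]
  have [measurable]: "F \<in> measurable M M" "J \<in> borel_measurable M" by (fact d)+
  have "integrable M f \<longleftrightarrow> integrable (distr (density M (\<lambda>x. ennreal ((cmod (J x))\<^sup>2))) M F) f"
    by (simp only: d)
  also have "\<dots> \<longleftrightarrow> integrable (density M (\<lambda>x. ennreal ((cmod (J x))\<^sup>2))) (\<lambda>x. f (F x))"
    by (rule integrable_distr_eq) simp_all
  also have "\<dots> \<longleftrightarrow> integrable M (\<lambda>x. (cmod (J x))\<^sup>2 *\<^sub>R f (F x))"
    by (rule integrable_density) simp_all
  finally show "integrable M (\<lambda>x. (cmod (J x))\<^sup>2 *\<^sub>R f (F x)) \<longleftrightarrow> integrable M f" ..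
  have "(\<integral>x. f x \<partial>M) = (\<integral>x. f x \<partial>distr (density M (\<lambda>x. ennreal ((cmod (J x))\<^sup>2))) M F)"
    by (simp only: d)
  also have "\<dots> = (\<integral>x. f (F x) \<partial>density M (\<lambda>x. ennreal ((cmod (J x))\<^sup>2)))"
    by (rule integral_distr) simp_all
  also have "\<dots> = (\<integral>x. (cmod (J x))\<^sup>2 *\<^sub>R f (F x) \<partial>M)"
    by (rule integral_density) simp_all
  finally show "(\<integral>x. (cmod (J x))\<^sup>2 *\<^sub>R f (F x) \<partial>M) = (\<integral>x. f x \<partial>M)" ..
qed

lemma bihol_aut_bergman_space:
  assumes U: "open U" and aut: "bihol_aut U F G J" and f: "f \<in> bergman_space U"
  shows "(\<lambda>x. f (F x) * J x) \<in> bergman_space U"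
proof -
  have hol: "holo_map F U" "holomorphic_sev J U" "\<And>x. x \<in> U \<Longrightarrow> F x \<in> U"
    using aut unfolding bihol_aut_def by blast+
  have f': "holomorphic_sev f U" "integrable (restrict_space lborel U) (\<lambda>x. (cmod (f x))\<^sup>2)"
    using f bergman_space_iff[OF U] by blast+
  have m: "(\<lambda>x. (cmod (f x))\<^sup>2) \<in> borel_measurable (restrict_space lborel U)"
    using f'(2) by (rule borel_measurable_integrable)
  have "integrable (restrict_space lborel U) (\<lambda>x. (cmod (J x))\<^sup>2 *\<^sub>R (cmod (f (F x)))\<^sup>2)"
    using bihol_aut_integral(1)[OF U aut m] f'(2) by simp
  then have "integrable (restrict_space lborel U) (\<lambda>x. (cmod (f (F x) * J x))\<^sup>2)"
    by (simp add: norm_mult power_mult_distrib mult.commute)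
  moreover have "holomorphic_sev (\<lambda>x. f (F x) * J x) U"
    by (intro holomorphic_sev_mult holomorphic_sev_compose_map[OF f'(1)] hol)
  ultimately show ?thesis using bergman_space_iff[OF U] by blast
qed

text \<open>The transformation law of the Bergman kernel. For f in the Bergman space, f = (f' \<circ> F) J for the
function f' = (f \<circ> G) / (J \<circ> G), which is again square integrable; reproduce f' at F y and
substitute x by F x.\<close>
lemma reproduces_pullback:
  assumes U: "open U" and aut: "bihol_aut U F G J" and y: "y \<in> U" and k: "reproduces U (F y) k"
  shows "reproduces U y (\<lambda>x. k (F x) * J x * cnj (J y))"
  unfolding reproduces_def
proof (intro conjI ballI)
  let ?M = "restrict_space lborel U"
  have F: "\<And>x. x \<in> U \<Longrightarrow> F x \<in> U" "\<And>x. x \<in> U \<Longrightarrow> G (F x) = x" "\<And>x. x \<in> U \<Longrightarrow> J x \<noteq> 0"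
    using aut unfolding bihol_aut_def by blast+
  have k': "k \<in> bergman_space U" "\<And>f. f \<in> bergman_space U \<Longrightarrow> f (F y) = (LINT z:U|lborel. f z * cnj (k z))"
    using k unfolding reproduces_def by blast+
  show "(\<lambda>x. k (F x) * J x * cnj (J y)) \<in> bergman_space U"
    by (intro bergman_space_cmult[OF U] bihol_aut_bergman_space[OF U aut k'(1)])
  fix f assume f: "f \<in> bergman_space U"
  define f' where "f' = (\<lambda>x. f (G x) * inverse (J (G x)))"
  have f': "f' \<in> bergman_space U"
    unfolding f'_def by (rule bihol_aut_bergman_space[OF U bihol_aut_inverse[OF U aut] f])
  have m: "(\<lambda>x. f' x * cnj (k x)) \<in> borel_measurable ?M"
    using f' k'(1) unfolding bergman_space_iff[OF U]
    by (intro continuous_on_imp_measurable_restrict continuous_intros holomorphic_sev_imp_continuous_on) blast+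
  have "f y = f' (F y) * J y"
    using F y by (simp add: f'_def)
  also have "f' (F y) = (\<integral>x. f' x * cnj (k x) \<partial>?M)"
    using k'(2)[OF f'] by (simp add: set_integral_restrict_space[OF U])
  also have "\<dots> = (\<integral>x. (cmod (J x))\<^sup>2 *\<^sub>R (f' (F x) * cnj (k (F x))) \<partial>?M)"
    by (rule bihol_aut_integral(2)[OF U aut m, symmetric])
  also have "\<dots> = (\<integral>x. f x * cnj (k (F x) * J x) \<partial>?M)"
  proof (rule Bochner_Integration.integral_cong)
    fix x assume "x \<in> space ?M"
    then have x: "x \<in> U" by (simp add: space_restrict_space)
    have "(cmod (J x))\<^sup>2 *\<^sub>R (f' (F x) * cnj (k (F x))) = (J x * cnj (J x)) * (f' (F x) * cnj (k (F x)))"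
      by (simp only: scaleR_conv_of_real complex_norm_square)
    also have "\<dots> = f x * cnj (k (F x) * J x)"
      using F[OF x] by (simp add: f'_def)
    finally show "(cmod (J x))\<^sup>2 *\<^sub>R (f' (F x) * cnj (k (F x))) = f x * cnj (k (F x) * J x)" .
  qed simp
  also have "(\<integral>x. f x * cnj (k (F x) * J x) \<partial>?M) * J y = (\<integral>x. f x * cnj (k (F x) * J x * cnj (J y)) \<partial>?M)"
    by (subst Bochner_Integration.integral_mult_left_zero[symmetric]) (simp add: mult_ac)
  finally show "f y = (LINT z:U|lborel. f z * cnj (k (F z) * J z * cnj (J y)))"
    by (simp add: set_integral_restrict_space[OF U])
qed

section \<open>The Lie ball in matrix coordinates\<close>

text \<open>The coordinates p = z1 + i z2, s = z3, q = z1 - i z2 realise the Lie ball of dimension 3 as a domain of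
symmetric matrices with diagonal entries p, -q and off-diagonal entry s: z . z = p q + s^2 is minus the
determinant, and the generic norm is det (I - Z Z*).\<close>
definition lie_pt :: "complex \<Rightarrow> complex \<Rightarrow> complex \<Rightarrow> complex^3" where
  "lie_pt p s q = vector [(p + q) / 2, (p - q) / (2 * \<i>), s]"
definition coord_p :: "complex^3 \<Rightarrow> complex" where "coord_p z = z $ 1 + \<i> * z $ 2"
definition coord_s :: "complex^3 \<Rightarrow> complex" where "coord_s z = z $ 3"
definition coord_q :: "complex^3 \<Rightarrow> complex" where "coord_q z = z $ 1 - \<i> * z $ 2"

lemma coords_lie_pt [simp]: "coord_p (lie_pt p s q) = p" "coord_s (lie_pt p s q) = s" "coord_q (lie_pt p s q) = q"
  by (simp_all add: lie_pt_def coord_p_def coord_s_def coord_q_def field_simps)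

lemma lie_pt_coords [simp]: "lie_pt (coord_p z) (coord_s z) (coord_q z) = z"
  by (simp add: lie_pt_def coord_p_def coord_s_def coord_q_def vec_eq_iff forall_3)

lemma norm_vec_sq: "(norm (z :: complex^'n))\<^sup>2 = (\<Sum>i\<in>UNIV. (cmod (z $ i))\<^sup>2)"
  by (simp add: norm_vec_def L2_set_def sum_nonneg)

lemma norm_coords: "2 * (norm z)\<^sup>2 = (cmod (coord_p z))\<^sup>2 + (cmod (coord_q z))\<^sup>2 + 2 * (cmod (coord_s z))\<^sup>2"
  by (simp add: norm_vec_sq sum_3 coord_p_def coord_q_def coord_s_def cmod_power2) (simp add: power2_eq_square algebra_simps)

lemma dot_coords: "(\<Sum>i\<in>UNIV. (z $ i)\<^sup>2) = coord_p z * coord_q z + (coord_s z)\<^sup>2" for z :: "complex^3"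
  by (simp add: sum_3 coord_p_def coord_q_def coord_s_def power2_eq_square algebra_simps)

lemma lie_norm_coords:
  "lie_norm z = 1 - (cmod (coord_p z))\<^sup>2 - (cmod (coord_q z))\<^sup>2 - 2 * (cmod (coord_s z))\<^sup>2 + (cmod (coord_p z * coord_q z + (coord_s z)\<^sup>2))\<^sup>2"
  for z :: "complex^3"
  using norm_coords[of z] unfolding lie_norm_def dot_coords by simp

text \<open>Two expansions of det (I - Z Z*). The first completes the square in q and exhibits the points of
the ball over fixed p and s as a disc; the second is the determinant of the Hermitian matrix itself.\<close>
lemma lie_norm_fibre_disc:
  "(1 - (cmod (coord_p z))\<^sup>2) * lie_norm z
     = (1 - (cmod (coord_p z))\<^sup>2 - (cmod (coord_s z))\<^sup>2)\<^sup>2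
       - (cmod (of_real (1 - (cmod (coord_p z))\<^sup>2) * coord_q z - cnj (coord_p z) * (coord_s z)\<^sup>2))\<^sup>2" (is ?A)
  "lie_norm z = (1 - (cmod (coord_p z))\<^sup>2 - (cmod (coord_s z))\<^sup>2) * (1 - (cmod (coord_s z))\<^sup>2 - (cmod (coord_q z))\<^sup>2)
       - (cmod (coord_p z * cnj (coord_s z) - coord_s z * cnj (coord_q z)))\<^sup>2" (is ?B)
proof -
  obtain a b c d e f where pqs: "coord_p z = Complex a b" "coord_s z = Complex c d" "coord_q z = Complex e f"
    by (metis complex.exhaust)
  define k where "k = 1 - (cmod (coord_p z))\<^sup>2"
  have k: "k = 1 - (a\<^sup>2 + b\<^sup>2)" unfolding k_def pqs by (simp add: cmod_power2)
  have "k * lie_norm z = (k - (cmod (coord_s z))\<^sup>2)\<^sup>2 - (cmod (of_real k * coord_q z - cnj (coord_p z) * (coord_s z)\<^sup>2))\<^sup>2"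
    unfolding lie_norm_coords pqs by (simp add: cmod_power2 Re_power2 Im_power2) (use k in algebra)
  then show ?A unfolding k_def .
  show ?B
    unfolding lie_norm_coords pqs by (simp add: cmod_power2 Re_power2 Im_power2) algebra
qed

text \<open>A Hermitian 2 by 2 matrix with positive determinant is positive definite as soon as its trace, or
one of its diagonal entries, is positive.\<close>
lemma lie_ball_coords:
  "z \<in> lie_ball \<longleftrightarrow> (cmod (coord_p z))\<^sup>2 + (cmod (coord_s z))\<^sup>2 < 1 \<and> lie_norm z > 0" for z :: "complex^3"
proof -
  define A where "A = 1 - (cmod (coord_p z))\<^sup>2 - (cmod (coord_s z))\<^sup>2"
  define B where "B = 1 - (cmod (coord_s z))\<^sup>2 - (cmod (coord_q z))\<^sup>2"
  have n: "norm z < 1 \<longleftrightarrow> A + B > 0"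
  proof -
    have "norm z < 1 \<longleftrightarrow> (norm z)\<^sup>2 < 1" by (simp add: power_less_one_iff)
    then show ?thesis using norm_coords[of z] unfolding A_def B_def by linarith
  qed
  have N: "lie_norm z > 0 \<Longrightarrow> A * B > 0"
    using lie_norm_fibre_disc(2)[of z] zero_le_power2[of "cmod (coord_p z * cnj (coord_s z) - coord_s z * cnj (coord_q z))"]
    unfolding A_def B_def by linarith
  show ?thesis
    unfolding lie_ball_def mem_Collect_eq n
  proof (intro iffI conjI)
    assume h: "A + B > 0 \<and> lie_norm z > 0"
    then have "A * B > 0" "A + B > 0" using N by auto
    then have "A > 0" by (smt (verit) mult_neg_neg zero_less_mult_iff)
    then show "(cmod (coord_p z))\<^sup>2 + (cmod (coord_s z))\<^sup>2 < 1" unfolding A_def by simp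
    show "lie_norm z > 0" using h by simp
  next
    assume h: "(cmod (coord_p z))\<^sup>2 + (cmod (coord_s z))\<^sup>2 < 1 \<and> lie_norm z > 0"
    then have "A > 0" "A * B > 0" using N unfolding A_def by auto
    then show "A + B > 0" by (simp add: zero_less_mult_iff)
    show "lie_norm z > 0" using h by simp
  qed
qed

lemma lie_ball_coord_p: "z \<in> lie_ball \<Longrightarrow> cmod (coord_p z) < 1" for z :: "complex^3"
  using lie_ball_coords[of z] by (smt (verit) norm_ge_zero one_le_power zero_le_power2)

section \<open>Shape of the Hartogs domain\<close>

text \<open>Along a ray the generic norm decreases, since |z . z| \<le> |z|^2 < 1. Hence the domain is star-shaped,
and rotations in z can be extended to discs inside the domain.\<close>
lemma lie_norm_scale_mono:
  assumes "norm z < 1" "0 \<le> t" "t \<le> 1"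
  shows "lie_norm z \<le> lie_norm (t *\<^sub>R z)"
proof -
  define n where "n = (norm z)\<^sup>2"
  define d where "d = (cmod (\<Sum>i\<in>UNIV. (z $ i)\<^sup>2))\<^sup>2"
  have n: "0 \<le> n" "n < 1" unfolding n_def using assms by (simp_all add: power_less_one_iff)
  have "cmod (\<Sum>i\<in>UNIV. (z $ i)\<^sup>2) \<le> (\<Sum>i\<in>UNIV. cmod ((z $ i)\<^sup>2))" by (rule norm_sum)
  also have "\<dots> = n" unfolding n_def norm_vec_sq by (simp add: norm_power)
  finally have "d \<le> n\<^sup>2" unfolding d_def by (intro power_mono) auto
  also have "n\<^sup>2 \<le> n" using n by (simp add: power2_eq_square mult_left_le)
  finally have d: "d \<le> n" .
  have d0: "0 \<le> d" unfolding d_def by simp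
  define T where "T = t\<^sup>2"
  have T: "0 \<le> T" "T \<le> 1" unfolding T_def using assms by (simp_all add: power_le_one)
  have "((t *\<^sub>R z) $ i)\<^sup>2 = of_real T * (z $ i)\<^sup>2" for i
    by (subst vector_scaleR_component) (simp add: scaleR_conv_of_real power_mult_distrib T_def)
  then have "(\<Sum>i\<in>UNIV. ((t *\<^sub>R z) $ i)\<^sup>2) = of_real T * (\<Sum>i\<in>UNIV. (z $ i)\<^sup>2)"
    by (simp only: sum_distrib_left)
  then have "lie_norm (t *\<^sub>R z) = 1 - 2 * T * n + T\<^sup>2 * d"
    unfolding lie_norm_def n_def d_def T_def by (simp add: norm_mult power_mult_distrib norm_power)
  moreover have "lie_norm z = 1 - 2 * n + d" unfolding lie_norm_def n_def d_def by simp
  moreover have "(1 - 2 * T * n + T\<^sup>2 * d) - (1 - 2 * n + d) = (1 - T) * (2 * n - (1 + T) * d)"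
    by (simp add: power2_eq_square algebra_simps)
  moreover have "(1 + T) * d \<le> 2 * n"
    using mult_mono[of "1 + T" 2 d n] T d d0 by simp
  ultimately show ?thesis using T by (smt (verit) mult_nonneg_nonneg)
qed

lemma lie_ball_scale:
  assumes "z \<in> lie_ball" "0 \<le> t" "t \<le> 1"
  shows "t *\<^sub>R z \<in> lie_ball"
  using assms lie_norm_scale_mono[of z t] mult_left_le_one_le[of "norm z" t]
  by (auto simp: lie_ball_def)

lemma continuous_lie_norm: "continuous_on A (lie_norm :: complex^'n \<Rightarrow> real)"
  unfolding lie_norm_def by (intro continuous_intros)

lemma open_lie_ball: "open (lie_ball :: (complex^'n) set)"
proof -
  have "lie_ball = ball 0 1 \<inter> {z :: complex^'n. 0 < lie_norm z}"
    by (auto simp: lie_ball_def)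
  moreover have "open (ball (0 :: complex^'n) 1 \<inter> {z. 0 < lie_norm z})"
    by (intro open_Int open_ball open_Collect_less continuous_lie_norm continuous_on_const)
  ultimately show ?thesis by simp
qed

lemma hartogs_lie_iff:
  "(z, Z) \<in> hartogs_lie \<mu> \<longleftrightarrow> z \<in> lie_ball \<and> (norm Z)\<^sup>2 < lie_norm z powr \<mu>"
  by (simp add: hartogs_lie_def)

lemma open_hartogs_lie: "open (hartogs_lie \<mu> :: ((complex^'n) \<times> (complex^'m)) set)"
proof -
  let ?L = "fst -` lie_ball :: ((complex^'n) \<times> (complex^'m)) set"
  have o: "open ?L" by (intro open_vimage open_lie_ball continuous_on_fst continuous_on_id)
  have "continuous_on ?L (\<lambda>x. lie_norm (fst x) powr \<mu> - (norm (snd x))\<^sup>2)"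
    by (intro continuous_intros continuous_on_compose2[OF continuous_lie_norm[of UNIV]] continuous_on_powr)
       (auto simp: lie_ball_def)
  then have "open (?L \<inter> (\<lambda>x. lie_norm (fst x) powr \<mu> - (norm (snd x))\<^sup>2) -` {0<..})"
    by (rule continuous_open_preimage[OF _ o]) auto
  also have "?L \<inter> (\<lambda>x. lie_norm (fst x) powr \<mu> - (norm (snd x))\<^sup>2) -` {0<..} = hartogs_lie \<mu>"
    by (auto simp: hartogs_lie_def)
  finally show ?thesis .
qed

lemma lie_norm_0 [simp]: "lie_norm 0 = 1"
  by (simp add: lie_norm_def)

lemma zero_in_lie_ball [simp]: "0 \<in> lie_ball"
  by (simp add: lie_ball_def)

lemma lie_norm_le_1: "norm z < 1 \<Longrightarrow> lie_norm z \<le> 1"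
  using lie_norm_scale_mono[of z 0] by simp

lemma hartogs_lie_base_iff: "(0, Z) \<in> hartogs_lie \<mu> \<longleftrightarrow> norm Z < 1"
  by (simp add: hartogs_lie_iff power_less_one_iff)

lemma hartogs_lie_snd_norm:
  assumes "x \<in> hartogs_lie \<mu>" "\<mu> > 0" shows "norm (snd x) < 1"
proof -
  obtain z Z where x: "x = (z, Z)" by (cases x)
  have z: "z \<in> lie_ball" "(norm Z)\<^sup>2 < lie_norm z powr \<mu>" using assms x by (auto simp: hartogs_lie_iff)
  then have "lie_norm z powr \<mu> \<le> 1 powr \<mu>"
    using lie_norm_le_1 assms(2) by (intro powr_mono2) (auto simp: lie_ball_def)
  then have "(norm Z)\<^sup>2 < 1" using z by simp
  then show ?thesis using x by (simp add: power_less_one_iff)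
qed

lemma hartogs_lie_scale:
  assumes "(z, Z) \<in> hartogs_lie \<mu>" "\<mu> > 0" "0 \<le> t" "t \<le> 1" "norm Z' \<le> norm Z"
  shows "(t *\<^sub>R z, Z') \<in> hartogs_lie \<mu>"
proof -
  have z: "z \<in> lie_ball" "(norm Z)\<^sup>2 < lie_norm z powr \<mu>" using assms by (auto simp: hartogs_lie_iff)
  have "(norm Z')\<^sup>2 \<le> (norm Z)\<^sup>2" using assms(5) by (intro power_mono) auto
  also have "\<dots> < lie_norm z powr \<mu>" by fact
  also have "\<dots> \<le> lie_norm (t *\<^sub>R z) powr \<mu>"
    using z assms lie_norm_scale_mono[of z t] by (intro powr_mono2) (auto simp: lie_ball_def)
  finally show ?thesis using lie_ball_scale[OF z(1) assms(3,4)] by (simp add: hartogs_lie_iff)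
qed

lemma connected_hartogs_lie:
  assumes "\<mu> > 0" shows "connected (hartogs_lie \<mu> :: ((complex^'n) \<times> (complex^'m)) set)"
proof (rule starlike_imp_connected, unfold starlike_def, rule bexI[of _ 0], rule ballI)
  show "0 \<in> (hartogs_lie \<mu> :: ((complex^'n) \<times> (complex^'m)) set)"
    using hartogs_lie_base_iff[of 0] by (simp add: zero_prod_def)
  fix x :: "(complex^'n) \<times> (complex^'m)" assume x: "x \<in> hartogs_lie \<mu>"
  obtain z Z where xz: "x = (z, Z)" by (cases x)
  show "closed_segment 0 x \<subseteq> hartogs_lie \<mu>"
  proof
    fix y assume "y \<in> closed_segment 0 x"
    then obtain t where t: "y = t *\<^sub>R x" "0 \<le> t" "t \<le> 1" by (auto simp: closed_segment_def)
    then have y: "y = (t *\<^sub>R z, t *\<^sub>R Z)" using xz by simp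
    show "y \<in> hartogs_lie \<mu>"
      unfolding y using t x assms mult_left_le_one_le[of "norm Z" t] by (intro hartogs_lie_scale[of z Z]) (auto simp: xz)
  qed
qed

section \<open>The Moebius automorphisms of the Hartogs domain\<close>

text \<open>The automorphism of the Lie ball that acts on the diagonal entry p by a Moebius map of the disc.
It is triangular in p, s, q, so that its Jacobian and the substitution rule follow from Fubini.\<close>
definition lie_moebius :: "real \<Rightarrow> complex^3 \<Rightarrow> complex^3" where
  "lie_moebius a z = lie_pt (moebius a (coord_p z)) (of_real (sqrt (1 - a\<^sup>2)) * coord_s z / (1 - of_real a * coord_p z))
                (coord_q z - of_real a * (coord_s z)\<^sup>2 / (1 - of_real a * coord_p z))"

lemma abs_lt_1_sq: "\<bar>a::real\<bar> < 1 \<Longrightarrow> 0 < 1 - a\<^sup>2"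
  by (simp add: abs_square_less_1)

lemma moebius_shrink:
  assumes "\<bar>a\<bar> < 1" "cmod p < 1"
  shows "1 - (cmod (moebius a p))\<^sup>2 = (1 - a\<^sup>2) / (cmod (1 - of_real a * p))\<^sup>2 * (1 - (cmod p)\<^sup>2)"
  using moebius_norm_identity[of a p] moebius_denom_nonzero[OF assms]
  by (simp add: moebius_def norm_divide power_divide field_simps)

text \<open>The generic norm is multiplied by the same factor c as the diagonal entry 1 - |p|^2 - |s|^2.
By \<open>lie_norm_fibre_disc\<close> it suffices to see that the linear form in q whose modulus occurs there is
multiplied by exactly c.\<close>
lemma lie_moebius_identities:
  fixes a :: real and z :: "complex^3"
  assumes a: "\<bar>a\<bar> < 1" "cmod (coord_p z) < 1"
  defines "c \<equiv> (1 - a\<^sup>2) / (cmod (1 - of_real a * coord_p z))\<^sup>2"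
  shows "c > 0"
    and "1 - (cmod (coord_p (lie_moebius a z)))\<^sup>2 - (cmod (coord_s (lie_moebius a z)))\<^sup>2 = c * (1 - (cmod (coord_p z))\<^sup>2 - (cmod (coord_s z))\<^sup>2)"
    and "lie_norm (lie_moebius a z) = c * lie_norm z"
    and "lie_moebius a z \<in> lie_ball \<longleftrightarrow> z \<in> lie_ball"
proof -
  define p s q where "p = coord_p z" "s = coord_s z" "q = coord_q z"
  define u where "u = 1 - of_real a * p"
  define P where "P = 1 - (cmod p)\<^sup>2"
  note d = p_s_q_def
  have u: "u \<noteq> 0" using moebius_denom_nonzero[OF a] by (simp add: u_def d)
  have a2: "1 - a\<^sup>2 > 0" using abs_lt_1_sq[OF a(1)] .
  show c: "c > 0" unfolding c_def using a2 u by (simp add: u_def d)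
  have P0: "P > 0" unfolding P_def d using a(2) by (simp add: power_less_one_iff)
  have c': "c = (1 - a\<^sup>2) / (cmod u)\<^sup>2" by (simp add: c_def u_def d)
  have p': "coord_p (lie_moebius a z) = moebius a p" and s': "coord_s (lie_moebius a z) = of_real (sqrt (1 - a\<^sup>2)) * s / u"
    and q': "coord_q (lie_moebius a z) = q - of_real a * s\<^sup>2 / u"
    by (simp_all add: lie_moebius_def d u_def)
  have P': "1 - (cmod (moebius a p))\<^sup>2 = c * P"
    using moebius_shrink[OF a] by (simp add: c_def d P_def)
  have S': "(cmod (of_real (sqrt (1 - a\<^sup>2)) * s / u))\<^sup>2 = c * (cmod s)\<^sup>2"
    using a2 by (simp add: norm_mult norm_divide power_mult_distrib power_divide c')
  show A: "1 - (cmod (coord_p (lie_moebius a z)))\<^sup>2 - (cmod (coord_s (lie_moebius a z)))\<^sup>2 = c * (1 - (cmod (coord_p z))\<^sup>2 - (cmod (coord_s z))\<^sup>2)"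
    unfolding p' s' S' P' using d by (simp add: P_def algebra_simps)
  have cc: "complex_of_real c = of_real (1 - a\<^sup>2) / (u * cnj u)"
    unfolding c' of_real_divide complex_norm_square[symmetric] of_real_power ..
  have s2: "(of_real (sqrt (1 - a\<^sup>2)) * s / u)\<^sup>2 = of_real (1 - a\<^sup>2) * s\<^sup>2 / u\<^sup>2"
    using a2 by (simp add: power_mult_distrib power_divide flip: of_real_power)
  have cnjm: "cnj (moebius a p) = (cnj p - of_real a) / cnj u"
    by (simp add: moebius_def u_def)
  have Pc: "complex_of_real P = 1 - p * cnj p"
    unfolding P_def by (simp add: complex_norm_square flip: of_real_power)
  have key: "of_real (c * P) * (q - of_real a * s\<^sup>2 / u) - cnj (moebius a p) * (of_real (sqrt (1 - a\<^sup>2)) * s / u)\<^sup>2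
      = of_real c * (of_real P * q - cnj p * s\<^sup>2)"
  proof -
    have cu: "cnj u \<noteq> 0" using u by simp
    have e1: "cnj (moebius a p) * (of_real (sqrt (1 - a\<^sup>2)) * s / u)\<^sup>2 = of_real c * ((cnj p - of_real a) * s\<^sup>2 / u)"
      unfolding s2 cnjm cc using u cu by (simp add: field_simps power2_eq_square)
    have e2: "of_real P * (of_real a * s\<^sup>2 / u) + (cnj p - of_real a) * s\<^sup>2 / u = cnj p * s\<^sup>2"
    proof -
      have "of_real P * (of_real a * s\<^sup>2) + (cnj p - of_real a) * s\<^sup>2 = cnj p * s\<^sup>2 * u"
        unfolding Pc u_def by (simp add: algebra_simps)
      then show ?thesis using u by (simp add: field_simps)
    qed
    show ?thesis
      unfolding e1 of_real_mult using arg_cong[OF e2, of "\<lambda>t. of_real c * t"] by (simp add: algebra_simps)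
  qed
  have "(c * P) * lie_norm (lie_moebius a z) = (c * (P - (cmod s)\<^sup>2))\<^sup>2 - (c * cmod (of_real P * q - cnj p * s\<^sup>2))\<^sup>2"
  proof -
    have "(1 - (cmod (coord_p (lie_moebius a z)))\<^sup>2) * lie_norm (lie_moebius a z)
      = (1 - (cmod (coord_p (lie_moebius a z)))\<^sup>2 - (cmod (coord_s (lie_moebius a z)))\<^sup>2)\<^sup>2
       - (cmod (of_real (1 - (cmod (coord_p (lie_moebius a z)))\<^sup>2) * coord_q (lie_moebius a z) - cnj (coord_p (lie_moebius a z)) * (coord_s (lie_moebius a z))\<^sup>2))\<^sup>2"
      by (rule lie_norm_fibre_disc(1))
    then show ?thesis
      unfolding A unfolding p' s' q' P' key using c by (simp add: norm_mult d P_def)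
  qed
  also have "\<dots> = c\<^sup>2 * (P * lie_norm z)"
  proof -
    have "P * lie_norm z = (P - (cmod s)\<^sup>2)\<^sup>2 - (cmod (of_real P * q - cnj p * s\<^sup>2))\<^sup>2"
      using lie_norm_fibre_disc(1)[of z] unfolding P_def d .
    then show ?thesis by algebra
  qed
  finally have "(c * P) * lie_norm (lie_moebius a z) = (c * P) * (c * lie_norm z)"
    by (simp add: power2_eq_square mult_ac)
  then show N: "lie_norm (lie_moebius a z) = c * lie_norm z" using c P0 by simp
  have "1 - (cmod (coord_p (lie_moebius a z)))\<^sup>2 - (cmod (coord_s (lie_moebius a z)))\<^sup>2 > 0 \<longleftrightarrow> 1 - (cmod (coord_p z))\<^sup>2 - (cmod (coord_s z))\<^sup>2 > 0"
    unfolding A using c by (simp add: zero_less_mult_iff)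
  moreover have "lie_norm (lie_moebius a z) > 0 \<longleftrightarrow> lie_norm z > 0"
    unfolding N using c by (simp add: zero_less_mult_iff)
  ultimately show "lie_moebius a z \<in> lie_ball \<longleftrightarrow> z \<in> lie_ball"
    unfolding lie_ball_coords by linarith
qed

lemma moebius_denom_inverse:
  assumes "\<bar>a\<bar> < 1" "cmod p < 1"
  shows "1 + of_real a * moebius a p = of_real (1 - a\<^sup>2) / (1 - of_real a * p)"
  using moebius_denom_nonzero[OF assms] by (simp add: moebius_def field_simps power2_eq_square)

lemma lie_moebius_inverse:
  assumes a: "\<bar>a\<bar> < 1" "cmod (coord_p z) < 1"
  shows "lie_moebius (- a) (lie_moebius a z) = z"
proof -
  define u where "u = 1 - of_real a * coord_p z"
  define r where "r = complex_of_real (sqrt (1 - a\<^sup>2))"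
  have u: "u \<noteq> 0" using moebius_denom_nonzero[OF a] by (simp add: u_def)
  have a2: "1 - a\<^sup>2 > 0" using abs_lt_1_sq[OF a(1)] .
  have r2: "r * r = of_real (1 - a\<^sup>2)" and r0: "r \<noteq> 0"
    using a2 unfolding r_def by (simp_all flip: of_real_mult)
  have d: "1 + of_real a * moebius a (coord_p z) = r * r / u"
    unfolding r2 u_def by (rule moebius_denom_inverse[OF a])
  have "lie_moebius (- a) (lie_moebius a z) = lie_pt (moebius (- a) (moebius a (coord_p z))) (r * (r * coord_s z / u) / (r * r / u))
        (coord_q z - of_real a * (coord_s z)\<^sup>2 / u + of_real a * (r * coord_s z / u)\<^sup>2 / (r * r / u))"
    unfolding d[symmetric] by (simp add: lie_moebius_def u_def r_def)
  also have "r * (r * coord_s z / u) / (r * r / u) = coord_s z" using u r0 by (simp add: field_simps)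
  also have "coord_q z - of_real a * (coord_s z)\<^sup>2 / u + of_real a * (r * coord_s z / u)\<^sup>2 / (r * r / u) = coord_q z"
    using u r0 by (simp add: field_simps power2_eq_square)
  finally show ?thesis using moebius_inverse[OF a] by simp
qed

text \<open>A holomorphic function of p whose squared modulus is the \<mu>-th power of the factor by which the
generic norm changes; the principal logarithm is available since Re (1 - a p) > 0 on the disc.\<close>
definition fibre_factor :: "real \<Rightarrow> real \<Rightarrow> complex \<Rightarrow> complex" where
  "fibre_factor \<mu> a p = of_real ((1 - a\<^sup>2) powr (\<mu> / 2)) * exp (- of_real \<mu> * Ln (1 - of_real a * p))"

lemma norm_fibre_factor_sq:
  assumes a: "\<bar>a\<bar> < 1" "cmod p < 1"
  shows "(cmod (fibre_factor \<mu> a p))\<^sup>2 = ((1 - a\<^sup>2) / (cmod (1 - of_real a * p))\<^sup>2) powr \<mu>"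
proof -
  define u where "u = 1 - of_real a * p"
  have u: "u \<noteq> 0" using moebius_denom_nonzero[OF a] by (simp add: u_def)
  have a2: "1 - a\<^sup>2 > 0" using abs_lt_1_sq[OF a(1)] .
  have "cmod (exp (- of_real \<mu> * Ln u)) = cmod u powr (- \<mu>)"
    using u by (simp add: powr_def)
  then have "(cmod (fibre_factor \<mu> a p))\<^sup>2 = ((1 - a\<^sup>2) powr (\<mu> / 2))\<^sup>2 * (cmod u powr (- \<mu>))\<^sup>2"
    by (simp add: fibre_factor_def norm_mult power_mult_distrib u_def)
  also have "((1 - a\<^sup>2) powr (\<mu> / 2))\<^sup>2 = (1 - a\<^sup>2) powr \<mu>"
    using a2 by (simp add: power2_eq_square flip: powr_add)
  also have "(cmod u powr (- \<mu>))\<^sup>2 = inverse (((cmod u)\<^sup>2) powr \<mu>)"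
    using u by (simp add: power2_eq_square powr_minus powr_mult)
  finally show ?thesis
    using a2 u by (simp add: u_def powr_divide divide_inverse[symmetric])
qed

lemma fibre_factor_nonzero: "\<bar>a\<bar> < 1 \<Longrightarrow> fibre_factor \<mu> a p \<noteq> 0"
  using abs_lt_1_sq[of a] by (simp add: fibre_factor_def)

lemma fibre_factor_inverse:
  assumes a: "\<bar>a\<bar> < 1" "cmod p < 1"
  shows "fibre_factor \<mu> (- a) (moebius a p) * fibre_factor \<mu> a p = 1"
proof -
  define u where "u = 1 - of_real a * p"
  have u: "u \<noteq> 0" "Re u > 0" using moebius_denom_nonzero[OF a] moebius_denom_Re_pos[OF a] by (simp_all add: u_def)
  then have un: "u \<notin> \<real>\<^sub>\<le>\<^sub>0" using complex_nonpos_Reals_iff by auto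
  have a2: "1 - a\<^sup>2 > 0" using abs_lt_1_sq[OF a(1)] .
  have "Ln (1 + of_real a * moebius a p) = Ln (of_real (1 - a\<^sup>2) * inverse u)"
    unfolding moebius_denom_inverse[OF a] u_def divide_inverse ..
  also have "\<dots> = of_real (ln (1 - a\<^sup>2)) + Ln (inverse u)"
    using Ln_times_of_real[of "1 - a\<^sup>2" "inverse u"] Ln_of_real[of "1 - a\<^sup>2"] a2 u by simp
  also have "Ln (inverse u) = - Ln u" by (rule Ln_inverse[OF un])
  finally have L: "Ln (1 + of_real a * moebius a p) = of_real (ln (1 - a\<^sup>2)) - Ln u" by simp
  have "fibre_factor \<mu> (- a) (moebius a p) * fibre_factor \<mu> a p
      = of_real ((1 - a\<^sup>2) powr (\<mu> / 2) * (1 - a\<^sup>2) powr (\<mu> / 2)) * (exp (- of_real \<mu> * (of_real (ln (1 - a\<^sup>2)) - Ln u)) * exp (- of_real \<mu> * Ln u))"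
    using L by (simp add: fibre_factor_def u_def)
  also have "exp (- of_real \<mu> * (of_real (ln (1 - a\<^sup>2)) - Ln u)) * exp (- of_real \<mu> * Ln u) = exp (of_real (- \<mu> * ln (1 - a\<^sup>2)))"
    by (simp add: exp_add[symmetric] algebra_simps)
  also have "\<dots> = of_real ((1 - a\<^sup>2) powr (- \<mu>))"
    using a2 by (simp add: powr_def exp_of_real[symmetric])
  also have "of_real ((1 - a\<^sup>2) powr (\<mu> / 2) * (1 - a\<^sup>2) powr (\<mu> / 2)) * of_real ((1 - a\<^sup>2) powr (- \<mu>)) = (1::complex)"
    using a2 by (simp flip: of_real_mult powr_add)
  finally show ?thesis .
qed

text \<open>The automorphism of the ball lifts to the Hartogs domain because Z is rescaled together with the
bounding function.\<close>
definition hartogs_moebius :: "real \<Rightarrow> real \<Rightarrow> (complex^3) \<times> (complex^'m) \<Rightarrow> (complex^3) \<times> (complex^'m)" where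
  "hartogs_moebius \<mu> a x = (lie_moebius a (fst x), fibre_factor \<mu> a (coord_p (fst x)) *s snd x)"

text \<open>The product of the diagonal entries of the triangular derivative: the derivative in p, the factors of
s and q (the latter 1), and one factor for each of the m coordinates of Z.\<close>
definition jacobian_moebius :: "real \<Rightarrow> real \<Rightarrow> (complex^3) \<times> (complex^'m) \<Rightarrow> complex" where
  "jacobian_moebius \<mu> a x = moebius_deriv a (coord_p (fst x)) * (of_real (sqrt (1 - a\<^sup>2)) / (1 - of_real a * coord_p (fst x)))
      * fibre_factor \<mu> a (coord_p (fst x)) ^ CARD('m)"

lemma norm_vec_smult: "norm (c *s Z) = cmod c * norm (Z :: complex^'m)"
proof -
  have "(norm (c *s Z))\<^sup>2 = (cmod c * norm Z)\<^sup>2"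
    by (simp add: norm_vec_sq norm_mult power_mult_distrib sum_distrib_left)
  then show ?thesis by (simp add: power2_eq_iff_nonneg)
qed

lemma hartogs_moebius_mem_iff:
  assumes a: "\<bar>a\<bar> < 1" and p: "cmod (coord_p (fst x)) < 1"
  shows "hartogs_moebius \<mu> a x \<in> hartogs_lie \<mu> \<longleftrightarrow> x \<in> hartogs_lie \<mu>"
proof -
  obtain z Z where x: "x = (z, Z)" by (cases x)
  note T = lie_moebius_identities[OF a, of z]
  define c where "c = (1 - a\<^sup>2) / (cmod (1 - of_real a * coord_p z))\<^sup>2"
  have p': "cmod (coord_p z) < 1" using p x by simp
  have c: "c > 0" unfolding c_def by (rule T(1)[OF p'])
  have "(norm (fibre_factor \<mu> a (coord_p z) *s Z))\<^sup>2 = c powr \<mu> * (norm Z)\<^sup>2"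
    unfolding norm_vec_smult power_mult_distrib norm_fibre_factor_sq[OF a p'] c_def ..
  moreover have "lie_norm (lie_moebius a z) powr \<mu> = c powr \<mu> * lie_norm z powr \<mu>" if "z \<in> lie_ball"
    using T(3)[OF p'] that c by (simp add: c_def[symmetric] powr_mult lie_ball_def)
  moreover have "c powr \<mu> > 0" using c by simp
  ultimately show ?thesis
    using T(4)[OF p'] by (auto simp: x hartogs_moebius_def hartogs_lie_iff)
qed

lemma hartogs_lie_coord_p: "x \<in> hartogs_lie \<mu> \<Longrightarrow> cmod (coord_p (fst x)) < 1" for x :: "(complex^3) \<times> (complex^'m)"
  by (cases x) (auto simp: hartogs_lie_iff lie_ball_coord_p)

lemma hartogs_moebius_mem:
  "\<bar>a\<bar> < 1 \<Longrightarrow> x \<in> hartogs_lie \<mu> \<Longrightarrow> hartogs_moebius \<mu> a x \<in> hartogs_lie \<mu>"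
  using hartogs_moebius_mem_iff hartogs_lie_coord_p by blast

lemma coord_p_lie_moebius [simp]: "coord_p (lie_moebius a z) = moebius a (coord_p z)"
  by (simp add: lie_moebius_def)

lemma hartogs_moebius_inverse:
  assumes "\<bar>a\<bar> < 1" "x \<in> hartogs_lie \<mu>"
  shows "hartogs_moebius \<mu> (- a) (hartogs_moebius \<mu> a x) = x"
  using lie_moebius_inverse[OF assms(1) hartogs_lie_coord_p[OF assms(2)]] fibre_factor_inverse[OF assms(1) hartogs_lie_coord_p[OF assms(2)], of \<mu>]
  by (cases x) (simp add: hartogs_moebius_def)

lemma holomorphic_sev_coord_p: "holomorphic_sev (\<lambda>x. coord_p (fst x)) U"
  unfolding coord_p_def by (intro holomorphic_sev_intros)
lemma holomorphic_sev_coord_q: "holomorphic_sev (\<lambda>x. coord_q (fst x)) U"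
  unfolding coord_q_def by (intro holomorphic_sev_intros)
lemma holomorphic_sev_coord_s: "holomorphic_sev (\<lambda>x. coord_s (fst x)) U"
  unfolding coord_s_def by (intro holomorphic_sev_intros)

lemma holomorphic_sev_fibre_factor:
  fixes U :: "((complex^3) \<times> (complex^'m)) set"
  assumes a: "\<bar>a\<bar> < 1" and U: "U \<subseteq> hartogs_lie \<mu>"
  shows "holomorphic_sev (\<lambda>x. fibre_factor \<mu>' a (coord_p (fst x))) U"
proof -
  have n: "1 - of_real a * coord_p (fst x) \<notin> \<real>\<^sub>\<le>\<^sub>0" if "x \<in> U" for x
    using moebius_denom_Re_pos[OF a hartogs_lie_coord_p[of x \<mu>]] that U by (auto simp: complex_nonpos_Reals_iff)
  have 1: "holomorphic_sev (\<lambda>x. 1 - of_real a * coord_p (fst x)) U"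
    by (intro holomorphic_sev_intros holomorphic_sev_coord_p)
  have 2: "holomorphic_sev (\<lambda>x. Ln (1 - of_real a * coord_p (fst x))) U"
    by (rule holomorphic_sev_compose_field[OF 1 has_field_derivative_Ln[OF n]])
  have 3: "holomorphic_sev (\<lambda>x. - of_real \<mu>' * Ln (1 - of_real a * coord_p (fst x))) U"
    by (rule holomorphic_sev_cmult[OF 2])
  have 4: "holomorphic_sev (\<lambda>x. exp (- of_real \<mu>' * Ln (1 - of_real a * coord_p (fst x)))) U"
    by (rule holomorphic_sev_compose_field[OF 3 DERIV_exp])
  show ?thesis unfolding fibre_factor_def by (rule holomorphic_sev_cmult[OF 4])
qed

lemma holo_map_hartogs_moebius:
  assumes a: "\<bar>a\<bar> < 1"
  shows "holo_map (hartogs_moebius \<mu> a) (hartogs_lie \<mu> :: ((complex^3) \<times> (complex^'m)) set)"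
proof (rule holo_mapI)
  let ?U = "hartogs_lie \<mu> :: ((complex^3) \<times> (complex^'m)) set"
  have n: "1 - of_real a * coord_p (fst x) \<noteq> 0" if "x \<in> ?U" for x
    using moebius_denom_nonzero[OF a hartogs_lie_coord_p[OF that]] .
  have 1: "holomorphic_sev (\<lambda>x. moebius a (coord_p (fst x))) ?U"
    unfolding moebius_def by (intro holomorphic_sev_intros holomorphic_sev_coord_p n)
  have 2: "holomorphic_sev (\<lambda>x. of_real (sqrt (1 - a\<^sup>2)) * coord_s (fst x) / (1 - of_real a * coord_p (fst x))) ?U"
    by (intro holomorphic_sev_intros holomorphic_sev_coord_p holomorphic_sev_coord_s n)
  have 3: "holomorphic_sev (\<lambda>x. coord_q (fst x) - of_real a * (coord_s (fst x))\<^sup>2 / (1 - of_real a * coord_p (fst x))) ?U"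
    by (intro holomorphic_sev_intros holomorphic_sev_coord_p holomorphic_sev_coord_s holomorphic_sev_coord_q n)
  have c1: "holomorphic_sev (\<lambda>x. fst (hartogs_moebius \<mu> a x) $ 1) ?U"
    using holomorphic_sev_cmult[OF holomorphic_sev_add[OF 1 3], of "1/2"] by (simp add: hartogs_moebius_def lie_moebius_def lie_pt_def)
  have c2: "holomorphic_sev (\<lambda>x. fst (hartogs_moebius \<mu> a x) $ 2) ?U"
    using holomorphic_sev_cmult[OF holomorphic_sev_diff[OF 1 3], of "1/(2*\<i>)"] by (simp add: hartogs_moebius_def lie_moebius_def lie_pt_def)
  have c3: "holomorphic_sev (\<lambda>x. fst (hartogs_moebius \<mu> a x) $ 3) ?U"
    using 2 by (simp add: hartogs_moebius_def lie_moebius_def lie_pt_def)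
  show "holomorphic_sev (\<lambda>x. fst (hartogs_moebius \<mu> a x) $ i) ?U" for i
    using exhaust_3[of i] c1 c2 c3 by auto
  show "holomorphic_sev (\<lambda>x. snd (hartogs_moebius \<mu> a x) $ j) ?U" for j
    using holomorphic_sev_mult[OF holomorphic_sev_fibre_factor[OF a order_refl] holomorphic_sev_snd_nth[of j], of \<mu> \<mu>]
    by (simp add: hartogs_moebius_def)
qed

lemma jacobian_moebius_nonzero:
  assumes a: "\<bar>a\<bar> < 1" and x: "x \<in> hartogs_lie \<mu>"
  shows "jacobian_moebius \<mu> a x \<noteq> 0"
proof -
  have "complex_of_real (1 - a\<^sup>2) \<noteq> 0" "complex_of_real (sqrt (1 - a\<^sup>2)) \<noteq> 0"
    using abs_lt_1_sq[OF a] by (simp_all only: of_real_eq_0_iff real_sqrt_eq_0_iff)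
  then show ?thesis
    using moebius_denom_nonzero[OF a hartogs_lie_coord_p[OF x]] fibre_factor_nonzero[OF a]
    unfolding jacobian_moebius_def moebius_deriv_def by (simp only: mult_eq_0_iff divide_eq_0_iff power_eq_0_iff simp_thms)
qed

lemma holomorphic_sev_jacobian_moebius:
  assumes a: "\<bar>a\<bar> < 1"
  shows "holomorphic_sev (jacobian_moebius \<mu> a) (hartogs_lie \<mu> :: ((complex^3) \<times> (complex^'m)) set)"
  unfolding jacobian_moebius_def[abs_def] moebius_deriv_def
  by (intro holomorphic_sev_intros holomorphic_sev_coord_p holomorphic_sev_fibre_factor[OF a order_refl])
     (use moebius_denom_nonzero[OF a hartogs_lie_coord_p] in auto)

lemma continuous_lie_pt: "continuous_on UNIV (\<lambda>(p, s, q). lie_pt p s q)"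
proof -
  have "linear (\<lambda>(p, s, q). lie_pt p s q)"
    by (rule linearI; clarsimp simp: lie_pt_def vec_eq_iff forall_3; simp add: scaleR_conv_of_real field_simps)
  then show ?thesis by (simp add: linear_continuous_on linear_conv_bounded_linear)
qed

lemma measurable_lie_pt [measurable (raw)]:
  assumes [measurable]: "p \<in> borel_measurable M" "s \<in> borel_measurable M" "q \<in> borel_measurable M"
  shows "(\<lambda>x. lie_pt (p x) (s x) (q x)) \<in> borel_measurable M"
proof -
  have "(\<lambda>x. (p x, s x, q x)) \<in> borel_measurable M"
    by (simp add: borel_prod[symmetric])
  moreover have "(\<lambda>(p, s, q). lie_pt p s q) \<in> borel_measurable borel"
    by (rule borel_measurable_continuous_onI[OF continuous_lie_pt])
  ultimately have "(\<lambda>x. (\<lambda>(p, s, q). lie_pt p s q) (p x, s x, q x)) \<in> borel_measurable M"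
    by (rule measurable_compose)
  then show ?thesis by simp
qed

lemma measurable_coord_p [measurable]: "coord_p \<in> borel_measurable borel"
  unfolding coord_p_def[abs_def] by (intro borel_measurable_continuous_onI continuous_intros)
lemma measurable_coord_s [measurable]: "coord_s \<in> borel_measurable borel"
  unfolding coord_s_def[abs_def] by (intro borel_measurable_continuous_onI continuous_intros)
lemma measurable_coord_q [measurable]: "coord_q \<in> borel_measurable borel"
  unfolding coord_q_def[abs_def] by (intro borel_measurable_continuous_onI continuous_intros)

lemma nn_integral_lborel_Pair:
  fixes g :: "'a::euclidean_space \<times> 'b::euclidean_space \<Rightarrow> ennreal"
  assumes "g \<in> borel_measurable borel"
  shows "(\<integral>\<^sup>+x. g x \<partial>lborel) = (\<integral>\<^sup>+a. \<integral>\<^sup>+b. g (a, b) \<partial>lborel \<partial>lborel)"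
  using lborel.nn_integral_fst[of g lborel] assms by (simp add: lborel_prod)

lemma nn_integral_lie_coords:
  obtains C :: real where "C > 0" "\<And>g. g \<in> borel_measurable borel \<Longrightarrow>
    (\<integral>\<^sup>+z. g z \<partial>(lborel :: (complex^3) measure)) = ennreal C * (\<integral>\<^sup>+p. \<integral>\<^sup>+s. \<integral>\<^sup>+q. g (lie_pt p s q) \<partial>lborel \<partial>lborel \<partial>lborel)"
proof -
  let ?L = "\<lambda>z. (coord_p z, coord_s z, coord_q z)"
  have lin: "linear ?L"
    by (rule linearI) (auto simp: coord_p_def coord_s_def coord_q_def algebra_simps)
  have bij: "bij ?L"
    by (rule o_bij[of "\<lambda>(p, s, q). lie_pt p s q"]) (auto simp: fun_eq_iff)
  obtain C where C: "C > 0" "\<And>g. g \<in> borel_measurable borel \<Longrightarrow>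
        (\<integral>\<^sup>+x. g (?L x) \<partial>lborel) = ennreal C * (\<integral>\<^sup>+y. g y \<partial>lborel)"
    using nn_integral_linear_bij[OF lin bij] by blast
  show ?thesis
  proof (rule that[OF C(1)])
    fix g :: "complex^3 \<Rightarrow> ennreal" assume [measurable]: "g \<in> borel_measurable borel"
    have [measurable]: "(\<lambda>(p, s, q). lie_pt p s q) \<in> borel_measurable borel"
      by (rule borel_measurable_continuous_onI[OF continuous_lie_pt])
    define h where "h = (\<lambda>y. g ((\<lambda>(p, s, q). lie_pt p s q) y))"
    have h: "h \<in> borel_measurable borel" unfolding h_def by measurable
    have h2: "(\<lambda>y. h (p, y)) \<in> borel_measurable borel" for p
    proof -
      have "(\<lambda>y. h (p, y)) = (\<lambda>y. g (lie_pt p (fst y) (snd y)))" by (simp add: h_def split_beta)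
      also have "\<dots> \<in> borel_measurable borel"
        by (simp add: borel_prod[symmetric])
      finally show ?thesis .
    qed
    have "(\<integral>\<^sup>+z. g z \<partial>lborel) = ennreal C * (\<integral>\<^sup>+y. h y \<partial>lborel)"
      using C(2)[OF h] by (simp add: h_def)
    also have "(\<integral>\<^sup>+y. h y \<partial>lborel) = (\<integral>\<^sup>+p. \<integral>\<^sup>+y. h (p, y) \<partial>lborel \<partial>lborel)"
      by (rule nn_integral_lborel_Pair[OF h])
    also have "\<dots> = (\<integral>\<^sup>+p. \<integral>\<^sup>+s. \<integral>\<^sup>+q. h (p, s, q) \<partial>lborel \<partial>lborel \<partial>lborel)"
      by (intro nn_integral_cong nn_integral_lborel_Pair h2)
    finally show "(\<integral>\<^sup>+z. g z \<partial>lborel) = ennreal C * (\<integral>\<^sup>+p. \<integral>\<^sup>+s. \<integral>\<^sup>+q. g (lie_pt p s q) \<partial>lborel \<partial>lborel \<partial>lborel)"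
      by (simp add: h_def)
  qed
qed

lemma nn_integral_complex_scale:
  fixes g :: "complex \<Rightarrow> ennreal"
  assumes "g \<in> borel_measurable borel" "c \<noteq> 0"
  shows "ennreal ((cmod c)\<^sup>2) * (\<integral>\<^sup>+s. g (c * s) \<partial>lborel) = (\<integral>\<^sup>+s. g s \<partial>lborel)"
proof -
  have lin: "linear ((*) c)" by (rule linearI) (auto simp: algebra_simps)
  have "(\<integral>\<^sup>+s. g (c * s) \<partial>lborel) = ennreal ((1 / cmod c)\<^sup>2) * (\<integral>\<^sup>+s. g s \<partial>lborel)"
    using nn_integral_linear_similarity[OF lin _ _ assms(1), of "cmod c"] assms(2) by (simp add: norm_mult)
  then have "ennreal ((cmod c)\<^sup>2) * (\<integral>\<^sup>+s. g (c * s) \<partial>lborel) = ennreal ((cmod c)\<^sup>2 * (1 / cmod c)\<^sup>2) * (\<integral>\<^sup>+s. g s \<partial>lborel)"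
    by (simp add: ennreal_mult' mult.assoc)
  also have "(cmod c)\<^sup>2 * (1 / cmod c)\<^sup>2 = 1" using assms(2) by (simp add: power_divide)
  finally show ?thesis by simp
qed

lemma linear_vec_smult: "linear ((*s) (c::complex) :: complex^'m \<Rightarrow> complex^'m)"
  by (rule linearI) (auto simp: vec_eq_iff algebra_simps)

lemma nn_integral_cvec_scale:
  fixes g :: "complex^'m \<Rightarrow> ennreal"
  assumes "g \<in> borel_measurable borel" "c \<noteq> 0"
  shows "ennreal ((cmod c ^ CARD('m))\<^sup>2) * (\<integral>\<^sup>+Z. g (c *s Z) \<partial>lborel) = (\<integral>\<^sup>+Z. g Z \<partial>lborel)"
proof -
  have "(\<integral>\<^sup>+s. g (c *s s) \<partial>lborel) = ennreal ((1 / cmod c) ^ (DIM(complex^'m))) * (\<integral>\<^sup>+s. g s \<partial>lborel)"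
    using nn_integral_linear_similarity[OF linear_vec_smult[of c] _ _ assms(1), of "cmod c"] assms(2) by (simp add: norm_vec_smult)
  also have "(1 / cmod c) ^ (DIM(complex^'m)) = (1 / cmod c ^ CARD('m))\<^sup>2"
    by (simp add: power_mult[symmetric] power_divide mult.commute)
  finally have "ennreal ((cmod c ^ CARD('m))\<^sup>2) * (\<integral>\<^sup>+s. g (c *s s) \<partial>lborel) = ennreal ((cmod c ^ CARD('m))\<^sup>2 * (1 / cmod c ^ CARD('m))\<^sup>2) * (\<integral>\<^sup>+s. g s \<partial>lborel)"
    by (simp add: ennreal_mult' mult.assoc)
  also have "(cmod c ^ CARD('m))\<^sup>2 * (1 / cmod c ^ CARD('m))\<^sup>2 = 1" using assms(2) by (simp add: power_divide)
  finally show ?thesis by simp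
qed

text \<open>Over fixed p the map is a translation in q and a scaling in s; what remains is the substitution rule
for the Moebius map of the disc.\<close>
lemma nn_integral_lie_moebius:
  assumes a: "\<bar>a\<bar> < 1" and H [measurable]: "H \<in> borel_measurable borel"
  shows "(\<integral>\<^sup>+z. ennreal ((cmod (moebius_deriv a (coord_p z)) * cmod (of_real (sqrt (1 - a\<^sup>2)) / (1 - of_real a * coord_p z)))\<^sup>2)
             * H (lie_moebius a z) * indicator (ball 0 1) (coord_p z) \<partial>lborel)
       = (\<integral>\<^sup>+z. H z * indicator (ball 0 1) (coord_p z) \<partial>lborel)"
proof -
  define r where "r = (\<lambda>p. complex_of_real (sqrt (1 - a\<^sup>2)) / (1 - of_real a * p))"
  have [measurable]: "r \<in> borel_measurable borel" unfolding r_def by measurable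
  have [measurable]: "moebius a \<in> borel_measurable borel" "moebius_deriv a \<in> borel_measurable borel"
    unfolding moebius_def[abs_def] moebius_deriv_def[abs_def] by measurable
  have [measurable]: "ball (0::complex) 1 \<in> sets borel" by simp
  have [measurable]: "lie_moebius a \<in> borel_measurable borel"
    unfolding lie_moebius_def[abs_def] by measurable
  obtain C where C: "C > 0" "\<And>g. g \<in> borel_measurable borel \<Longrightarrow>
    (\<integral>\<^sup>+z. g z \<partial>(lborel :: (complex^3) measure)) = ennreal C * (\<integral>\<^sup>+p. \<integral>\<^sup>+s. \<integral>\<^sup>+q. g (lie_pt p s q) \<partial>lborel \<partial>lborel \<partial>lborel)"
    using nn_integral_lie_coords by blast
  define h where "h = (\<lambda>p. \<integral>\<^sup>+s. \<integral>\<^sup>+q. H (lie_pt p s q) \<partial>lborel \<partial>lborel)"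
  have [measurable]: "h \<in> borel_measurable borel" unfolding h_def by measurable
  have inner: "(\<integral>\<^sup>+s. \<integral>\<^sup>+q. ennreal ((cmod (moebius_deriv a p) * cmod (r p))\<^sup>2) * H (lie_moebius a (lie_pt p s q)) * indicator (ball 0 1) p \<partial>lborel \<partial>lborel)
      = ennreal ((cmod (moebius_deriv a p))\<^sup>2) * h (moebius a p) * indicator (ball 0 1) p" for p
  proof (cases "p \<in> ball 0 1")
    case True
    have r0: "r p \<noteq> 0"
      using moebius_denom_nonzero[OF a, of p] True abs_lt_1_sq[OF a] by (simp add: r_def)
    define k where "k = (\<lambda>s. of_real a * s\<^sup>2 / (1 - of_real a * p))"
    have T: "lie_moebius a (lie_pt p s q) = lie_pt (moebius a p) (r p * s) (q - k s)" for s q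
      by (simp add: lie_moebius_def r_def k_def)
    have "(\<integral>\<^sup>+s. \<integral>\<^sup>+q. ennreal ((cmod (moebius_deriv a p) * cmod (r p))\<^sup>2) * H (lie_moebius a (lie_pt p s q)) * indicator (ball 0 1) p \<partial>lborel \<partial>lborel)
        = (\<integral>\<^sup>+s. \<integral>\<^sup>+q. ennreal ((cmod (moebius_deriv a p) * cmod (r p))\<^sup>2) * H (lie_pt (moebius a p) (r p * s) (q - k s)) \<partial>lborel \<partial>lborel)"
      using True by (simp add: T)
    also have "\<dots> = (\<integral>\<^sup>+s. ennreal ((cmod (moebius_deriv a p) * cmod (r p))\<^sup>2) * (\<integral>\<^sup>+q. H (lie_pt (moebius a p) (r p * s) (q - k s)) \<partial>lborel) \<partial>lborel)"
      by (intro nn_integral_cong nn_integral_cmult) measurable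
    also have "\<dots> = (\<integral>\<^sup>+s. ennreal ((cmod (moebius_deriv a p) * cmod (r p))\<^sup>2) * (\<integral>\<^sup>+q. H (lie_pt (moebius a p) (r p * s) q) \<partial>lborel) \<partial>lborel)"
    proof (rule nn_integral_cong)
      fix s
      have "(\<integral>\<^sup>+q. H (lie_pt (moebius a p) (r p * s) (q - k s)) \<partial>lborel) = (\<integral>\<^sup>+q. H (lie_pt (moebius a p) (r p * s) q) \<partial>lborel)"
        by (rule nn_integral_lborel_diff) measurable
      then show "ennreal ((cmod (moebius_deriv a p) * cmod (r p))\<^sup>2) * (\<integral>\<^sup>+q. H (lie_pt (moebius a p) (r p * s) (q - k s)) \<partial>lborel)
        = ennreal ((cmod (moebius_deriv a p) * cmod (r p))\<^sup>2) * (\<integral>\<^sup>+q. H (lie_pt (moebius a p) (r p * s) q) \<partial>lborel)" by simp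
    qed
    also have "\<dots> = ennreal ((cmod (moebius_deriv a p) * cmod (r p))\<^sup>2) * (\<integral>\<^sup>+s. (\<integral>\<^sup>+q. H (lie_pt (moebius a p) (r p * s) q) \<partial>lborel) \<partial>lborel)"
      by (rule nn_integral_cmult) measurable
    also have "\<dots> = ennreal ((cmod (moebius_deriv a p))\<^sup>2) * (ennreal ((cmod (r p))\<^sup>2) * (\<integral>\<^sup>+s. (\<integral>\<^sup>+q. H (lie_pt (moebius a p) (r p * s) q) \<partial>lborel) \<partial>lborel))"
      by (simp add: power_mult_distrib ennreal_mult' mult.assoc)
    also have "ennreal ((cmod (r p))\<^sup>2) * (\<integral>\<^sup>+s. (\<integral>\<^sup>+q. H (lie_pt (moebius a p) (r p * s) q) \<partial>lborel) \<partial>lborel) = h (moebius a p)"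
      unfolding h_def by (rule nn_integral_complex_scale[OF _ r0]) measurable
    finally show ?thesis using True by simp
  qed simp
  have "(\<integral>\<^sup>+z. ennreal ((cmod (moebius_deriv a (coord_p z)) * cmod (r (coord_p z)))\<^sup>2) * H (lie_moebius a z) * indicator (ball 0 1) (coord_p z) \<partial>lborel)
      = ennreal C * (\<integral>\<^sup>+p. ennreal ((cmod (moebius_deriv a p))\<^sup>2) * h (moebius a p) * indicator (ball 0 1) p \<partial>lborel)"
    by (subst C(2)) (simp_all add: inner)
  also have "(\<integral>\<^sup>+p. ennreal ((cmod (moebius_deriv a p))\<^sup>2) * h (moebius a p) * indicator (ball 0 1) p \<partial>lborel)
      = (\<integral>\<^sup>+p. h p * indicator (ball 0 1) p \<partial>lborel)"
    by (rule nn_integral_moebius[OF a]) measurable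
  also have "ennreal C * \<dots> = ennreal C * (\<integral>\<^sup>+p. \<integral>\<^sup>+s. \<integral>\<^sup>+q. H (lie_pt p s q) * indicator (ball 0 1) p \<partial>lborel \<partial>lborel \<partial>lborel)"
    unfolding h_def by (simp add: nn_integral_multc)
  also have "\<dots> = (\<integral>\<^sup>+z. H z * indicator (ball 0 1) (coord_p z) \<partial>lborel)"
    by (subst C(2)) simp_all
  finally show ?thesis unfolding r_def .
qed

text \<open>Over fixed z the map scales Z, which accounts for the power of the fibre factor in the Jacobian.\<close>
lemma nn_integral_hartogs_moebius:
  fixes g :: "(complex^3) \<times> (complex^'m) \<Rightarrow> ennreal"
  assumes a: "\<bar>a\<bar> < 1" and g [measurable]: "g \<in> borel_measurable borel"
  shows "(\<integral>\<^sup>+x. ennreal ((cmod (jacobian_moebius \<mu> a x))\<^sup>2) * g (hartogs_moebius \<mu> a x) * indicator (hartogs_lie \<mu>) x \<partial>lborel)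
       = (\<integral>\<^sup>+x. g x * indicator (hartogs_lie \<mu>) x \<partial>lborel)"
proof -
  let ?U = "hartogs_lie \<mu> :: ((complex^3) \<times> (complex^'m)) set"
  let ?m = "CARD('m)"
  have [measurable]: "?U \<in> sets borel" by (rule borel_open[OF open_hartogs_lie])
  have [measurable]: "ball (0::complex) 1 \<in> sets borel" by simp
  define h where "h = (\<lambda>x. g x * indicator ?U x)"
  have hm: "h \<in> borel_measurable borel" unfolding h_def by measurable
  then have hm' [measurable]: "h \<in> borel_measurable (borel \<Otimes>\<^sub>M borel)" by (simp add: borel_prod)
  \<comment> \<open>cut off outside the disc, where the logarithm in the fibre factor meets its branch cut\<close>
  define d where "d = (\<lambda>p. if p \<in> ball 0 1 then fibre_factor \<mu> a p else 1)"
  have d0: "d p \<noteq> 0" for p using fibre_factor_nonzero[OF a] by (simp add: d_def)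
  have dm [measurable]: "d \<in> borel_measurable borel"
    unfolding d_def
  proof (rule borel_measurable_continuous_on_if)
    show "continuous_on (ball 0 1) (fibre_factor \<mu> a)"
      unfolding fibre_factor_def[abs_def] using moebius_denom_Re_pos[OF a]
      by (intro continuous_intros) (auto simp: complex_nonpos_Reals_iff not_le)
  qed auto
  have [measurable]: "lie_moebius a \<in> borel_measurable borel"
    unfolding lie_moebius_def[abs_def] moebius_def by measurable
  have [measurable]: "moebius_deriv a \<in> borel_measurable borel"
    unfolding moebius_deriv_def[abs_def] by measurable
  define b where "b = (\<lambda>p. (cmod (moebius_deriv a p) * cmod (of_real (sqrt (1 - a\<^sup>2)) / (1 - of_real a * p)))\<^sup>2)"
  have [measurable]: "b \<in> borel_measurable borel" unfolding b_def by measurable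
  have b0: "b p \<ge> 0" for p unfolding b_def by simp
  define H where "H = (\<lambda>z. \<integral>\<^sup>+Z. h (z, Z) \<partial>lborel)"
  have [measurable]: "H \<in> borel_measurable borel" unfolding H_def by measurable
  have smult [measurable]: "(\<lambda>x. d (coord_p (fst x)) *s snd x) \<in> borel_measurable (borel \<Otimes>\<^sub>M (borel :: (complex^'m) measure))"
  proof -
    have "continuous_on UNIV (\<lambda>y :: complex \<times> (complex^'m). fst y *s snd y)"
    proof -
      have "(\<lambda>y :: complex \<times> (complex^'m). fst y *s snd y) = (\<lambda>y. \<chi> i. fst y * snd y $ i)"
        by (auto simp: vec_eq_iff)
      moreover have "continuous_on UNIV (\<lambda>y :: complex \<times> (complex^'m). \<chi> i. fst y * snd y $ i)"
        by (intro continuous_intros)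
      ultimately show ?thesis by (simp only:)
    qed
    then have 1: "(\<lambda>y :: complex \<times> (complex^'m). fst y *s snd y) \<in> borel_measurable (borel \<Otimes>\<^sub>M borel)"
      unfolding borel_prod by (rule borel_measurable_continuous_onI)
    have 2: "(\<lambda>x. (d (coord_p (fst x)), snd x)) \<in> (borel \<Otimes>\<^sub>M (borel :: (complex^'m) measure)) \<rightarrow>\<^sub>M (borel \<Otimes>\<^sub>M borel)"
      by measurable
    show ?thesis using measurable_compose[OF 2 1] by simp
  qed
  have main: "(\<lambda>x. ennreal (b (coord_p (fst x)) * (cmod (d (coord_p (fst x))) ^ ?m)\<^sup>2) * h (lie_moebius a (fst x), d (coord_p (fst x)) *s snd x)
      * indicator (ball 0 1) (coord_p (fst x))) \<in> borel_measurable (borel \<Otimes>\<^sub>M (borel :: (complex^'m) measure))"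
    by measurable
  have "(\<integral>\<^sup>+x. ennreal ((cmod (jacobian_moebius \<mu> a x))\<^sup>2) * g (hartogs_moebius \<mu> a x) * indicator ?U x \<partial>lborel)
      = (\<integral>\<^sup>+x. ennreal (b (coord_p (fst x)) * (cmod (d (coord_p (fst x))) ^ ?m)\<^sup>2) * h (lie_moebius a (fst x), d (coord_p (fst x)) *s snd x)
            * indicator (ball 0 1) (coord_p (fst x)) \<partial>lborel)"
  proof (intro nn_integral_cong)
    fix x :: "(complex^3) \<times> (complex^'m)"
    show "ennreal ((cmod (jacobian_moebius \<mu> a x))\<^sup>2) * g (hartogs_moebius \<mu> a x) * indicator ?U x
       = ennreal (b (coord_p (fst x)) * (cmod (d (coord_p (fst x))) ^ ?m)\<^sup>2) * h (lie_moebius a (fst x), d (coord_p (fst x)) *s snd x)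
            * indicator (ball 0 1) (coord_p (fst x))"
    proof (cases "cmod (coord_p (fst x)) < 1")
      case False
      then have "x \<notin> ?U" using hartogs_lie_coord_p by blast
      with False show ?thesis by simp
    next
      case True
      have j: "(cmod (jacobian_moebius \<mu> a x))\<^sup>2 = b (coord_p (fst x)) * (cmod (d (coord_p (fst x))) ^ ?m)\<^sup>2"
      proof -
        have dd: "d (coord_p (fst x)) = fibre_factor \<mu> a (coord_p (fst x))" using True by (simp add: d_def)
        show ?thesis unfolding dd b_def jacobian_moebius_def by (simp only: norm_mult norm_power power_mult_distrib)
      qed
      have "(lie_moebius a (fst x), d (coord_p (fst x)) *s snd x) = hartogs_moebius \<mu> a x"
        using True by (simp add: hartogs_moebius_def d_def)
      then show ?thesis
        using hartogs_moebius_mem_iff[OF a True, of \<mu>] True unfolding j by (auto simp: h_def split: split_indicator)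
    qed
  qed
  also have "\<dots> = (\<integral>\<^sup>+z. \<integral>\<^sup>+Z. ennreal (b (coord_p z) * (cmod (d (coord_p z)) ^ ?m)\<^sup>2) * h (lie_moebius a z, d (coord_p z) *s Z)
            * indicator (ball 0 1) (coord_p z) \<partial>lborel \<partial>lborel)"
    using main by (subst nn_integral_lborel_Pair) (simp_all add: borel_prod)
  also have "\<dots> = (\<integral>\<^sup>+z. ennreal (b (coord_p z)) * H (lie_moebius a z) * indicator (ball 0 1) (coord_p z) \<partial>lborel)"
  proof (intro nn_integral_cong)
    fix z :: "complex^3"
    have hz [measurable]: "(\<lambda>Z. h (lie_moebius a z, Z)) \<in> borel_measurable borel" by measurable
    have lm: "(\<lambda>Z. d (coord_p z) *s Z) \<in> borel_measurable (borel :: (complex^'m) measure)"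
      by (rule borel_measurable_linear[OF linear_vec_smult])
    have hz2 [measurable]: "(\<lambda>Z. h (lie_moebius a z, d (coord_p z) *s Z)) \<in> borel_measurable (borel :: (complex^'m) measure)"
      using measurable_compose[OF lm hz] by simp
    have "(\<integral>\<^sup>+Z. ennreal (b (coord_p z) * (cmod (d (coord_p z)) ^ ?m)\<^sup>2) * h (lie_moebius a z, d (coord_p z) *s Z) * indicator (ball 0 1) (coord_p z) \<partial>lborel)
      = ennreal (b (coord_p z) * (cmod (d (coord_p z)) ^ ?m)\<^sup>2) * (\<integral>\<^sup>+Z. h (lie_moebius a z, d (coord_p z) *s Z) \<partial>lborel) * indicator (ball 0 1) (coord_p z)"
      by (simp add: nn_integral_cmult nn_integral_multc)
    also have "ennreal (b (coord_p z) * (cmod (d (coord_p z)) ^ ?m)\<^sup>2) * (\<integral>\<^sup>+Z. h (lie_moebius a z, d (coord_p z) *s Z) \<partial>lborel)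
        = ennreal (b (coord_p z)) * (ennreal ((cmod (d (coord_p z)) ^ ?m)\<^sup>2) * (\<integral>\<^sup>+Z. h (lie_moebius a z, d (coord_p z) *s Z) \<partial>lborel))"
      using b0 by (simp only: ennreal_mult' mult.assoc)
    also have "ennreal ((cmod (d (coord_p z)) ^ ?m)\<^sup>2) * (\<integral>\<^sup>+Z. h (lie_moebius a z, d (coord_p z) *s Z) \<partial>lborel) = H (lie_moebius a z)"
      unfolding H_def by (rule nn_integral_cvec_scale[OF hz d0])
    finally show "(\<integral>\<^sup>+Z. ennreal (b (coord_p z) * (cmod (d (coord_p z)) ^ ?m)\<^sup>2) * h (lie_moebius a z, d (coord_p z) *s Z) * indicator (ball 0 1) (coord_p z) \<partial>lborel)
        = ennreal (b (coord_p z)) * H (lie_moebius a z) * indicator (ball 0 1) (coord_p z)" .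
  qed
  also have "\<dots> = (\<integral>\<^sup>+z. H z * indicator (ball 0 1) (coord_p z) \<partial>lborel)"
    unfolding b_def by (rule nn_integral_lie_moebius[OF a]) measurable
  also have "\<dots> = (\<integral>\<^sup>+z. \<integral>\<^sup>+Z. h (z, Z) \<partial>lborel \<partial>lborel)"
  proof (intro nn_integral_cong)
    fix z :: "complex^3"
    show "H z * indicator (ball 0 1) (coord_p z) = (\<integral>\<^sup>+Z. h (z, Z) \<partial>lborel)"
    proof (cases "cmod (coord_p z) < 1")
      case False
      then have "(z, Z) \<notin> ?U" for Z using hartogs_lie_coord_p[of "(z, Z)" \<mu>] by auto
      then have "h (z, Z) = 0" for Z by (simp add: h_def)
      then show ?thesis using False by simp
    qed (simp add: H_def)
  qed
  also have "\<dots> = (\<integral>\<^sup>+x. h x \<partial>lborel)"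
    by (rule nn_integral_lborel_Pair[OF hm, symmetric])
  finally show ?thesis by (simp add: h_def)
qed

lemma bihol_aut_hartogs_moebius:
  assumes a: "\<bar>a\<bar> < 1"
  shows "bihol_aut (hartogs_lie \<mu> :: ((complex^3) \<times> (complex^'m)) set) (hartogs_moebius \<mu> a) (hartogs_moebius \<mu> (- a)) (jacobian_moebius \<mu> a)"
  unfolding bihol_aut_def
proof (intro conjI ballI)
  have a': "\<bar>- a\<bar> < 1" using a by simp
  fix x :: "(complex^3) \<times> (complex^'m)" assume x: "x \<in> hartogs_lie \<mu>"
  show "hartogs_moebius \<mu> a x \<in> hartogs_lie \<mu>" "hartogs_moebius \<mu> (- a) x \<in> hartogs_lie \<mu>"
    by (rule hartogs_moebius_mem[OF a x], rule hartogs_moebius_mem[OF a' x])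
  show "hartogs_moebius \<mu> (- a) (hartogs_moebius \<mu> a x) = x" by (rule hartogs_moebius_inverse[OF a x])
  show "hartogs_moebius \<mu> a (hartogs_moebius \<mu> (- a) x) = x" using hartogs_moebius_inverse[OF a' x] by simp
  show "jacobian_moebius \<mu> a x \<noteq> 0" by (rule jacobian_moebius_nonzero[OF a x])
next
  show "holo_map (hartogs_moebius \<mu> a) (hartogs_lie \<mu> :: ((complex^3) \<times> (complex^'m)) set)"
    "holo_map (hartogs_moebius \<mu> (- a)) (hartogs_lie \<mu> :: ((complex^3) \<times> (complex^'m)) set)"
    "holomorphic_sev (jacobian_moebius \<mu> a) (hartogs_lie \<mu> :: ((complex^3) \<times> (complex^'m)) set)"
    using a by (auto intro: holo_map_hartogs_moebius holomorphic_sev_jacobian_moebius)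
next
  fix g :: "(complex^3) \<times> (complex^'m) \<Rightarrow> ennreal" assume "g \<in> borel_measurable borel"
  then show "(\<integral>\<^sup>+x. ennreal ((cmod (jacobian_moebius \<mu> a x))\<^sup>2) * g (hartogs_moebius \<mu> a x) * indicator (hartogs_lie \<mu>) x \<partial>lborel)
       = (\<integral>\<^sup>+x. g x * indicator (hartogs_lie \<mu>) x \<partial>lborel)"
    by (rule nn_integral_hartogs_moebius[OF a])
qed

section \<open>Linear automorphisms and a normal form for points of the Lie ball\<close>

definition clin :: "(complex^'n \<Rightarrow> complex^'n) \<Rightarrow> bool" where
  "clin A \<longleftrightarrow> (\<forall>x y. A (x + y) = A x + A y) \<and> (\<forall>c x. A (c *s x) = c *s A x)"

lemma scaleR_eq_smult: "r *\<^sub>R x = complex_of_real r *s (x :: complex^'n)"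
  unfolding vec_eq_iff vector_scaleR_component vector_smult_component by (simp add: scaleR_conv_of_real)

lemma clin_linear: "clin A \<Longrightarrow> linear A"
  by (rule linearI) (simp_all add: clin_def scaleR_eq_smult)

lemma norm_Pair_eq: "norm a = norm c \<Longrightarrow> norm b = norm d \<Longrightarrow> norm (a, b) = norm (c, d)"
  by (simp add: norm_Pair)

lemma bihol_aut_linear:
  fixes A A' :: "complex^'n \<Rightarrow> complex^'n" and B B' :: "complex^'m \<Rightarrow> complex^'m"
  assumes U: "open U" and A: "clin A" "clin A'" "\<And>x. A' (A x) = x" "\<And>x. A (A' x) = x" "\<And>x. norm (A x) = norm x"
    and B: "clin B" "clin B'" "\<And>x. B' (B x) = x" "\<And>x. B (B' x) = x" "\<And>x. norm (B x) = norm x"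
    and mem: "\<And>x y. (A x, B y) \<in> U \<longleftrightarrow> (x, y) \<in> U"
  shows "bihol_aut U (\<lambda>x. (A (fst x), B (snd x))) (\<lambda>x. (A' (fst x), B' (snd x))) (\<lambda>x. 1)"
proof -
  have mem': "(A' x, B' y) \<in> U \<longleftrightarrow> (x, y) \<in> U" for x y
    using mem[of "A' x" "B' y"] A(4) B(4) by simp
  have holo: "holo_map (\<lambda>x. (C (fst x), D (snd x))) U" if "clin C" "clin D" for C :: "complex^'n \<Rightarrow> complex^'n" and D :: "complex^'m \<Rightarrow> complex^'m"
    unfolding holo_map_def
  proof (intro ballI exI conjI allI)
    have CD: "bounded_linear C" "bounded_linear D"
      using clin_linear[OF that(1)] clin_linear[OF that(2)] by (simp_all add: linear_conv_bounded_linear)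
    show "((\<lambda>x. (C (fst x), D (snd x))) has_derivative (\<lambda>x. (C (fst x), D (snd x)))) (at x)" for x
      by (rule bounded_linear_imp_has_derivative bounded_linear_Pair
          bounded_linear_compose[OF CD(1) bounded_linear_fst] bounded_linear_compose[OF CD(2) bounded_linear_snd])+
    show "(C (fst (cscale c x)), D (snd (cscale c x))) = cscale c (C (fst x), D (snd x))" for c and x :: "(complex^'n) \<times> (complex^'m)"
      using that by (simp add: clin_def cscale_def)
  qed
  let ?F = "\<lambda>x. (A (fst x), B (snd x))"
  have linF: "linear ?F"
    using clin_linear[OF A(1)] clin_linear[OF B(1)]
    by (intro linearI) (simp_all add: linear_add linear_scale)
  have normF: "norm (?F x) = norm x" for x :: "(complex^'n) \<times> (complex^'m)"
    using norm_Pair_eq[of "A (fst x)" "fst x" "B (snd x)" "snd x"] A(5) B(5) by simp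
  show ?thesis
    unfolding bihol_aut_def
  proof (intro conjI ballI)
    show "holo_map ?F U" "holo_map (\<lambda>x. (A' (fst x), B' (snd x))) U" by (intro holo A B)+
    show "holomorphic_sev (\<lambda>x. 1) U" by (rule holomorphic_sev_const)
  next
    fix x assume x: "x \<in> U"
    show "?F x \<in> U" "(A' (fst x), B' (snd x)) \<in> U"
      using x mem[of "fst x" "snd x"] mem'[of "fst x" "snd x"] by simp_all
  next
    fix g :: "(complex^'n) \<times> (complex^'m) \<Rightarrow> ennreal" assume g [measurable]: "g \<in> borel_measurable borel"
    have [measurable]: "U \<in> sets borel" using U by (rule borel_open)
    define h where "h = (\<lambda>x. g x * indicator U x)"
    have h: "h \<in> borel_measurable borel" unfolding h_def by measurable
    have "(\<integral>\<^sup>+x. ennreal ((cmod 1)\<^sup>2) * g (?F x) * indicator U x \<partial>lborel) = (\<integral>\<^sup>+x. h (?F x) \<partial>lborel)"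
      by (intro nn_integral_cong) (simp add: h_def indicator_def mem split: prod.splits)
    also have "\<dots> = (\<integral>\<^sup>+x. h x \<partial>lborel)"
      by (rule nn_integral_linear_isometry[OF linF normF h])
    finally show "(\<integral>\<^sup>+x. ennreal ((cmod 1)\<^sup>2) * g (?F x) * indicator U x \<partial>lborel) = (\<integral>\<^sup>+x. g x * indicator U x \<partial>lborel)"
      unfolding h_def .
  qed (simp_all add: A B)
qed

definition cinner :: "complex^'n \<Rightarrow> complex^'n \<Rightarrow> complex" where
  "cinner x y = (\<Sum>i\<in>UNIV. x $ i * cnj (y $ i))"

lemma cinner_add_left: "cinner (x + y) z = cinner x z + cinner y z"
  by (simp add: cinner_def sum.distrib algebra_simps)
lemma cinner_diff_left: "cinner (x - y) z = cinner x z - cinner y z"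
  by (simp add: cinner_def sum_subtractf algebra_simps)
lemma cinner_diff_right: "cinner z (x - y) = cinner z x - cinner z y"
  by (simp add: cinner_def sum_subtractf algebra_simps)
lemma cinner_smult_left: "cinner (c *s x) z = c * cinner x z"
  by (simp add: cinner_def sum_distrib_left mult_ac)
lemma cinner_smult_right: "cinner z (c *s x) = cnj c * cinner z x"
  by (simp add: cinner_def sum_distrib_left mult_ac)
lemma cnj_cinner: "cnj (cinner x y) = cinner y x"
  by (simp add: cinner_def mult_ac)
lemma cinner_self: "cinner x x = of_real ((norm x)\<^sup>2)"
  unfolding cinner_def norm_vec_sq complex_norm_square[symmetric] by simp

text \<open>The complex Householder reflection. Division by zero makes it the identity for v = 0, so that no case
distinction is needed when the vectors to be exchanged coincide.\<close>
definition reflect :: "complex^'n \<Rightarrow> complex^'n \<Rightarrow> complex^'n" where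
  "reflect v x = x - (2 * cinner x v / cinner v v) *s v"

lemma clin_reflect: "clin (reflect v)"
  unfolding clin_def reflect_def
  by (auto simp: cinner_add_left cinner_smult_left vec_eq_iff add_divide_distrib algebra_simps)

lemma reflect_add: "reflect v (x + y) = reflect v x + reflect v y"
  and reflect_smult: "reflect v (c *s x) = c *s reflect v x"
  using clin_reflect[of v] unfolding clin_def by blast+

lemma cinner_reflect: "cinner (reflect v x) (reflect v y) = cinner x y"
proof (cases "cinner v v = 0")
  case False
  have r: "cnj (cinner v v) = cinner v v" by (rule cnj_cinner)
  show ?thesis
    unfolding reflect_def cinner_diff_left cinner_diff_right cinner_smult_left cinner_smult_right complex_cnj_divide complex_cnj_mult r
      cnj_cinner using False by (simp add: field_simps)
qed (simp add: reflect_def)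

lemma norm_reflect: "norm (reflect v x) = norm x"
proof -
  have "complex_of_real ((norm (reflect v x))\<^sup>2) = of_real ((norm x)\<^sup>2)"
    unfolding cinner_self[symmetric] by (rule cinner_reflect)
  then have "(norm (reflect v x))\<^sup>2 = (norm x)\<^sup>2" by (simp only: of_real_eq_iff)
  then show ?thesis by (simp add: power2_eq_iff_nonneg)
qed

lemma reflect_reflect: "reflect v (reflect v x) = x"
proof (cases "cinner v v = 0")
  case False
  then have "cinner (reflect v x) v = - cinner x v"
    by (simp add: reflect_def cinner_diff_left cinner_smult_left)
  then show ?thesis
    by (simp add: reflect_def[of v "reflect v x"]) (simp add: reflect_def vec_eq_iff)
qed (simp add: reflect_def)

lemma reflect_fixes: "cinner x v = 0 \<Longrightarrow> reflect v x = x"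
  by (simp add: reflect_def)

lemma reflect_diff_maps:
  assumes "norm u = norm w" "cinner u w = cinner w u"
  shows "reflect (u - w) u = w"
proof (cases "cinner (u - w) (u - w) = 0")
  case True
  then have "u = w" by (simp add: cinner_self)
  then show ?thesis by (simp add: reflect_def)
next
  case False
  have "2 * cinner u (u - w) = cinner (u - w) (u - w)"
    by (simp only: cinner_diff_left cinner_diff_right) (use assms in \<open>simp add: cinner_self\<close>)
  then show ?thesis using False by (simp add: reflect_def)
qed

definition cdot :: "complex^'n \<Rightarrow> complex" where "cdot z = (\<Sum>i\<in>UNIV. (z $ i)\<^sup>2)"

definition cvec :: "real^'n \<Rightarrow> complex^'n" where "cvec x = (\<chi> i. of_real (x $ i))"

text \<open>For real v the reflection is a real orthogonal map, hence preserves z . z and the Lie ball.\<close>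
lemma cdot_reflect_real: "cdot (reflect (cvec v) z) = cdot z"
proof (cases "cinner (cvec v) (cvec v) = 0")
  case False
  define k where "k = 2 * cinner z (cvec v) / cinner (cvec v) (cvec v)"
  have "cdot (reflect (cvec v) z) = (\<Sum>i\<in>UNIV. (z $ i)\<^sup>2 - 2 * k * (z $ i * of_real (v $ i)) + k\<^sup>2 * (of_real (v $ i) * of_real (v $ i)))"
    unfolding cdot_def reflect_def k_def[symmetric]
    by (intro sum.cong) (simp_all add: cvec_def power2_eq_square algebra_simps)
  also have "\<dots> = cdot z - 2 * k * cinner z (cvec v) + k\<^sup>2 * cinner (cvec v) (cvec v)"
    by (simp add: cdot_def cinner_def cvec_def sum.distrib sum_subtractf sum_distrib_left)
  also have "\<dots> = cdot z" unfolding k_def using False by (simp add: field_simps power2_eq_square)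
  finally show ?thesis .
qed (simp add: reflect_def)

lemma lie_norm_cdot: "lie_norm z = 1 - 2 * (norm z)\<^sup>2 + (cmod (cdot z))\<^sup>2"
  by (simp add: lie_norm_def cdot_def)

lemma cdot_smult: "cdot (c *s z) = c\<^sup>2 * cdot z"
  by (simp add: cdot_def sum_distrib_left power_mult_distrib)

lemma clin_smult: "clin ((*s) c)"
  by (simp add: clin_def vec_eq_iff algebra_simps)

lemma cvec_diff: "cvec (x - y) = cvec x - cvec y"
  by (simp add: cvec_def vec_eq_iff)
lemma cvec_scaleR: "cvec (r *\<^sub>R x) = of_real r *s cvec x"
  by (simp add: cvec_def vec_eq_iff)
lemma cinner_cvec: "cinner (cvec x) (cvec y) = of_real (x \<bullet> y)"
  by (simp add: cinner_def cvec_def inner_vec_def)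
lemma norm_cvec: "norm (cvec x) = norm x"
  by (simp add: cvec_def norm_vec_def)
lemma reflect_cvec: "\<exists>y'. reflect (cvec v) (cvec y) = cvec y'"
proof
  show "reflect (cvec v) (cvec y) = cvec (y - (2 * (y \<bullet> v) / (v \<bullet> v)) *\<^sub>R v)"
    unfolding cvec_diff cvec_scaleR by (simp add: reflect_def cinner_cvec)
qed

lemma reflect_cvec_maps:
  assumes "norm u = norm w"
  shows "reflect (cvec (u - w)) (cvec u) = cvec w"
  unfolding cvec_diff by (rule reflect_diff_maps) (simp_all add: norm_cvec cinner_cvec assms inner_commute)

lemma complex_rotate_nonneg: "\<exists>c. cmod c = 1 \<and> c\<^sup>2 * d = of_real (cmod d)"
proof (cases "d = 0")
  case True then show ?thesis by (intro exI[of _ 1]) simp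
next
  case False
  \<comment> \<open>the square of c is the conjugate phase of d\<close>
  define c where "c = csqrt (cnj (sgn d))"
  have c2: "c\<^sup>2 = cnj (sgn d)" by (simp add: c_def)
  then have "(cmod c)\<^sup>2 = 1" using False by (metis complex_mod_cnj norm_power norm_sgn)
  then have "cmod c = 1" by (simp add: power2_eq_1_iff) (metis norm_ge_zero not_one_le_zero neg_equal_0_iff_equal le_minus_one_simps(3))
  moreover have "c\<^sup>2 * d = of_real (cmod d)"
    unfolding c2 using False
    by (simp add: sgn_div_norm scaleR_conv_of_real) (simp add: field_simps complex_norm_square[symmetric] power2_eq_square mult.commute[of _ d] flip: of_real_mult)
  ultimately show ?thesis by blast
qed

text \<open>A phase makes z . z nonnegative, so the real and imaginary parts of z become orthogonal. Two real
reflections then move them to the first two coordinate axes, where s = 0 and p, q are real. The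
property P is only required to pass backwards along these maps.\<close>
lemma lie_ball_normal_form:
  fixes P :: "complex^3 \<Rightarrow> bool"
  assumes phase: "\<And>c z. cmod c = 1 \<Longrightarrow> P (c *s z) \<Longrightarrow> P z"
    and refl: "\<And>v z. P (reflect (cvec v) z) \<Longrightarrow> P z"
    and base: "\<And>a b. P (lie_pt (of_real a) 0 (of_real b))"
  shows "P z"
proof -
  obtain c where c: "cmod c = 1" "c\<^sup>2 * cdot z = of_real (cmod (cdot z))"
    using complex_rotate_nonneg by blast
  define x y :: "real^3" where "x = (\<chi> i. Re ((c *s z) $ i))" and "y = (\<chi> i. Im ((c *s z) $ i))"
  have xy: "c *s z = cvec x + \<i> *s cvec y"
    unfolding vec_eq_iff x_def y_def cvec_def vector_add_component vector_smult_component vec_lambda_beta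
    by (intro allI complex_eq)
  have "cdot (c *s z) = of_real (cmod (cdot z))"
    using c(2) by (simp add: cdot_smult)
  then have "Im (cdot (c *s z)) = 0" by simp
  moreover have "Im (cdot (c *s z)) = 2 * (x \<bullet> y)"
    unfolding xy by (simp add: cdot_def cvec_def inner_vec_def Im_power2 sum_distrib_left algebra_simps)
  ultimately have orth: "x \<bullet> y = 0" by simp
  define w1 w2 where "w1 = norm x *\<^sub>R (axis 1 1 :: real^3)" "w2 = axis (2::3) (1::real)"
  define H1 where "H1 = reflect (cvec (x - w1))"
  have H1x: "H1 (cvec x) = cvec w1"
    unfolding H1_def by (rule reflect_cvec_maps) (simp add: w1_w2_def)
  obtain y' where y': "H1 (cvec y) = cvec y'" unfolding H1_def using reflect_cvec by blast
  have "complex_of_real (w1 \<bullet> y') = of_real (x \<bullet> y)"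
    unfolding cinner_cvec[symmetric] H1x[symmetric] y'[symmetric] unfolding H1_def by (rule cinner_reflect)
  then have orth': "w1 \<bullet> y' = 0" using orth by (simp only: of_real_eq_iff)
  define v2 where "v2 = norm y' *\<^sub>R w2"
  define H2 where "H2 = reflect (cvec (y' - v2))"
  have H2y: "H2 (cvec y') = cvec v2"
    unfolding H2_def by (rule reflect_cvec_maps) (simp add: v2_def w1_w2_def)
  have "w1 \<bullet> w2 = 0" by (simp add: w1_w2_def inner_axis_axis)
  then have H2x: "H2 (cvec w1) = cvec w1"
    unfolding H2_def using orth' by (intro reflect_fixes) (simp add: cinner_cvec v2_def inner_diff_right)
  have "H2 (H1 (c *s z)) = cvec w1 + \<i> *s cvec v2"
  proof -
    have "H1 (cvec x + \<i> *s cvec y) = cvec w1 + \<i> *s cvec y'"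
      using H1x y' unfolding H1_def by (simp only: reflect_add reflect_smult)
    moreover have "H2 (cvec w1 + \<i> *s cvec y') = cvec w1 + \<i> *s cvec v2"
      using H2x H2y unfolding H2_def by (simp only: reflect_add reflect_smult)
    ultimately show ?thesis unfolding xy by (simp only:)
  qed
  also have "\<dots> = lie_pt (of_real (norm x - norm y')) 0 (of_real (norm x + norm y'))"
  proof -
    have "cvec w1 $ i = (if i = 1 then of_real (norm x) else 0)" for i
      by (simp add: cvec_def w1_w2_def axis_def)
    moreover have "cvec v2 $ i = (if i = 2 then of_real (norm y') else 0)" for i
      by (simp add: cvec_def v2_def w1_w2_def axis_def)
    ultimately show ?thesis
      by (simp add: vec_eq_iff forall_3 lie_pt_def complex_eq_iff)
  qed
  finally have nf: "H2 (H1 (c *s z)) = lie_pt (of_real (norm x - norm y')) 0 (of_real (norm x + norm y'))" .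
  have "P (H2 (H1 (c *s z)))" unfolding nf by (rule base)
  then have "P (H1 (c *s z))" unfolding H2_def by (rule refl)
  then have "P (c *s z)" unfolding H1_def by (rule refl)
  then show ?thesis by (rule phase[OF c(1)])
qed

lemma norm_axis_complex: "norm (axis i c :: complex^'m) = cmod c"
proof -
  have "(norm (axis i c :: complex^'m))\<^sup>2 = (\<Sum>j\<in>UNIV. if j = i then (cmod c)\<^sup>2 else 0)"
    unfolding norm_vec_sq by (intro sum.cong) (auto simp: axis_def)
  then have "(norm (axis i c :: complex^'m))\<^sup>2 = (cmod c)\<^sup>2" by simp
  then show ?thesis by (simp add: power2_eq_iff_nonneg)
qed

lemma lie_moebius_axis: "\<bar>a\<bar> < 1 \<Longrightarrow> lie_moebius a (lie_pt (of_real a) 0 q) = lie_pt 0 0 q"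
  by (simp add: lie_moebius_def moebius_def)

text \<open>Changing the sign of z2 exchanges p and q; it conjugates the Moebius map in p to one in q.\<close>
lemma lie_pt_swap: "reflect (cvec (axis 2 1)) (lie_pt p 0 q) = lie_pt q 0 p"
proof -
  have "cinner (cvec (axis 2 1)) (cvec (axis (2::3) 1)) = 1"
    by (simp add: cinner_cvec inner_axis_axis)
  moreover have "cinner (lie_pt p 0 q) (cvec (axis 2 1)) = (p - q) / (2 * \<i>)"
    by (simp add: cinner_def sum_3 lie_pt_def cvec_def axis_def)
  ultimately have "reflect (cvec (axis 2 1)) (lie_pt p 0 q) = lie_pt p 0 q - ((p - q) / \<i>) *s cvec (axis 2 1)"
    unfolding reflect_def by simp
  moreover have "lie_pt p 0 q - ((p - q) / \<i>) *s cvec (axis 2 1) = lie_pt q 0 p"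
    by (simp add: vec_eq_iff forall_3 lie_pt_def cvec_def axis_def field_simps)
  ultimately show ?thesis by (simp only:)
qed

text \<open>Householder reflections exchange two vectors of equal length only if their inner product is real,
which the phase of \<omega> achieves.\<close>
lemma exists_reflection_to_axis:
  fixes W :: "complex^'m"
  obtains v \<omega> where "reflect v W = axis i \<omega>" "cmod \<omega> = norm W"
proof -
  define c where "c = (if W $ i = 0 then 1 else sgn (W $ i))"
  have c: "cmod c = 1" by (simp add: c_def norm_sgn)
  have cW: "cnj c * W $ i = of_real (cmod (W $ i))"
  proof (cases "W $ i = 0")
    case False
    have "cnj (sgn (W $ i)) * W $ i = (W $ i * cnj (W $ i)) / of_real (cmod (W $ i))"
      by (simp add: sgn_div_norm scaleR_conv_of_real divide_inverse mult_ac)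
    also have "\<dots> = of_real (cmod (W $ i))"
      using False by (simp add: complex_norm_square[symmetric] power2_eq_square)
    finally show ?thesis using False by (simp add: c_def)
  qed simp
  define \<omega> where "\<omega> = c * of_real (norm W)"
  have w: "cmod \<omega> = norm W" by (simp add: \<omega>_def norm_mult c)
  have ax: "cinner W (axis i \<omega>) = W $ i * cnj \<omega>"
    by (simp add: cinner_def axis_def if_distrib[of cnj] if_distrib[of "\<lambda>x. _ * x"] cong: if_cong)
  have real: "W $ i * cnj \<omega> = of_real (cmod (W $ i) * norm W)"
    using cW by (simp add: \<omega>_def mult_ac)
  have "cinner W (axis i \<omega>) = cinner (axis i \<omega>) W"
    using cnj_cinner[of W "axis i \<omega>"] unfolding ax real by simp
  then have "reflect (W - axis i \<omega>) W = axis i \<omega>"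
    by (intro reflect_diff_maps) (simp add: norm_axis_complex w)
  then show ?thesis using w that by blast
qed

section \<open>The series of the kernel and its zeros\<close>

lemma neg_binomial_sums:
  fixes X :: complex
  assumes "cmod X < 1"
  shows "(\<lambda>n. of_real (fact (n + M) / fact n) * X ^ n) sums (fact M * (1 / (1 - X)) ^ (M + 1))"
proof -
  have "(\<lambda>n. ((- of_nat (M + 1)) gchoose n) * (- X) ^ n) sums (1 + (- X)) powr (- of_nat (M + 1))"
    by (rule gen_binomial_complex) (use assms in simp)
  moreover have "((- of_nat (M + 1)) gchoose n) * (- X) ^ n = of_nat ((n + M) choose n) * X ^ n" for n
  proof -
    have "((- of_nat (M + 1) :: complex) gchoose n) = (- 1) ^ n * (of_nat (n + M) gchoose n)"
      unfolding gbinomial_minus by (simp add: algebra_simps)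
    moreover have "(- X) ^ n = (- 1) ^ n * X ^ n" by (rule power_minus)
    ultimately show ?thesis by (simp add: binomial_gbinomial flip: power_mult_distrib)
  qed
  moreover have "(1 + (- X)) powr (- of_nat (M + 1)) = (1 / (1 - X)) ^ (M + 1)"
  proof -
    have "1 - X \<noteq> 0" using assms by auto
    then have "(1 - X) powr (of_nat (M + 1)) = (1 - X) ^ (M + 1)" by (rule powr_nat'[OF disjI1])
    then show ?thesis by (simp only: powr_minus add_uminus_conv_diff power_one_over inverse_eq_divide)
  qed
  ultimately have "(\<lambda>n. of_nat ((n + M) choose n) * X ^ n) sums ((1 / (1 - X)) ^ (M + 1))" by simp
  then have "(\<lambda>n. fact M * (of_nat ((n + M) choose n) * X ^ n)) sums (fact M * (1 / (1 - X)) ^ (M + 1))"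
    by (rule sums_mult)
  moreover have "fact M * (of_nat ((n + M) choose n) * X ^ n) = of_real (fact (n + M) / fact n) * X ^ n" for n
  proof -
    have "of_nat ((n + M) choose n) = (fact (n + M) / (fact n * fact M) :: complex)"
      using binomial_fact[of n "n + M", where 'a = complex] by simp
    then show ?thesis by (simp add: field_simps)
  qed
  ultimately show ?thesis by simp
qed

text \<open>The factor by which the integral of the \<sigma>-th power of the generic norm over the ball depends on \<sigma>
is the reciprocal of this polynomial.\<close>
definition hua_poly :: "real \<Rightarrow> real" where "hua_poly \<sigma> = (\<sigma> + 1) * (\<sigma> + 2) * (2 * \<sigma> + 3)"

text \<open>Up to a constant, the reciprocal of the n-th moment of the Hartogs domain.\<close>
definition ker_coeff :: "nat \<Rightarrow> real \<Rightarrow> nat \<Rightarrow> real" where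
  "ker_coeff m \<mu> n = fact (n + m) / fact n * hua_poly (\<mu> * real (n + m))"

definition P_poly :: "nat \<Rightarrow> real \<Rightarrow> 'a \<Rightarrow> 'a::real_normed_field" where
  "P_poly m \<mu> \<eta> = of_real ((1 - \<mu>) * (2 - \<mu>) * (3 / 2 - \<mu>))
     + of_real ((real m + 1) * (\<mu> * (1 - \<mu>) * (13 / 2 - 7 * \<mu>))) * \<eta>
     + of_real ((real m + 1) * (real m + 2) * (3 * (3 / 2 - 2 * \<mu>) * \<mu>\<^sup>2)) * \<eta>\<^sup>2
     + of_real ((real m + 1) * (real m + 2) * (real m + 3) * \<mu> ^ 3) * \<eta> ^ 3"

text \<open>Expansion in rising factorials of t = n + m + 1. Multiplied by (n + m)! / n! these become the
coefficients of the negative binomial series, which explains the shape of P.\<close>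
lemma hua_poly_expand:
  "hua_poly (\<mu> * (t - 1)) = 2 * ((1 - \<mu>) * (2 - \<mu>) * (3 / 2 - \<mu>) + \<mu> * (1 - \<mu>) * (13 / 2 - 7 * \<mu>) * t
      + 3 * (3 / 2 - 2 * \<mu>) * \<mu>\<^sup>2 * (t * (t + 1)) + \<mu> ^ 3 * (t * (t + 1) * (t + 2)))"
  by (simp add: hua_poly_def power2_eq_square power3_eq_cube algebra_simps add_divide_distrib diff_divide_distrib)

lemma ker_coeff_sums:
  fixes X :: complex
  assumes X: "cmod X < 1"
  shows "(\<lambda>n. of_real (ker_coeff m \<mu> n) * X ^ n) sums (2 * fact m * (1 / (1 - X)) ^ (m + 1) * P_poly m \<mu> (1 / (1 - X)))"
proof -
  define e0 e1 e2 e3 where e: "e0 = (1 - \<mu>) * (2 - \<mu>) * (3 / 2 - \<mu>)" "e1 = \<mu> * (1 - \<mu>) * (13 / 2 - 7 * \<mu>)"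
    "e2 = 3 * (3 / 2 - 2 * \<mu>) * \<mu>\<^sup>2" "e3 = \<mu> ^ 3"
  define \<eta> where "\<eta> = 1 / (1 - X)"
  have f: "fact (n + (m + 1)) = (fact (n + m) * (real (n + m) + 1) :: real)"
    "fact (n + (m + 2)) = (fact (n + m) * ((real (n + m) + 1) * (real (n + m) + 2)) :: real)"
    "fact (n + (m + 3)) = (fact (n + m) * ((real (n + m) + 1) * (real (n + m) + 2) * (real (n + m) + 3)) :: real)" for n
    by (simp_all add: fact_reduce numeral_eq_Suc algebra_simps)
  have fm: "fact (m + 1) = (fact m * (of_nat m + 1) :: complex)"
    "fact (m + 2) = (fact m * ((of_nat m + 1) * (of_nat m + 2)) :: complex)"
    "fact (m + 3) = (fact m * ((of_nat m + 1) * (of_nat m + 2) * (of_nat m + 3)) :: complex)"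
    by (simp_all add: fact_reduce numeral_eq_Suc algebra_simps)
  have "hua_poly (\<mu> * real (n + m)) = 2 * (e0 + e1 * (real (n + m) + 1) + e2 * ((real (n + m) + 1) * (real (n + m) + 2))
      + e3 * ((real (n + m) + 1) * (real (n + m) + 2) * (real (n + m) + 3)))" for n
    using hua_poly_expand[of \<mu> "real (n + m) + 1"] unfolding e by (simp add: add.commute)
  then have k: "ker_coeff m \<mu> n = 2 * e0 * (fact (n + m) / fact n) + 2 * e1 * (fact (n + (m + 1)) / fact n)
      + 2 * e2 * (fact (n + (m + 2)) / fact n) + 2 * e3 * (fact (n + (m + 3)) / fact n)" for n
    unfolding ker_coeff_def f by (simp add: divide_inverse distrib_left distrib_right mult_ac)
  have s: "(\<lambda>n. of_real (2 * c) * (of_real (fact (n + (m + j)) / fact n) * X ^ n)) sums (of_real (2 * c) * (fact (m + j) * \<eta> ^ (m + j + 1)))" for c j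
    unfolding \<eta>_def by (intro sums_mult neg_binomial_sums X)
  have "(\<lambda>n. of_real (2 * e0) * (of_real (fact (n + (m + 0)) / fact n) * X ^ n)
      + of_real (2 * e1) * (of_real (fact (n + (m + 1)) / fact n) * X ^ n)
      + of_real (2 * e2) * (of_real (fact (n + (m + 2)) / fact n) * X ^ n)
      + of_real (2 * e3) * (of_real (fact (n + (m + 3)) / fact n) * X ^ n))
    sums (of_real (2 * e0) * (fact (m + 0) * \<eta> ^ (m + 0 + 1)) + of_real (2 * e1) * (fact (m + 1) * \<eta> ^ (m + 1 + 1))
       + of_real (2 * e2) * (fact (m + 2) * \<eta> ^ (m + 2 + 1)) + of_real (2 * e3) * (fact (m + 3) * \<eta> ^ (m + 3 + 1)))"
    by (intro sums_add s)
  moreover have "of_real (2 * e0) * (of_real (fact (n + (m + 0)) / fact n) * X ^ n)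
      + of_real (2 * e1) * (of_real (fact (n + (m + 1)) / fact n) * X ^ n)
      + of_real (2 * e2) * (of_real (fact (n + (m + 2)) / fact n) * X ^ n)
      + of_real (2 * e3) * (of_real (fact (n + (m + 3)) / fact n) * X ^ n) = of_real (ker_coeff m \<mu> n) * X ^ n" for n
    unfolding k of_real_add of_real_mult[symmetric] distrib_right mult.assoc[symmetric] by simp
  moreover have "of_real (2 * e0) * (fact (m + 0) * \<eta> ^ (m + 0 + 1)) + of_real (2 * e1) * (fact (m + 1) * \<eta> ^ (m + 1 + 1))
       + of_real (2 * e2) * (fact (m + 2) * \<eta> ^ (m + 2 + 1)) + of_real (2 * e3) * (fact (m + 3) * \<eta> ^ (m + 3 + 1))
      = 2 * fact m * \<eta> ^ (m + 1) * P_poly m \<mu> \<eta>"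
  proof -
    have "\<eta> ^ (m + 0 + 1) = \<eta> ^ (m + 1)" "\<eta> ^ (m + 1 + 1) = \<eta> ^ (m + 1) * \<eta>" "\<eta> ^ (m + 2 + 1) = \<eta> ^ (m + 1) * \<eta>\<^sup>2"
      "\<eta> ^ (m + 3 + 1) = \<eta> ^ (m + 1) * \<eta> ^ 3"
      by (simp_all add: power_add eval_nat_numeral mult_ac)
    moreover have "P_poly m \<mu> \<eta> = of_real e0 + (of_nat m + 1) * of_real e1 * \<eta> + (of_nat m + 1) * (of_nat m + 2) * of_real e2 * \<eta>\<^sup>2
        + (of_nat m + 1) * (of_nat m + 2) * (of_nat m + 3) * of_real e3 * \<eta> ^ 3"
      unfolding P_poly_def e by simp
    moreover have alg: "2 * a0 * (F * E) + 2 * a1 * (F * (M + 1) * (E * \<eta>)) + 2 * a2 * (F * ((M + 1) * (M + 2)) * (E * \<eta>\<^sup>2))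
        + 2 * a3 * (F * ((M + 1) * (M + 2) * (M + 3)) * (E * \<eta> ^ 3))
      = 2 * F * E * (a0 + (M + 1) * a1 * \<eta> + (M + 1) * (M + 2) * a2 * \<eta>\<^sup>2 + (M + 1) * (M + 2) * (M + 3) * a3 * \<eta> ^ 3)"
      for a0 a1 a2 a3 E F M :: complex by algebra
    ultimately show ?thesis unfolding fm by (simp only: add_0_right of_real_mult of_real_numeral)
  qed
  ultimately show ?thesis unfolding \<eta>_def by simp
qed

lemma Re_inverse_pos: "Re z > 0 \<Longrightarrow> Re (inverse z) > 0"
proof -
  assume z: "Re z > 0"
  then have "z \<noteq> 0" by auto
  moreover have "Re (inverse z) = Re z / (cmod z)\<^sup>2"
    by (simp add: inverse_eq_divide Re_divide cmod_power2)
  ultimately show ?thesis using z by simp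
qed

text \<open>The Routh-Hurwitz criterion in degree 3, including the boundary case. A root \<xi> would satisfy
A / \<xi> + B / (d3 \<xi> + d2) + \<xi> = 0 with A = d0 / d2 and B = d1 - A d3 nonnegative, but all three terms
have nonnegative real part, the last a positive one.\<close>
lemma cubic_no_root_right_half_plane:
  fixes d0 d1 d2 d3 :: real and \<xi> :: complex
  assumes d: "d0 \<ge> 0" "d2 > 0" "d3 > 0" "d1 * d2 \<ge> d0 * d3" and xi: "Re \<xi> > 0"
  shows "of_real d0 + of_real d1 * \<xi> + of_real d2 * \<xi>\<^sup>2 + of_real d3 * \<xi> ^ 3 \<noteq> 0"
proof
  assume 0: "of_real d0 + of_real d1 * \<xi> + of_real d2 * \<xi>\<^sup>2 + of_real d3 * \<xi> ^ 3 = 0"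
  define A where "A = d0 / d2"
  define B where "B = d1 - A * d3"
  have AB: "A \<ge> 0" "B \<ge> 0" "A * d2 = d0" "A * d3 + B = d1"
    using d by (auto simp: A_def B_def field_simps)
  define \<beta> where "\<beta> = of_real d3 * \<xi> + of_real d2"
  have beta: "Re \<beta> > 0" unfolding \<beta>_def using d xi by (simp add: add_pos_pos)
  have nz: "\<xi> \<noteq> 0" "\<beta> \<noteq> 0" using xi beta by auto
  have "of_real A * \<beta> + of_real B * \<xi> + \<xi>\<^sup>2 * \<beta> = of_real (A * d2) + of_real (A * d3 + B) * \<xi> + of_real d2 * \<xi>\<^sup>2 + of_real d3 * \<xi> ^ 3"
    unfolding \<beta>_def by (simp add: power2_eq_square power3_eq_cube algebra_simps)
  then have sum: "of_real A * \<beta> + of_real B * \<xi> + \<xi>\<^sup>2 * \<beta> = 0" unfolding AB using 0 by simp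
  define u v where "u = inverse \<xi>" "v = inverse \<beta>"
  have "of_real A * u + of_real B * v + \<xi> = 0"
    using nz sum by (simp add: u_v_def field_simps power2_eq_square)
  then have "Re (of_real A * u + of_real B * v + \<xi>) = 0" by (simp only: zero_complex.sel)
  then have "A * Re u + B * Re v + Re \<xi> = 0" by simp
  moreover have "Re u > 0" "Re v > 0"
    unfolding u_v_def by (rule Re_inverse_pos[OF xi], rule Re_inverse_pos[OF beta])
  moreover from this have "A * Re u \<ge> 0" "B * Re v \<ge> 0" using AB by simp_all
  ultimately show False using xi by linarith
qed

text \<open>Taylor expansion at 1/2, the image of X = -1 under X \<mapsto> 1 / (1 - X); the constant term is q.\<close>
lemma P_poly_shift:
  fixes \<xi> :: complex
  defines "D1 m \<mu> \<equiv> 13 / 2 + 9 / 2 * (real m - 1) * \<mu> + (3 / 4 * (real m)\<^sup>2 - 9 / 4 * real m - 1 / 2) * \<mu>\<^sup>2"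
    and "D2 m \<mu> \<equiv> 9 / 2 + 3 / 2 * (real m - 1) * \<mu>"
  shows "P_poly m \<mu> (1 / 2 + \<xi>) = of_real (q_poly m \<mu>) + of_real ((real m + 1) * \<mu> * D1 m \<mu>) * \<xi>
      + of_real ((real m + 1) * (real m + 2) * \<mu>\<^sup>2 * D2 m \<mu>) * \<xi>\<^sup>2
      + of_real ((real m + 1) * (real m + 2) * (real m + 3) * \<mu> ^ 3) * \<xi> ^ 3"
proof -
  define A0 A1 A2 A3 where A: "A0 = (1 - \<mu>) * (2 - \<mu>) * (3 / 2 - \<mu>)" "A1 = (real m + 1) * (\<mu> * (1 - \<mu>) * (13 / 2 - 7 * \<mu>))"
    "A2 = (real m + 1) * (real m + 2) * (3 * (3 / 2 - 2 * \<mu>) * \<mu>\<^sup>2)"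
    "A3 = (real m + 1) * (real m + 2) * (real m + 3) * \<mu> ^ 3"
  have 0: "q_poly m \<mu> = A0 + A1 / 2 + A2 / 4 + A3 / 8"
    unfolding A q_poly_def by (simp add: field_simps power2_eq_square power3_eq_cube)
  have 1: "(real m + 1) * \<mu> * D1 m \<mu> = A1 + A2 + 3 / 4 * A3"
    unfolding A D1_def by (simp add: field_simps power2_eq_square power3_eq_cube)
  have 2: "(real m + 1) * (real m + 2) * \<mu>\<^sup>2 * D2 m \<mu> = A2 + 3 / 2 * A3"
    unfolding A D2_def by (simp add: field_simps power2_eq_square power3_eq_cube)
  have "P_poly m \<mu> (1 / 2 + \<xi>) = of_real A0 + of_real A1 * (1 / 2 + \<xi>) + of_real A2 * (1 / 2 + \<xi>)\<^sup>2 + of_real A3 * (1 / 2 + \<xi>) ^ 3"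
    unfolding P_poly_def A by simp
  also have "\<dots> = of_real (A0 + A1 / 2 + A2 / 4 + A3 / 8) + of_real (A1 + A2 + 3 / 4 * A3) * \<xi>
      + of_real (A2 + 3 / 2 * A3) * \<xi>\<^sup>2 + of_real A3 * \<xi> ^ 3"
    by (simp add: field_simps power2_eq_square power3_eq_cube)
  finally show ?thesis unfolding 0 1 2 A(4)[symmetric] .
qed

text \<open>The difference of the two sides is a cubic in \<mu>. Its coefficients are nonnegative for m \<ge> 3; for
m = 1, 2 the condition q \<ge> 0 bounds \<mu> and thereby the negative terms.\<close>
lemma hurwitz_inequality:
  fixes \<mu> :: real
  assumes m: "m \<ge> 1" and mu: "\<mu> > 0" and q: "q_poly m \<mu> \<ge> 0"
  shows "(real m + 1) * (13 / 2 + 9 / 2 * (real m - 1) * \<mu> + (3 / 4 * (real m)\<^sup>2 - 9 / 4 * real m - 1 / 2) * \<mu>\<^sup>2)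
     * (9 / 2 + 3 / 2 * (real m - 1) * \<mu>) \<ge> (real m + 3) * q_poly m \<mu>"
proof -
  define x where "x = real m"
  have eq: "(x + 1) * (13 / 2 + 9 / 2 * (x - 1) * \<mu> + (3 / 4 * x\<^sup>2 - 9 / 4 * x - 1 / 2) * \<mu>\<^sup>2)
     * (9 / 2 + 3 / 2 * (x - 1) * \<mu>) - (x + 3) * q_poly m \<mu>
     = (x - 1) * x * (x\<^sup>2 - 2 * x - 2) * \<mu> ^ 3 + (9 * x ^ 3 - 27 / 2 * x\<^sup>2 - 9 * x + 9 / 2) * \<mu>\<^sup>2
       + (x - 1) * (107 / 4 * x + 81 / 4) * \<mu> + (105 / 4 * x + 81 / 4)"
    unfolding q_poly_def x_def[symmetric] by (simp add: field_simps power2_eq_square power3_eq_cube)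
  have "\<dots> \<ge> 0"
  proof -
    consider "m = 1" | "m = 2" | "m \<ge> 3" using m by linarith
    then show ?thesis
    proof cases
      case 1
      then have "\<mu>\<^sup>2 \<le> 4 / 3" using q by (simp add: q_poly_def)
      then show ?thesis using 1 by (simp add: x_def)
    next
      case 2
      then have "0 \<le> - (\<mu> ^ 3) - 9 / 4 * \<mu>\<^sup>2 + 13 / 4 * \<mu> + 3" using q by (simp add: q_poly_def)
      moreover have "0 \<le> \<mu>\<^sup>2" by simp
      ultimately have "\<mu> ^ 3 \<le> 13 / 4 * \<mu> + 3" by linarith
      then have h: "4 * \<mu> ^ 3 \<le> 13 * \<mu> + 12" by simp
      have sq: "0 \<le> \<mu> * \<mu>" by simp
      show ?thesis unfolding x_def 2 by (simp add: power2_eq_square) (use mu sq h in linarith)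
    next
      case 3
      define y where "y = x - 3"
      have y: "y \<ge> 0" "x = y + 3" using 3 by (simp_all add: y_def x_def)
      have e1: "x\<^sup>2 - 2 * x - 2 = y\<^sup>2 + 4 * y + 1" unfolding y(2) by (simp add: power2_eq_square algebra_simps)
      have 1: "x\<^sup>2 - 2 * x - 2 \<ge> 0" unfolding e1 using y(1) by simp
      have e2: "9 * x ^ 3 - 27 / 2 * x\<^sup>2 - 9 * x + 9 / 2 = 9 * y ^ 3 + 135 / 2 * y\<^sup>2 + 153 * y + 99"
        unfolding y(2) by (simp add: power2_eq_square power3_eq_cube algebra_simps)
      have 2: "9 * x ^ 3 - 27 / 2 * x\<^sup>2 - 9 * x + 9 / 2 \<ge> 0" unfolding e2 using y(1) by simp
      have 3: "x \<ge> 1" using y by simp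
      have "(x - 1) * x * (x\<^sup>2 - 2 * x - 2) * \<mu> ^ 3 \<ge> 0"
        by (intro mult_nonneg_nonneg 1 zero_le_power) (use 3 mu in simp_all)
      moreover have "(9 * x ^ 3 - 27 / 2 * x\<^sup>2 - 9 * x + 9 / 2) * \<mu>\<^sup>2 \<ge> 0"
        by (rule mult_nonneg_nonneg[OF 2 zero_le_power2])
      moreover have "(x - 1) * (107 / 4 * x + 81 / 4) * \<mu> \<ge> 0"
        by (intro mult_nonneg_nonneg) (use 3 mu in simp_all)
      moreover have "105 / 4 * x + 81 / 4 \<ge> 0" using 3 by simp
      ultimately show ?thesis by linarith
    qed
  qed
  then show ?thesis using eq unfolding x_def by linarith
qed

lemma Re_cayley:
  assumes "cmod X < 1"
  shows "Re (1 / (1 - X)) > 1 / 2"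
proof -
  have nz: "1 - X \<noteq> 0" using assms by auto
  have "(cmod X)\<^sup>2 < 1" using assms by (simp add: power_less_one_iff)
  then have "(cmod (1 - X))\<^sup>2 < 2 * (1 - Re X)" by (simp add: cmod_power2) (simp add: power2_eq_square algebra_simps)
  moreover have "(cmod (1 - X))\<^sup>2 > 0" using nz by simp
  moreover have "Re (1 / (1 - X)) = (1 - Re X) / (cmod (1 - X))\<^sup>2" by (simp add: Re_divide cmod_power2)
  ultimately show ?thesis by (simp only: pos_less_divide_eq) simp
qed

lemma P_poly_no_zero:
  assumes m: "m \<ge> 1" and mu: "\<mu> > 0" and q: "q_poly m \<mu> \<ge> 0" and X: "cmod X < 1"
  shows "P_poly m \<mu> (1 / (1 - X)) \<noteq> 0"
proof -
  define \<xi> where "\<xi> = 1 / (1 - X) - 1 / 2"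
  have xi: "Re \<xi> > 0" unfolding \<xi>_def using Re_cayley[OF X] by simp
  let ?D1 = "13 / 2 + 9 / 2 * (real m - 1) * \<mu> + (3 / 4 * (real m)\<^sup>2 - 9 / 4 * real m - 1 / 2) * \<mu>\<^sup>2"
  let ?D2 = "9 / 2 + 3 / 2 * (real m - 1) * \<mu>"
  have D2: "?D2 > 0" using m mu by (intro add_pos_nonneg mult_nonneg_nonneg) auto
  have c: "0 \<le> (real m + 1) * (real m + 2) * \<mu> ^ 3" using mu by simp
  have "q_poly m \<mu> * ((real m + 1) * (real m + 2) * (real m + 3) * \<mu> ^ 3) = (real m + 1) * (real m + 2) * \<mu> ^ 3 * ((real m + 3) * q_poly m \<mu>)"
    by simp
  also have "\<dots> \<le> (real m + 1) * (real m + 2) * \<mu> ^ 3 * ((real m + 1) * ?D1 * ?D2)"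
    by (rule mult_left_mono[OF hurwitz_inequality[OF m mu q] c])
  also have "\<dots> = ((real m + 1) * \<mu> * ?D1) * ((real m + 1) * (real m + 2) * \<mu>\<^sup>2 * ?D2)"
    by (simp only: power2_eq_square power3_eq_cube mult_ac)
  finally have h: "q_poly m \<mu> * ((real m + 1) * (real m + 2) * (real m + 3) * \<mu> ^ 3) \<le> ((real m + 1) * \<mu> * ?D1) * ((real m + 1) * (real m + 2) * \<mu>\<^sup>2 * ?D2)" .
  have "P_poly m \<mu> (1 / 2 + \<xi>) \<noteq> 0"
    unfolding P_poly_shift
    by (rule cubic_no_root_right_half_plane[OF q _ _ h xi]) (use mu D2 in auto)
  then show ?thesis by (simp add: \<xi>_def)
qed

text \<open>P is real with positive leading coefficient, so a negative value at 1/2 forces a real zero to the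
right of 1/2, by the intermediate value theorem.\<close>
lemma P_poly_zero:
  assumes mu: "\<mu> > 0" and q: "q_poly m \<mu> < 0"
  obtains r :: real where "- 1 < r" "r < 1" "P_poly m \<mu> (1 / (1 - complex_of_real r)) = 0"
proof -
  let ?P = "\<lambda>\<eta>::real. P_poly m \<mu> \<eta>"
  define d where "d = (real m + 1) * (real m + 2) * (real m + 3) * \<mu> ^ 3"
  have d: "d > 0" unfolding d_def using mu by simp
  have half: "complex_of_real (?P (1 / 2)) = of_real (q_poly m \<mu>)"
    using P_poly_shift[of m \<mu> 0] by (simp add: P_poly_def)
  then have neg: "?P (1 / 2) < 0" using q by (simp only: of_real_eq_iff)
  have cont: "continuous_on UNIV ?P" unfolding P_poly_def by (intro continuous_intros)
  define a b c where "a = (1 - \<mu>) * (2 - \<mu>) * (3 / 2 - \<mu>)" "b = (real m + 1) * (\<mu> * (1 - \<mu>) * (13 / 2 - 7 * \<mu>))"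
    "c = (real m + 1) * (real m + 2) * (3 * (3 / 2 - 2 * \<mu>) * \<mu>\<^sup>2)"
  have P: "?P \<eta> = a + b * \<eta> + c * \<eta>\<^sup>2 + d * \<eta> ^ 3" for \<eta> :: real
    unfolding P_poly_def a_b_c_def d_def by simp
  have "filterlim (\<lambda>\<eta>. a + b * \<eta> + c * \<eta>\<^sup>2 + d * \<eta> ^ 3) at_top at_top" using d by real_asymp
  then have "eventually (\<lambda>\<eta>. ?P \<eta> > 0 \<and> \<eta> > 1 / 2) at_top"
    unfolding P by (intro eventually_conj filterlim_at_top_dense[THEN iffD1, rule_format] eventually_gt_at_top)
  then obtain \<eta>1 :: real where e1: "?P \<eta>1 > 0" "\<eta>1 > 1 / 2" using eventually_happens by force
  obtain \<eta> where eta: "1 / 2 \<le> \<eta>" "\<eta> \<le> \<eta>1" "?P \<eta> = 0"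
    using IVT'[of ?P "1 / 2" 0 \<eta>1] neg e1 continuous_on_subset[OF cont] by auto
  have "\<eta> \<noteq> 1 / 2"
  proof
    assume "\<eta> = 1 / 2"
    then have "?P (1 / 2) = 0" using eta(3) by (simp only:)
    then show False using neg by (simp only: less_irrefl)
  qed
  with eta have e: "\<eta> > 1 / 2" by simp
  define r where "r = 1 - 1 / \<eta>"
  show ?thesis
  proof (rule that[of r])
    show "- 1 < r" "r < 1" using e by (simp_all add: r_def field_simps)
    have "1 / (1 - complex_of_real r) = of_real \<eta>" using e by (simp add: r_def)
    moreover have "P_poly m \<mu> (complex_of_real \<eta>) = of_real (?P \<eta>)" unfolding P_poly_def by simp
    ultimately show "P_poly m \<mu> (1 / (1 - complex_of_real r)) = 0" using eta by simp
  qed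
qed

lemma q_poly_pos: "m \<ge> 6 \<Longrightarrow> \<mu> > 0 \<Longrightarrow> q_poly m \<mu> > 0"
proof -
  assume m: "m \<ge> 6" and mu: "\<mu> > 0"
  have "real m * (real m - 5) \<ge> 6 * 1" using m by (intro mult_mono) auto
  then have 1: "(real m)\<^sup>2 - 5 * real m - 2 \<ge> 0" by (simp add: power2_eq_square algebra_simps)
  show ?thesis
    unfolding q_poly_def using m mu 1
    by (intro add_nonneg_pos add_nonneg_nonneg mult_nonneg_nonneg divide_nonneg_nonneg zero_le_power) auto
qed

text \<open>Divided by x^2, the cubic is - a x + b + c / x + d / x^2, which is strictly decreasing.\<close>
lemma cubic_sign_once:
  fixes x y :: real
  assumes "a \<ge> 0" "c \<ge> 0" "d > 0" "0 < x" "x < y" "- a * x ^ 3 + b * x\<^sup>2 + c * x + d \<le> 0"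
  shows "- a * y ^ 3 + b * y\<^sup>2 + c * y + d < 0"
proof -
  let ?q = "\<lambda>x. - a * x ^ 3 + b * x\<^sup>2 + c * x + d"
  have "?q y * x\<^sup>2 - ?q x * y\<^sup>2 = - (a * (x\<^sup>2 * y\<^sup>2 * (y - x)) + c * (x * y * (y - x)) + d * ((y - x) * (y + x)))"
    by (simp add: power2_eq_square power3_eq_cube algebra_simps)
  moreover have "a * (x\<^sup>2 * y\<^sup>2 * (y - x)) \<ge> 0" "c * (x * y * (y - x)) \<ge> 0" "d * ((y - x) * (y + x)) > 0"
    using assms by simp_all
  ultimately have "?q y * x\<^sup>2 < ?q x * y\<^sup>2" by linarith
  also have "\<dots> \<le> 0" using assms by (simp add: mult_nonpos_nonneg)
  finally show ?thesis using assms by (simp add: mult_less_0_iff)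
qed

lemma q_poly_root:
  assumes m: "1 \<le> m" "m \<le> 5"
  shows "\<exists>!\<mu>. \<mu> > 0 \<and> q_poly m \<mu> = 0" and "\<mu> > 0 \<Longrightarrow> \<mu> \<le> mu_root m \<longleftrightarrow> q_poly m \<mu> \<ge> 0"
proof -
  have m': "m = 1 \<or> m = 2 \<or> m = 3 \<or> m = 4 \<or> m = 5" using m by linarith
  define a b c where "a = - ((real m - 1) * ((real m)\<^sup>2 - 5 * real m - 2) / 8)" "b = 9 * real m * (real m - 3) / 8" "c = 13 * (real m - 1) / 4"
  have ac: "a \<ge> 0" "c \<ge> 0" using m' by (auto simp: a_b_c_def)
  have q: "q_poly m x = - a * x ^ 3 + b * x\<^sup>2 + c * x + 3" for x
    unfolding q_poly_def a_b_c_def by simp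
  have once: "q_poly m y < 0" if "0 < x" "x < y" "q_poly m x \<le> 0" for x y
    using cubic_sign_once[OF ac, of 3 x y b] that unfolding q by simp
  \<comment> \<open>20 exceeds the root for each of the five values of m\<close>
  have "q_poly m 20 < 0" using m' by (auto simp: q_poly_def)
  moreover have "q_poly m 0 > 0" by (simp add: q_poly_def)
  moreover have "continuous_on {0..20} (q_poly m)" unfolding q_poly_def[abs_def] by (intro continuous_intros)
  ultimately obtain r where r: "0 \<le> r" "r \<le> 20" "q_poly m r = 0"
    using IVT2'[of "q_poly m" 20 0 0] by auto
  have r0: "r > 0" using r \<open>q_poly m 0 > 0\<close> by (cases "r = 0") auto
  have uniq: "x = r" if "x > 0" "q_poly m x = 0" for x
    using once[of x r] once[of r x] that r r0 by (cases x r rule: linorder_cases) auto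
  then show "\<exists>!\<mu>. \<mu> > 0 \<and> q_poly m \<mu> = 0" using r r0 by blast
  have root: "mu_root m = r" unfolding mu_root_def by (rule the_equality) (use r r0 in simp, use uniq in blast)
  show "\<mu> \<le> mu_root m \<longleftrightarrow> q_poly m \<mu> \<ge> 0" if "\<mu> > 0"
    unfolding root
  proof (cases \<mu> r rule: linorder_cases)
    case less
    then have "\<not> q_poly m \<mu> \<le> 0" using once[of \<mu> r] that r by force
    then show "\<mu> \<le> r \<longleftrightarrow> q_poly m \<mu> \<ge> 0" using less by linarith
  next
    case equal
    then show "\<mu> \<le> r \<longleftrightarrow> q_poly m \<mu> \<ge> 0" using r by simp
  next
    case greater
    then have "q_poly m \<mu> < 0" using once[of r \<mu>] r r0 by force
    then show "\<mu> \<le> r \<longleftrightarrow> q_poly m \<mu> \<ge> 0" using greater by linarith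
  qed
qed

definition ker_sum :: "nat \<Rightarrow> real \<Rightarrow> complex \<Rightarrow> complex" where
  "ker_sum m \<mu> X = 2 * fact m * (1 / (1 - X)) ^ (m + 1) * P_poly m \<mu> (1 / (1 - X))"

lemma ker_sum_sums: "cmod X < 1 \<Longrightarrow> (\<lambda>n. of_real (ker_coeff m \<mu> n) * X ^ n) sums ker_sum m \<mu> X"
  unfolding ker_sum_def by (rule ker_coeff_sums)

lemma ker_coeff_pos: "\<mu> > 0 \<Longrightarrow> ker_coeff m \<mu> n > 0"
  by (simp add: ker_coeff_def hua_poly_def add_nonneg_pos)

lemma ker_coeff_summable:
  assumes "0 \<le> r" "r < 1"
  shows "summable (\<lambda>n. ker_coeff m \<mu> n * r ^ n)"
proof -
  have "summable (\<lambda>n. of_real (ker_coeff m \<mu> n) * of_real r ^ n :: complex)"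
    using ker_sum_sums[of "of_real r" m \<mu>] assms by (intro sums_summable) simp
  then have "summable (\<lambda>n. complex_of_real (ker_coeff m \<mu> n * r ^ n))" by simp
  then show ?thesis by (simp only: summable_of_real_iff)
qed

lemma ker_sum_bound:
  assumes mu: "\<mu> > 0" and Xr: "cmod X \<le> r" "r < 1"
  shows "cmod (ker_sum m \<mu> X) \<le> (\<Sum>n. ker_coeff m \<mu> n * r ^ n)"
proof -
  have r: "0 \<le> r" using Xr norm_ge_zero[of X] by linarith
  have X: "cmod X < 1" using Xr by simp
  have le: "cmod (of_real (ker_coeff m \<mu> n) * X ^ n) \<le> ker_coeff m \<mu> n * r ^ n" for n
    using Xr less_imp_le[OF ker_coeff_pos[OF mu, of m n]] by (simp add: norm_mult norm_power mult_left_mono power_mono)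
  have s: "summable (\<lambda>n. cmod (of_real (ker_coeff m \<mu> n) * X ^ n))"
    by (rule summable_comparison_test'[OF ker_coeff_summable[OF r Xr(2)], of 0]) (use le in simp)
  have "cmod (ker_sum m \<mu> X) = cmod (\<Sum>n. of_real (ker_coeff m \<mu> n) * X ^ n)"
    unfolding sums_unique[OF ker_sum_sums[OF X]] ..
  also have "\<dots> \<le> (\<Sum>n. cmod (of_real (ker_coeff m \<mu> n) * X ^ n))" by (rule summable_norm[OF s])
  also have "\<dots> \<le> (\<Sum>n. ker_coeff m \<mu> n * r ^ n)"
    by (rule suminf_le[OF le s ker_coeff_summable[OF r Xr(2)]])
  finally show ?thesis .
qed

section \<open>Moments of the Hartogs domain\<close>

lemma measurable_vec_nth [measurable]: "(\<lambda>Z. Z $ i) \<in> borel_measurable (borel :: (complex^'m) measure)"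
  by (intro borel_measurable_continuous_onI continuous_intros)

definition ball_moment :: "'m::finite \<Rightarrow> nat \<Rightarrow> real \<Rightarrow> ennreal" where
  "ball_moment i k t = (\<integral>\<^sup>+Z. ennreal ((cmod (Z $ i)) ^ (2 * k)) * indicator {Z. (norm Z)\<^sup>2 < t} Z \<partial>(lborel :: (complex^'m) measure))"

text \<open>Substitute sqrt t times Z.\<close>
lemma ball_moment_scale:
  fixes i :: "'m::finite"
  assumes t: "t > 0"
  shows "ball_moment i k t = ennreal (t ^ (k + CARD('m))) * ball_moment i k 1"
proof -
  define g where "g = (\<lambda>Z :: complex^'m. ennreal ((cmod (Z $ i)) ^ (2 * k)) * indicator {Z. (norm Z)\<^sup>2 < t} Z)"
  have g: "g \<in> borel_measurable borel" unfolding g_def by measurable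
  define r where "r = sqrt t"
  have r: "r > 0" "r\<^sup>2 = t" using t by (simp_all add: r_def)
  have lin: "linear ((*\<^sub>R) r :: complex^'m \<Rightarrow> _)" by (rule linearI) (simp_all add: scaleR_right_distrib)
  have eq: "g (r *\<^sub>R Z) = ennreal (t ^ k) * (ennreal ((cmod (Z $ i)) ^ (2 * k)) * indicator {Z. (norm Z)\<^sup>2 < 1} Z)" for Z
  proof -
    have "(norm (r *\<^sub>R Z))\<^sup>2 = t * (norm Z)\<^sup>2" using r by (simp add: power_mult_distrib)
    then have i: "(indicator {Z. (norm Z)\<^sup>2 < t} (r *\<^sub>R Z) :: ennreal) = indicator {Z. (norm Z)\<^sup>2 < 1} Z"
      using t by (simp add: indicator_def)
    have "cmod ((r *\<^sub>R Z) $ i) ^ (2 * k) = t ^ k * cmod (Z $ i) ^ (2 * k)"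
      using r by (simp add: power_mult_distrib power_mult)
    then show ?thesis unfolding g_def i using t by (simp add: ennreal_mult' mult.assoc)
  qed
  have "ennreal (t ^ k) * ball_moment i k 1 = (\<integral>\<^sup>+Z. g (r *\<^sub>R Z) \<partial>lborel)"
    unfolding eq ball_moment_def by (rule nn_integral_cmult[symmetric]) measurable
  also have "\<dots> = ennreal ((1 / r) ^ DIM(complex^'m)) * ball_moment i k t"
    using nn_integral_linear_similarity[OF lin _ r(1) g] r by (simp add: g_def ball_moment_def)
  also have "(1 / r) ^ DIM(complex^'m) = 1 / t ^ CARD('m)"
    using r by (simp add: power_mult[symmetric] power_divide mult.commute[of _ 2] power_mult)
  finally have "ennreal (t ^ CARD('m)) * (ennreal (t ^ k) * ball_moment i k 1)
      = ennreal (t ^ CARD('m)) * (ennreal (1 / t ^ CARD('m)) * ball_moment i k t)" by simp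
  also have "\<dots> = ball_moment i k t"
    using t by (simp add: mult.assoc[symmetric] ennreal_mult'[symmetric])
  finally show ?thesis using t by (simp add: power_add ennreal_mult' mult_ac)
qed

lemma nn_integral_exp_tail: "(\<integral>\<^sup>+t. ennreal (exp (- t)) * indicator {a<..} t \<partial>lborel) = ennreal (exp (- a))"
proof -
  have "(\<integral>\<^sup>+t. ennreal (exp (- t)) * indicator {a<..} t \<partial>lborel) = (\<integral>\<^sup>+t. ennreal (exp (- t)) * indicator {a..} t \<partial>lborel)"
    by (rule nn_integral_cong_AE, rule AE_mp[OF AE_lborel_singleton[of a]]) (auto split: split_indicator)
  also have "\<dots> = ennreal (0 - (- exp (- a)))"
  proof (rule nn_integral_FTC_atLeast)
    show "((\<lambda>t. - exp (- t)) has_real_derivative exp (- x)) (at x)" for x :: real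
      by (auto intro!: derivative_eq_intros)
    have "((\<lambda>t::real. - exp (- t)) \<longlongrightarrow> - 0) at_top"
      by (intro tendsto_minus filterlim_compose[OF exp_at_bot] filterlim_uminus_at_bot_at_top)
    then show "((\<lambda>t::real. - exp (- t)) \<longlongrightarrow> 0) at_top" by simp
  qed auto
  finally show ?thesis by simp
qed

definition gauss_moment :: "'m::finite \<Rightarrow> nat \<Rightarrow> ennreal" where
  "gauss_moment i k = (\<integral>\<^sup>+Z. ennreal ((cmod (Z $ i)) ^ (2 * k)) * ennreal (exp (- (norm Z)\<^sup>2)) \<partial>(lborel :: (complex^'m) measure))"

lemma nn_integral_power_exp: "(\<integral>\<^sup>+t. ennreal (t ^ n * exp (- t)) * indicator {0<..} t \<partial>lborel) = ennreal (fact n)"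
proof -
  have "(\<integral>\<^sup>+t. ennreal (t ^ n * exp (- t)) * indicator {0<..} t \<partial>lborel) = (\<integral>\<^sup>+t. ennreal (t ^ n * exp (- t)) * indicator {0..} t \<partial>lborel)"
    by (rule nn_integral_cong_AE, rule AE_mp[OF AE_lborel_singleton[of 0]]) (auto split: split_indicator)
  then show ?thesis using nn_intergal_power_times_exp_Ici[of n] by simp
qed

text \<open>Layer cake: exp (- |Z|^2) is the integral of exp (- t) over t > |Z|^2.\<close>
lemma gauss_moment_ball_moment:
  fixes i :: "'m::finite"
  shows "gauss_moment i k = ennreal (fact (k + CARD('m))) * ball_moment i k 1"
proof -
  have "gauss_moment i k = (\<integral>\<^sup>+Z. \<integral>\<^sup>+t. ennreal ((cmod (Z $ i)) ^ (2 * k)) * (ennreal (exp (- t)) * indicator {(norm Z)\<^sup>2<..} t) \<partial>lborel \<partial>(lborel :: (complex^'m) measure))"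
    unfolding gauss_moment_def by (intro nn_integral_cong) (simp add: nn_integral_cmult nn_integral_exp_tail)
  also have "\<dots> = (\<integral>\<^sup>+Z. \<integral>\<^sup>+t. ennreal ((cmod (Z $ i)) ^ (2 * k)) * (ennreal (exp (- t)) * (if (norm Z)\<^sup>2 < t then 1 else 0)) \<partial>lborel \<partial>(lborel :: (complex^'m) measure))"
    by (intro nn_integral_cong) (simp add: indicator_def)
  also have "\<dots> = (\<integral>\<^sup>+t. \<integral>\<^sup>+Z. ennreal ((cmod (Z $ i)) ^ (2 * k)) * (ennreal (exp (- t)) * (if (norm Z)\<^sup>2 < t then 1 else 0)) \<partial>(lborel :: (complex^'m) measure) \<partial>lborel)"
    by (rule lborel_pair.Fubini'[symmetric]) measurable
  also have "\<dots> = (\<integral>\<^sup>+t. ennreal (t ^ (k + CARD('m)) * exp (- t)) * indicator {0<..} t * ball_moment i k 1 \<partial>lborel)"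
  proof (intro nn_integral_cong)
    fix t :: real
    have "(\<integral>\<^sup>+Z. ennreal ((cmod (Z $ i)) ^ (2 * k)) * (ennreal (exp (- t)) * (if (norm Z)\<^sup>2 < t then 1 else 0)) \<partial>(lborel :: (complex^'m) measure))
       = (\<integral>\<^sup>+Z. ennreal (exp (- t)) * (ennreal ((cmod (Z $ i)) ^ (2 * k)) * indicator {Z. (norm Z)\<^sup>2 < t} Z) \<partial>(lborel :: (complex^'m) measure))"
      by (intro nn_integral_cong) (simp add: indicator_def mult.commute)
    also have "\<dots> = ennreal (exp (- t)) * ball_moment i k t"
      unfolding ball_moment_def by (rule nn_integral_cmult) measurable
    also have "\<dots> = ennreal (t ^ (k + CARD('m)) * exp (- t)) * indicator {0<..} t * ball_moment i k 1"
    proof (cases "t > 0")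
      case True
      then show ?thesis by (subst ball_moment_scale[OF True]) (simp add: ennreal_mult' mult_ac)
    next
      case False
      then have "{Z :: complex^'m. (norm Z)\<^sup>2 < t} = {}" using zero_le_power2 by (smt (verit) Collect_empty_eq)
      then have "ball_moment i k t = 0" unfolding ball_moment_def by simp
      then show ?thesis using False by simp
    qed
    finally show "(\<integral>\<^sup>+Z. ennreal ((cmod (Z $ i)) ^ (2 * k)) * (ennreal (exp (- t)) * (if (norm Z)\<^sup>2 < t then 1 else 0)) \<partial>(lborel :: (complex^'m) measure))
       = ennreal (t ^ (k + CARD('m)) * exp (- t)) * indicator {0<..} t * ball_moment i k 1" .
  qed
  also have "\<dots> = ennreal (fact (k + CARD('m))) * ball_moment i k 1"
    by (subst nn_integral_multc) (simp_all add: nn_integral_power_exp)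
  finally show ?thesis .
qed

lemma nn_integral_complex_gauss:
  "(\<integral>\<^sup>+z. ennreal ((cmod z) ^ (2 * k)) * ennreal (exp (- (cmod z)\<^sup>2)) \<partial>(lborel :: complex measure)) = ennreal (pi * fact k)"
proof -
  define g where "g = (\<lambda>u::real. ennreal (u ^ k * exp (- u)))"
  have [measurable]: "g \<in> borel_measurable borel" unfolding g_def by measurable
  have "(\<integral>\<^sup>+z. ennreal ((cmod z) ^ (2 * k)) * ennreal (exp (- (cmod z)\<^sup>2)) \<partial>(lborel :: complex measure))
      = (\<integral>\<^sup>+z. g ((cmod z)\<^sup>2) \<partial>lborel)"
    unfolding g_def by (intro nn_integral_cong) (simp add: power_mult ennreal_mult')
  also have "\<dots> = ennreal pi * (\<integral>\<^sup>+u. g u * indicator {0..} u \<partial>lborel)"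
    by (rule nn_integral_radial_complex) measurable
  also have "(\<integral>\<^sup>+u. g u * indicator {0..} u \<partial>lborel) = ennreal (fact k)"
    unfolding g_def using nn_intergal_power_times_exp_Ici[of k] by simp
  finally show ?thesis by (simp flip: ennreal_mult)
qed

text \<open>Exchanges the extra complex variable with the i-th coordinate. It is an isometry, which allows the i-th
coordinate to be integrated out although the index type has no predecessor.\<close>
definition swap_coord :: "'m::finite \<Rightarrow> complex \<times> (complex^'m) \<Rightarrow> complex \<times> (complex^'m)" where
  "swap_coord i x = (snd x $ i, \<chi> j. if j = i then fst x else snd x $ j)"

lemma norm_swap_coord: "norm (swap_coord i x) = norm x"
proof -
  have "(\<Sum>j\<in>UNIV. (cmod (if j = i then fst x else snd x $ j))\<^sup>2) + (cmod (snd x $ i))\<^sup>2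
      = (\<Sum>j\<in>UNIV. (cmod (snd x $ j))\<^sup>2) + (cmod (fst x))\<^sup>2"
    by (simp add: sum.remove[of UNIV i] if_distrib[of cmod] if_distrib[of "\<lambda>x. x\<^sup>2"] cong: if_cong)
  then have "(cmod (fst (swap_coord i x)))\<^sup>2 + (norm (snd (swap_coord i x)))\<^sup>2 = (cmod (fst x))\<^sup>2 + (norm (snd x))\<^sup>2"
    unfolding norm_vec_sq swap_coord_def by simp
  then show ?thesis by (simp add: norm_prod_def)
qed

lemma linear_swap_coord: "linear (swap_coord i)"
  by (rule linearI) (auto simp: swap_coord_def vec_eq_iff)

text \<open>Integrate |\<zeta>|^(2k) exp (- |\<zeta>|^2 - |Z|^2) over (\<zeta>, Z) directly, and after exchanging \<zeta> with the i-th
coordinate of Z.\<close>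
lemma gauss_moment_fact: "gauss_moment i k = ennreal (fact k) * gauss_moment i 0" for i :: "'m::finite"
proof -
  define g where "g = (\<lambda>x :: complex \<times> (complex^'m). ennreal ((cmod (fst x)) ^ (2 * k)) * ennreal (exp (- (norm x)\<^sup>2)))"
  have g: "g \<in> borel_measurable borel"
    unfolding g_def
    by (intro borel_measurable_times_ennreal measurable_compose[OF _ measurable_ennreal] borel_measurable_continuous_onI continuous_intros)
  have n: "(norm (\<zeta>, Z))\<^sup>2 = (cmod \<zeta>)\<^sup>2 + (norm Z)\<^sup>2" for \<zeta> and Z :: "complex^'m"
    by (simp add: norm_Pair)
  have e: "ennreal (exp (- (norm (\<zeta>, Z))\<^sup>2)) = ennreal (exp (- (cmod \<zeta>)\<^sup>2)) * ennreal (exp (- (norm Z)\<^sup>2))" for \<zeta> and Z :: "complex^'m"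
  proof -
    have "exp (- (norm (\<zeta>, Z))\<^sup>2) = exp (- (cmod \<zeta>)\<^sup>2) * exp (- (norm Z)\<^sup>2)"
      unfolding n exp_add[symmetric] by simp
    then show ?thesis by (simp add: ennreal_mult')
  qed
  have "(\<integral>\<^sup>+x. g x \<partial>lborel) = (\<integral>\<^sup>+\<zeta>. \<integral>\<^sup>+Z. (ennreal ((cmod \<zeta>) ^ (2 * k)) * ennreal (exp (- (cmod \<zeta>)\<^sup>2))) * ennreal (exp (- (norm Z)\<^sup>2)) \<partial>(lborel :: (complex^'m) measure) \<partial>lborel)"
    by (subst nn_integral_lborel_Pair[OF g]) (simp add: g_def e mult.assoc)
  also have "\<dots> = (\<integral>\<^sup>+\<zeta>. (ennreal ((cmod \<zeta>) ^ (2 * k)) * ennreal (exp (- (cmod \<zeta>)\<^sup>2))) * gauss_moment i 0 \<partial>lborel)"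
    by (simp add: nn_integral_cmult gauss_moment_def)
  also have "\<dots> = ennreal (pi * fact k) * gauss_moment i 0"
    by (simp add: nn_integral_multc nn_integral_complex_gauss)
  finally have 1: "(\<integral>\<^sup>+x. g x \<partial>lborel) = ennreal (pi * fact k) * gauss_moment i 0" .
  have "(\<integral>\<^sup>+x. g x \<partial>lborel) = (\<integral>\<^sup>+x. g (swap_coord i x) \<partial>lborel)"
    by (rule nn_integral_linear_isometry[OF linear_swap_coord norm_swap_coord g, symmetric])
  also have "\<dots> = (\<integral>\<^sup>+x. ennreal ((cmod (snd x $ i)) ^ (2 * k)) * ennreal (exp (- (norm x)\<^sup>2)) \<partial>(lborel :: (complex \<times> (complex^'m)) measure))"
    unfolding g_def norm_swap_coord by (simp add: swap_coord_def)
  also have "\<dots> = (\<integral>\<^sup>+\<zeta>. \<integral>\<^sup>+Z. ennreal (exp (- (cmod \<zeta>)\<^sup>2)) * (ennreal ((cmod (Z $ i)) ^ (2 * k)) * ennreal (exp (- (norm Z)\<^sup>2))) \<partial>(lborel :: (complex^'m) measure) \<partial>lborel)"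
  proof (subst nn_integral_lborel_Pair)
    show "(\<lambda>x. ennreal ((cmod (snd x $ i)) ^ (2 * k)) * ennreal (exp (- (norm x)\<^sup>2))) \<in> borel_measurable (borel :: (complex \<times> (complex^'m)) measure)"
      by (intro borel_measurable_times_ennreal measurable_compose[OF _ measurable_ennreal] borel_measurable_continuous_onI continuous_intros)
    show "(\<integral>\<^sup>+\<zeta>. \<integral>\<^sup>+Z. ennreal ((cmod (snd (\<zeta>, Z) $ i)) ^ (2 * k)) * ennreal (exp (- (norm (\<zeta>, Z))\<^sup>2)) \<partial>(lborel :: (complex^'m) measure) \<partial>(lborel :: complex measure))
      = (\<integral>\<^sup>+\<zeta>. \<integral>\<^sup>+Z. ennreal (exp (- (cmod \<zeta>)\<^sup>2)) * (ennreal ((cmod (Z $ i)) ^ (2 * k)) * ennreal (exp (- (norm Z)\<^sup>2))) \<partial>(lborel :: (complex^'m) measure) \<partial>lborel)"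
      by (intro nn_integral_cong) (simp add: e mult_ac)
  qed
  also have "\<dots> = (\<integral>\<^sup>+\<zeta>. ennreal (exp (- (cmod \<zeta>)\<^sup>2)) * gauss_moment i k \<partial>lborel)"
    by (simp add: nn_integral_cmult gauss_moment_def)
  also have "\<dots> = ennreal pi * gauss_moment i k"
    using nn_integral_complex_gauss[of 0] by (simp add: nn_integral_multc)
  finally have "ennreal pi * gauss_moment i k = ennreal pi * (ennreal (fact k) * gauss_moment i 0)"
    unfolding 1 by (simp add: ennreal_mult' mult.assoc)
  then have "gauss_moment i k * ennreal pi = (ennreal (fact k) * gauss_moment i 0) * ennreal pi"
    by (simp only: mult.commute)
  then show ?thesis by (rule ennreal_mult_right_cancel) simp_all
qed

text \<open>The moments of the ball are recovered from those of the Gaussian, where they are factorials.\<close>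
lemma ball_moment_formula:
  obtains j :: real where "j > 0"
    "\<And>k. ball_moment (i :: 'm::finite) k 1 = ennreal (j * fact k / fact (k + CARD('m)))"
proof -
  have "ball_moment i 0 1 = emeasure lborel (ball (0::complex^'m) 1)"
  proof -
    have "{Z :: complex^'m. (norm Z)\<^sup>2 < 1} = ball 0 1" by (auto simp: power_less_one_iff)
    then show ?thesis unfolding ball_moment_def by simp
  qed
  then have "ball_moment i 0 1 \<noteq> 0" "ball_moment i 0 1 \<noteq> \<infinity>"
    using emeasure_unit_ball_pos_finite[where 'b = "complex^'m"] by simp_all
  then obtain b where b: "ball_moment i 0 1 = ennreal b" "b > 0"
    by (cases "ball_moment i 0 1") (auto simp: ennreal_eq_0_iff)
  \<comment> \<open>the total mass of the Gaussian\<close>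
  define j where "j = fact CARD('m) * b"
  have j: "gauss_moment i 0 = ennreal j"
    unfolding gauss_moment_ball_moment b j_def by (simp add: ennreal_mult')
  show ?thesis
  proof (rule that[of j])
    show "j > 0" using b by (simp add: j_def)
    fix k
    have "ball_moment i k 1 * ennreal (fact (k + CARD('m))) = ennreal (fact k) * ennreal j"
      using gauss_moment_ball_moment[of i k] gauss_moment_fact[of i k] j by (simp add: mult.commute)
    also have "\<dots> = ennreal (j * fact k / fact (k + CARD('m))) * ennreal (fact (k + CARD('m)))"
      using \<open>j > 0\<close> by (simp add: ennreal_mult'[symmetric] mult.commute)
    finally show "ball_moment i k 1 = ennreal (j * fact k / fact (k + CARD('m)))"
      by (rule ennreal_mult_right_cancel) simp_all
  qed
qed

text \<open>By \<open>lie_norm_fibre_disc\<close> the fibre is a disc |q - q0|^2 < R, on which the norm is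
(1 - |p|^2) (R - |q - q0|^2).\<close>
lemma hua_fibre:
  assumes s: "\<sigma> \<ge> 0" and p: "(cmod p)\<^sup>2 + (cmod s)\<^sup>2 < 1"
  shows "(\<integral>\<^sup>+q. ennreal (lie_norm (lie_pt p s q) powr \<sigma>) * indicator lie_ball (lie_pt p s q) \<partial>lborel)
       = ennreal (pi / (\<sigma> + 1) * (1 - (cmod p)\<^sup>2) powr (- \<sigma> - 2) * (1 - (cmod p)\<^sup>2 - (cmod s)\<^sup>2) powr (2 * \<sigma> + 2))"
proof -
  define P where "P = 1 - (cmod p)\<^sup>2"
  define A where "A = 1 - (cmod p)\<^sup>2 - (cmod s)\<^sup>2"
  have A: "A > 0" "P > 0" using p zero_le_power2[of "cmod s"] unfolding A_def P_def by linarith+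
  define q0 where "q0 = cnj p * s\<^sup>2 / of_real P"
  define R where "R = (A / P)\<^sup>2"
  have R: "R > 0" using A by (simp add: R_def)
  have N: "lie_norm (lie_pt p s q) = P * (R - (cmod (q - q0))\<^sup>2)" for q
  proof -
    have 1: "P * lie_norm (lie_pt p s q) = A\<^sup>2 - (cmod (of_real P * q - cnj p * s\<^sup>2))\<^sup>2"
      using lie_norm_fibre_disc(1)[of "lie_pt p s q"] by (simp add: A_def P_def)
    have "of_real P * q - cnj p * s\<^sup>2 = of_real P * (q - q0)"
      using A by (simp add: q0_def field_simps)
    then have "(cmod (of_real P * q - cnj p * s\<^sup>2))\<^sup>2 = P\<^sup>2 * (cmod (q - q0))\<^sup>2"
      using A by (simp add: norm_mult power_mult_distrib)
    moreover have "A\<^sup>2 = P\<^sup>2 * R" using A by (simp add: R_def power_divide)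
    ultimately have "P * lie_norm (lie_pt p s q) = P * (P * (R - (cmod (q - q0))\<^sup>2))"
      using 1 by (simp add: power2_eq_square algebra_simps)
    then show ?thesis using A by simp
  qed
  have mem: "lie_pt p s q \<in> lie_ball \<longleftrightarrow> (cmod (q - q0))\<^sup>2 < R" for q
    unfolding lie_ball_coords N using p A by (simp add: zero_less_mult_iff)
  define g where "g = (\<lambda>z. ennreal ((R - (cmod z)\<^sup>2) powr \<sigma>) * indicator {z. (cmod z)\<^sup>2 < R} z)"
  have gm: "g \<in> borel_measurable borel" unfolding g_def by measurable
  have "(\<integral>\<^sup>+q. ennreal (lie_norm (lie_pt p s q) powr \<sigma>) * indicator lie_ball (lie_pt p s q) \<partial>lborel)
      = (\<integral>\<^sup>+q. ennreal (P powr \<sigma>) * g (q - q0) \<partial>lborel)"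
    using A by (intro nn_integral_cong) (auto simp: g_def mem N powr_mult ennreal_mult' split: split_indicator)
  also have "\<dots> = ennreal (P powr \<sigma>) * (\<integral>\<^sup>+q. g (q - q0) \<partial>lborel)"
    by (rule nn_integral_cmult) (use gm in measurable)
  also have "(\<integral>\<^sup>+q. g (q - q0) \<partial>lborel) = (\<integral>\<^sup>+q. g q \<partial>lborel)"
    by (rule nn_integral_lborel_diff[OF gm])
  also have "\<dots> = ennreal (pi * R powr (\<sigma> + 1) / (\<sigma> + 1))"
    unfolding g_def using s R by (intro nn_integral_disc_powr) auto
  also have "ennreal (P powr \<sigma>) * \<dots> = ennreal (P powr \<sigma> * (pi * R powr (\<sigma> + 1) / (\<sigma> + 1)))"
    by (rule ennreal_mult'[symmetric]) (use s in simp)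
  also have "R powr (\<sigma> + 1) = A powr (2 * \<sigma> + 2) * P powr (- (2 * \<sigma> + 2))"
  proof -
    have "R powr (\<sigma> + 1) = (A / P) powr (2 * (\<sigma> + 1))"
      unfolding R_def powr_powr[symmetric] using A by simp
    also have "\<dots> = A powr (2 * \<sigma> + 2) / P powr (2 * \<sigma> + 2)"
      using A by (simp add: powr_divide)
    also have "\<dots> = A powr (2 * \<sigma> + 2) * P powr (- (2 * \<sigma> + 2))"
      unfolding powr_minus_divide by simp
    finally show ?thesis .
  qed
  also have "P powr \<sigma> * (pi * (A powr (2 * \<sigma> + 2) * P powr (- (2 * \<sigma> + 2))) / (\<sigma> + 1))
      = pi / (\<sigma> + 1) * (P powr \<sigma> * P powr (- (2 * \<sigma> + 2))) * A powr (2 * \<sigma> + 2)" by simp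
  also have "P powr \<sigma> * P powr (- (2 * \<sigma> + 2)) = P powr (- \<sigma> - 2)"
    unfolding powr_add[symmetric] by simp
  finally show ?thesis unfolding A_def P_def .
qed

text \<open>Integrating successively over q, s and p produces the factors 1 / (\<sigma> + 1), 1 / (2 \<sigma> + 3) and
1 / (\<sigma> + 2).\<close>
lemma hua_integral:
  obtains C :: real where "C > 0"
    "\<And>\<sigma>. \<sigma> \<ge> 0 \<Longrightarrow> (\<integral>\<^sup>+z. ennreal (lie_norm z powr \<sigma>) * indicator lie_ball z \<partial>(lborel :: (complex^3) measure))
        = ennreal (C / ((\<sigma> + 1) * (\<sigma> + 2) * (2 * \<sigma> + 3)))"
proof -
  obtain C where C: "C > 0" "\<And>g. g \<in> borel_measurable borel \<Longrightarrow>
    (\<integral>\<^sup>+z. g z \<partial>(lborel :: (complex^3) measure)) = ennreal C * (\<integral>\<^sup>+p. \<integral>\<^sup>+s. \<integral>\<^sup>+q. g (lie_pt p s q) \<partial>lborel \<partial>lborel \<partial>lborel)"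
    using nn_integral_lie_coords by blast
  show ?thesis
  proof (rule that[of "C * pi ^ 3"])
    show "C * pi ^ 3 > 0" using C by simp
    fix \<sigma> :: real assume s: "\<sigma> \<ge> 0"
    have [measurable]: "(lie_ball :: (complex^3) set) \<in> sets borel" by (rule borel_open[OF open_lie_ball])
    have [measurable]: "(lie_norm :: complex^3 \<Rightarrow> real) \<in> borel_measurable borel"
      by (rule borel_measurable_continuous_onI[OF continuous_lie_norm])
    define D where "D = (\<lambda>p. 1 - (cmod p)\<^sup>2)"
    have [measurable]: "D \<in> borel_measurable borel" unfolding D_def by measurable
    have inner: "(\<integral>\<^sup>+q. ennreal (lie_norm (lie_pt p s q) powr \<sigma>) * indicator lie_ball (lie_pt p s q) \<partial>lborel)
       = ennreal (pi / (\<sigma> + 1) * D p powr (- \<sigma> - 2)) * (ennreal ((D p - (cmod s)\<^sup>2) powr (2 * \<sigma> + 2)) * indicator {s. (cmod s)\<^sup>2 < D p} s)" for p s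
    proof (cases "(cmod p)\<^sup>2 + (cmod s)\<^sup>2 < 1")
      case True
      then show ?thesis unfolding hua_fibre[OF s True] using s by (simp add: D_def ennreal_mult'[symmetric])
    next
      case False
      then have "lie_pt p s q \<notin> lie_ball" for q by (simp add: lie_ball_coords)
      then show ?thesis using False by (simp add: D_def)
    qed
    have mid: "(\<integral>\<^sup>+s. ennreal (pi / (\<sigma> + 1) * D p powr (- \<sigma> - 2)) * (ennreal ((D p - (cmod s)\<^sup>2) powr (2 * \<sigma> + 2)) * indicator {s. (cmod s)\<^sup>2 < D p} s) \<partial>lborel)
        = ennreal (pi\<^sup>2 / ((\<sigma> + 1) * (2 * \<sigma> + 3))) * (ennreal ((1 - (cmod p)\<^sup>2) powr (\<sigma> + 1)) * indicator {p. (cmod p)\<^sup>2 < 1} p)" for p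
    proof (cases "(cmod p)\<^sup>2 < 1")
      case True
      then have D: "D p > 0" by (simp add: D_def)
      have "(\<integral>\<^sup>+s. ennreal (pi / (\<sigma> + 1) * D p powr (- \<sigma> - 2)) * (ennreal ((D p - (cmod s)\<^sup>2) powr (2 * \<sigma> + 2)) * indicator {s. (cmod s)\<^sup>2 < D p} s) \<partial>lborel)
        = ennreal (pi / (\<sigma> + 1) * D p powr (- \<sigma> - 2)) * (\<integral>\<^sup>+s. ennreal ((D p - (cmod s)\<^sup>2) powr (2 * \<sigma> + 2)) * indicator {s. (cmod s)\<^sup>2 < D p} s \<partial>lborel)"
        by (rule nn_integral_cmult) measurable
      also have "(\<integral>\<^sup>+s. ennreal ((D p - (cmod s)\<^sup>2) powr (2 * \<sigma> + 2)) * indicator {s. (cmod s)\<^sup>2 < D p} s \<partial>lborel)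
          = ennreal (pi * D p powr (2 * \<sigma> + 2 + 1) / (2 * \<sigma> + 2 + 1))"
        using s D by (intro nn_integral_disc_powr) auto
      also have "ennreal (pi / (\<sigma> + 1) * D p powr (- \<sigma> - 2)) * \<dots>
          = ennreal ((pi / (\<sigma> + 1) * D p powr (- \<sigma> - 2)) * (pi * D p powr (2 * \<sigma> + 2 + 1) / (2 * \<sigma> + 2 + 1)))"
        by (rule ennreal_mult'[symmetric]) (use s in simp)
      also have "(pi / (\<sigma> + 1) * D p powr (- \<sigma> - 2)) * (pi * D p powr (2 * \<sigma> + 2 + 1) / (2 * \<sigma> + 2 + 1))
          = pi\<^sup>2 / ((\<sigma> + 1) * (2 * \<sigma> + 3)) * (D p powr (- \<sigma> - 2) * D p powr (2 * \<sigma> + 2 + 1))"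
      proof -
        have e: "2 * \<sigma> + 2 + 1 = 2 * \<sigma> + 3" by simp
        show ?thesis unfolding e by (simp add: power2_eq_square)
      qed
      also have "D p powr (- \<sigma> - 2) * D p powr (2 * \<sigma> + 2 + 1) = D p powr (\<sigma> + 1)"
        unfolding powr_add[symmetric] by (simp add: add.commute)
      also have "ennreal (pi\<^sup>2 / ((\<sigma> + 1) * (2 * \<sigma> + 3)) * D p powr (\<sigma> + 1))
          = ennreal (pi\<^sup>2 / ((\<sigma> + 1) * (2 * \<sigma> + 3))) * ennreal (D p powr (\<sigma> + 1))"
        by (rule ennreal_mult) (use s in simp_all)
      finally show ?thesis using True by (simp add: D_def)
    next
      case False
      then have "\<not> (cmod s)\<^sup>2 < D p" for s using zero_le_power2[of "cmod s"] unfolding D_def by linarith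
      then show ?thesis using False by simp
    qed
    have "(\<integral>\<^sup>+z. ennreal (lie_norm z powr \<sigma>) * indicator lie_ball z \<partial>(lborel :: (complex^3) measure))
        = ennreal C * (\<integral>\<^sup>+p. ennreal (pi\<^sup>2 / ((\<sigma> + 1) * (2 * \<sigma> + 3))) * (ennreal ((1 - (cmod p)\<^sup>2) powr (\<sigma> + 1)) * indicator {p. (cmod p)\<^sup>2 < 1} p) \<partial>lborel)"
      by (subst C(2)) (simp_all only: inner mid, measurable)
    also have "(\<integral>\<^sup>+p. ennreal (pi\<^sup>2 / ((\<sigma> + 1) * (2 * \<sigma> + 3))) * (ennreal ((1 - (cmod p)\<^sup>2) powr (\<sigma> + 1)) * indicator {p. (cmod p)\<^sup>2 < 1} p) \<partial>(lborel :: complex measure))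
        = ennreal (pi\<^sup>2 / ((\<sigma> + 1) * (2 * \<sigma> + 3))) * (\<integral>\<^sup>+p. ennreal ((1 - (cmod p)\<^sup>2) powr (\<sigma> + 1)) * indicator {p. (cmod p)\<^sup>2 < 1} p \<partial>(lborel :: complex measure))"
      by (rule nn_integral_cmult) measurable
    also have "(\<integral>\<^sup>+p. ennreal ((1 - (cmod p)\<^sup>2) powr (\<sigma> + 1)) * indicator {p. (cmod p)\<^sup>2 < 1} p \<partial>(lborel :: complex measure))
        = ennreal (pi * 1 powr (\<sigma> + 1 + 1) / (\<sigma> + 1 + 1))"
      using s by (intro nn_integral_disc_powr) auto
    also have "ennreal C * (ennreal (pi\<^sup>2 / ((\<sigma> + 1) * (2 * \<sigma> + 3))) * \<dots>)
        = ennreal (C * (pi\<^sup>2 / ((\<sigma> + 1) * (2 * \<sigma> + 3)) * (pi * 1 powr (\<sigma> + 1 + 1) / (\<sigma> + 1 + 1))))"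
      using s C by (simp add: ennreal_mult'[symmetric])
    also have "C * (pi\<^sup>2 / ((\<sigma> + 1) * (2 * \<sigma> + 3)) * (pi * 1 powr (\<sigma> + 1 + 1) / (\<sigma> + 1 + 1))) = C * pi ^ 3 / ((\<sigma> + 1) * (\<sigma> + 2) * (2 * \<sigma> + 3))"
      by (simp add: power2_eq_square power3_eq_cube mult_ac add.commute)
    finally show "(\<integral>\<^sup>+z. ennreal (lie_norm z powr \<sigma>) * indicator lie_ball z \<partial>(lborel :: (complex^3) measure))
        = ennreal (C * pi ^ 3 / ((\<sigma> + 1) * (\<sigma> + 2) * (2 * \<sigma> + 3)))" .
  qed
qed

text \<open>Over z the fibre is the ball of squared radius N(z,z)^\<mu>, so homogeneity turns the fibre integral
into the (\<mu> (k + m))-th power of the generic norm.\<close>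
lemma hartogs_moment:
  fixes i :: "'m::finite"
  obtains C :: real where "C > 0"
    "\<And>\<mu> k. \<mu> > 0 \<Longrightarrow> (\<integral>\<^sup>+x. ennreal ((cmod (snd x $ i)) ^ (2 * k)) * indicator (hartogs_lie \<mu>) x \<partial>(lborel :: ((complex^3) \<times> (complex^'m)) measure))
        = ennreal (C * fact k / (fact (k + CARD('m)) * hua_poly (\<mu> * real (k + CARD('m)))))"
proof -
  obtain j where j: "j > 0" "\<And>k. ball_moment i k 1 = ennreal (j * fact k / fact (k + CARD('m)))"
    using ball_moment_formula by blast
  obtain C where C: "C > 0"
    "\<And>\<sigma>. \<sigma> \<ge> 0 \<Longrightarrow> (\<integral>\<^sup>+z. ennreal (lie_norm z powr \<sigma>) * indicator lie_ball z \<partial>(lborel :: (complex^3) measure))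
        = ennreal (C / ((\<sigma> + 1) * (\<sigma> + 2) * (2 * \<sigma> + 3)))"
    using hua_integral by blast
  show ?thesis
  proof (rule that[of "C * j"])
    show "C * j > 0" using C j by simp
    fix \<mu> :: real and k :: nat assume mu: "\<mu> > 0"
    let ?U = "hartogs_lie \<mu> :: ((complex^3) \<times> (complex^'m)) set"
    define \<sigma> where "\<sigma> = \<mu> * real (k + CARD('m))"
    have s: "\<sigma> \<ge> 0" using mu by (simp add: \<sigma>_def)
    have [measurable]: "?U \<in> sets borel" by (rule borel_open[OF open_hartogs_lie])
    have [measurable]: "(lie_ball :: (complex^3) set) \<in> sets borel" by (rule borel_open[OF open_lie_ball])
    have [measurable]: "(lie_norm :: complex^3 \<Rightarrow> real) \<in> borel_measurable borel"
      by (rule borel_measurable_continuous_onI[OF continuous_lie_norm])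
    have m: "(\<lambda>x. ennreal ((cmod (snd x $ i)) ^ (2 * k)) * indicator ?U x) \<in> borel_measurable (borel :: ((complex^3) \<times> (complex^'m)) measure)"
      by (intro borel_measurable_times_ennreal measurable_compose[OF _ measurable_ennreal] borel_measurable_continuous_onI continuous_intros borel_measurable_indicator)
         measurable
    have inner: "(\<integral>\<^sup>+Z. ennreal ((cmod (Z $ i)) ^ (2 * k)) * indicator ?U (z, Z) \<partial>lborel)
        = ball_moment i k 1 * (ennreal (lie_norm z powr \<sigma>) * indicator lie_ball z)" for z
    proof (cases "z \<in> lie_ball")
      case True
      then have N: "lie_norm z > 0" by (simp add: lie_ball_def)
      have "(\<integral>\<^sup>+Z. ennreal ((cmod (Z $ i)) ^ (2 * k)) * indicator ?U (z, Z) \<partial>lborel) = ball_moment i k (lie_norm z powr \<mu>)"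
        unfolding ball_moment_def using True by (intro nn_integral_cong) (simp add: indicator_def hartogs_lie_iff)
      also have "\<dots> = ennreal ((lie_norm z powr \<mu>) ^ (k + CARD('m))) * ball_moment i k 1"
        using N by (intro ball_moment_scale) simp
      also have "(lie_norm z powr \<mu>) ^ (k + CARD('m)) = lie_norm z powr \<sigma>"
        using N unfolding \<sigma>_def by (simp only: powr_powr[symmetric] powr_realpow[symmetric] powr_gt_zero)
      finally show ?thesis using True by (simp add: mult.commute)
    next
      case False
      then show ?thesis by (simp add: hartogs_lie_iff indicator_def)
    qed
    have "(\<integral>\<^sup>+x. ennreal ((cmod (snd x $ i)) ^ (2 * k)) * indicator ?U x \<partial>lborel)
        = (\<integral>\<^sup>+z. ball_moment i k 1 * (ennreal (lie_norm z powr \<sigma>) * indicator lie_ball z) \<partial>(lborel :: (complex^3) measure))"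
      by (subst nn_integral_lborel_Pair[OF m]) (simp add: inner)
    also have "\<dots> = ball_moment i k 1 * (\<integral>\<^sup>+z. ennreal (lie_norm z powr \<sigma>) * indicator lie_ball z \<partial>(lborel :: (complex^3) measure))"
      by (rule nn_integral_cmult) measurable
    also have "\<dots> = ennreal (j * fact k / fact (k + CARD('m)) * (C / hua_poly \<sigma>))"
      unfolding C(2)[OF s] j(2) hua_poly_def[symmetric] by (rule ennreal_mult'[symmetric]) (use j in simp)
    finally show "(\<integral>\<^sup>+x. ennreal ((cmod (snd x $ i)) ^ (2 * k)) * indicator ?U x \<partial>lborel)
        = ennreal (C * j * fact k / (fact (k + CARD('m)) * hua_poly (\<mu> * real (k + CARD('m)))))"
      unfolding \<sigma>_def by (simp add: mult_ac)
  qed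
qed

section \<open>The kernel at a base point\<close>

lemma lborel_distr_isometry:
  fixes L :: "'a::euclidean_space \<Rightarrow> 'a"
  assumes L: "linear L" "\<And>x. norm (L x) = norm x"
  shows "distr lborel borel L = lborel"
proof (rule measure_eqI)
  have m: "L \<in> borel_measurable borel" by (rule borel_measurable_linear[OF L(1)])
  fix A assume "A \<in> sets (distr lborel borel L)"
  then have A: "A \<in> sets borel" by simp
  then have LA: "L -` A \<in> sets borel" using measurable_sets[OF m, of A] by simp
  have "emeasure (distr lborel borel L) A = emeasure lborel (L -` A)"
    using m A by (subst emeasure_distr) auto
  also have "\<dots> = (\<integral>\<^sup>+x. indicator (L -` A) x \<partial>lborel)" using LA by (intro nn_integral_indicator[symmetric]) simp
  also have "\<dots> = (\<integral>\<^sup>+x. indicator A (L x) \<partial>lborel)" by (intro nn_integral_cong) (simp add: indicator_def)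
  also have "\<dots> = (\<integral>\<^sup>+x. indicator A x \<partial>lborel)"
    by (rule nn_integral_linear_isometry[OF L]) (use A in simp)
  also have "\<dots> = emeasure lborel A" by (rule nn_integral_indicator) (use A in simp)
  finally show "emeasure (distr lborel borel L) A = emeasure lborel A" .
qed simp

text \<open>Fubini for the product with the circle, together with the invariance of Lebesgue measure under
isometries.\<close>
lemma integral_rotation_average:
  fixes R :: "real \<Rightarrow> 'a::euclidean_space \<Rightarrow> 'a" and g :: "'a \<Rightarrow> complex"
  assumes g: "integrable lborel g"
    and R: "\<And>t. linear (R t)" "\<And>t x. norm (R t x) = norm x"
    and cont: "continuous_on UNIV (\<lambda>y. R (fst y) (snd y))"
  shows "integrable lborel (\<lambda>x. LINT t:{0..1}|lborel. g (R t x))" (is ?A)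
    and "(\<integral>x. (LINT t:{0..1}|lborel. g (R t x)) \<partial>lborel) = (\<integral>x. g x \<partial>lborel)" (is ?B)
proof -
  have gm [measurable]: "g \<in> borel_measurable borel" using borel_measurable_integrable[OF g] by simp
  have "(\<lambda>y. R (fst y) (snd y)) \<in> borel_measurable borel" by (rule borel_measurable_continuous_onI[OF cont])
  then have Rm [measurable]: "(\<lambda>y. R (fst y) (snd y)) \<in> borel_measurable (borel \<Otimes>\<^sub>M borel)" by (simp add: borel_prod)
  define f where "f = (\<lambda>t x. indicator {0..1::real} t *\<^sub>R g (R t x))"
  have d: "distr lborel borel (R t) = lborel" for t by (rule lborel_distr_isometry[OF R])
  have Rt [measurable]: "R t \<in> borel_measurable borel" for t by (rule borel_measurable_linear[OF R(1)])
  have int: "integrable lborel (\<lambda>x. h (R t x)) \<longleftrightarrow> integrable lborel h" "(\<integral>x. h (R t x) \<partial>lborel) = (\<integral>x. h x \<partial>lborel)"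
    if "h \<in> borel_measurable borel" for t and h :: "'a \<Rightarrow> 'c::{banach,second_countable_topology}"
    using integrable_distr_eq[of "R t" lborel borel h] integral_distr[of "R t" lborel borel h] that Rt[of t] unfolding d by simp_all
  have pair: "integrable (lborel \<Otimes>\<^sub>M lborel) (case_prod f)"
  proof (rule lborel_pair.Fubini_integrable)
    show "case_prod f \<in> borel_measurable (lborel \<Otimes>\<^sub>M lborel)" unfolding f_def split_beta by measurable
    have "(\<integral>x. norm (case_prod f (t, x)) \<partial>lborel) = indicator {0..1} t *\<^sub>R (\<integral>x. norm (g x) \<partial>lborel)" for t
      using int(2)[of "\<lambda>x. norm (g x)" t] by (simp add: f_def)
    then show "integrable lborel (\<lambda>t. \<integral>x. norm (case_prod f (t, x)) \<partial>lborel)" by simp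
    show "AE t in lborel. integrable lborel (\<lambda>x. case_prod f (t, x))"
      using int(1)[OF gm] g by (simp add: f_def)
  qed
  have A: "(LINT t:{0..1}|lborel. g (R t x)) = (\<integral>t. f t x \<partial>lborel)" for x
    unfolding f_def set_lebesgue_integral_def ..
  show ?A unfolding A by (rule lborel_pair.integrable_snd[OF pair])
  have "(\<integral>x. (\<integral>t. f t x \<partial>lborel) \<partial>lborel) = (\<integral>t. (\<integral>x. f t x \<partial>lborel) \<partial>lborel)"
    by (rule lborel_pair.Fubini_integral[OF pair])
  also have "\<dots> = (\<integral>t. indicator {0..1::real} t *\<^sub>R (\<integral>x. g x \<partial>lborel) \<partial>lborel)"
    unfolding f_def using int(2)[OF gm] by simp
  also have "\<dots> = (\<integral>x. g x \<partial>lborel)" by simp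
  finally show ?B unfolding A .
qed

definition unit_circle :: "real \<Rightarrow> complex" where
  "unit_circle t = exp (2 * of_real pi * \<i> * of_real t)"

lemma norm_unit_circle [simp]: "cmod (unit_circle t) = 1"
  by (simp add: unit_circle_def)

lemma continuous_unit_circle: "continuous_on S unit_circle"
  unfolding unit_circle_def by (intro continuous_intros)

lemma circle_mean_coeff:
  assumes h: "h holomorphic_on T" "cball 0 1 \<subseteq> T"
  shows "(LINT t:{0..1}|lborel. h (unit_circle t) * cnj (unit_circle t) ^ k) = (deriv ^^ k) h 0 / fact k"
proof -
  have c: "continuous_on (cball 0 1) h" using h by (meson continuous_on_subset holomorphic_on_imp_continuous_on)
  have hb: "h holomorphic_on ball 0 1" using h by (meson ball_subset_cball holomorphic_on_subset)
  have inv: "cnj (unit_circle t) = inverse (unit_circle t)" for t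
    using complex_norm_square[of "unit_circle t"] by (simp add: inverse_unique)
  have D: "(deriv ^^ k) h 0 = fact k / (2 * of_real pi * \<i>) * contour_integral (circlepath 0 1) (\<lambda>u. h u / (u - 0) ^ Suc k)"
    using Cauchy_higher_derivative_integral_circlepath[OF c hb, of 0 k] by simp
  have "contour_integral (circlepath 0 1) (\<lambda>u. h u / (u - 0) ^ Suc k)
      = integral {0..1} (\<lambda>t. h (circlepath 0 1 t) / (circlepath 0 1 t - 0) ^ Suc k * vector_derivative (circlepath 0 1) (at t))"
    by (rule contour_integral_integral)
  also have "\<dots> = integral {0..1} (\<lambda>t. (2 * of_real pi * \<i>) * (h (unit_circle t) * cnj (unit_circle t) ^ k))"
  proof (rule integral_cong)
    fix t :: real
    have circ: "circlepath 0 1 t = unit_circle t" by (simp add: circlepath unit_circle_def)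
    have vd: "vector_derivative (circlepath 0 1) (at t) = 2 * of_real pi * \<i> * unit_circle t"
      by (simp add: vector_derivative_circlepath unit_circle_def)
    have "unit_circle t \<noteq> 0" by (simp add: unit_circle_def)
    then show "h (circlepath 0 1 t) / (circlepath 0 1 t - 0) ^ Suc k * vector_derivative (circlepath 0 1) (at t)
        = (2 * of_real pi * \<i>) * (h (unit_circle t) * cnj (unit_circle t) ^ k)"
      unfolding circ vd inv by (simp add: field_simps)
  qed
  also have "\<dots> = (2 * of_real pi * \<i>) * integral {0..1} (\<lambda>t. h (unit_circle t) * cnj (unit_circle t) ^ k)"
    by (rule integral_mult_right)
  finally have "(deriv ^^ k) h 0 / fact k = integral {0..1} (\<lambda>t. h (unit_circle t) * cnj (unit_circle t) ^ k)"
    unfolding D by simp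
  moreover have "continuous_on {0..1} (\<lambda>t. h (unit_circle t) * cnj (unit_circle t) ^ k)"
    by (intro continuous_intros continuous_on_compose2[OF c continuous_unit_circle] continuous_unit_circle) auto
  then have "set_integrable lborel {0..1} (\<lambda>t. h (unit_circle t) * cnj (unit_circle t) ^ k)"
    by (rule borel_integrable_atLeastAtMost')
  ultimately show ?thesis using set_borel_integral_eq_integral(2) by fastforce
qed

definition twist :: "'m::finite \<Rightarrow> complex \<Rightarrow> complex \<Rightarrow> (complex^'n) \<times> (complex^'m) \<Rightarrow> (complex^'n) \<times> (complex^'m)" where
  "twist i a b x = (b *s fst x, \<chi> j. (if j = i then a else b) * snd x $ j)"

lemma linear_twist: "linear (twist i a b)"
  by (rule linearI) (auto simp: twist_def vec_eq_iff algebra_simps)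

lemma norm_snd_twist:
  assumes "cmod a = 1" "cmod b = 1"
  shows "norm (snd (twist i a b x)) = norm (snd x)"
proof -
  have "(norm (snd (twist i a b x)))\<^sup>2 = (norm (snd x))\<^sup>2"
    unfolding norm_vec_sq by (intro sum.cong) (auto simp: twist_def norm_mult assms)
  then show ?thesis by (simp add: power2_eq_iff_nonneg)
qed

lemma norm_twist:
  assumes "cmod a = 1" "cmod b = 1"
  shows "norm (twist i a b x) = norm x"
proof -
  have "norm (fst (twist i a b x)) = norm (fst x)" by (simp add: twist_def norm_vec_smult assms)
  then show ?thesis using norm_snd_twist[OF assms, of i x] by (simp add: norm_prod_def)
qed

lemma continuous_twist:
  assumes "continuous_on UNIV a" "continuous_on UNIV b"
  shows "continuous_on UNIV (\<lambda>y :: real \<times> (complex^'n) \<times> (complex^'m). twist i (a (fst y)) (b (fst y)) (snd y))"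
proof -
  have a: "continuous_on UNIV (\<lambda>y :: real \<times> (complex^'n) \<times> (complex^'m). a (fst y))"
    and b: "continuous_on UNIV (\<lambda>y :: real \<times> (complex^'n) \<times> (complex^'m). b (fst y))"
    by (intro continuous_on_compose2[OF assms(1)] continuous_on_compose2[OF assms(2)] continuous_intros; simp)+
  have e: "(\<lambda>y :: real \<times> (complex^'n) \<times> (complex^'m). twist i (a (fst y)) (b (fst y)) (snd y))
      = (\<lambda>y. (\<chi> j. b (fst y) * fst (snd y) $ j, \<chi> j. (if j = i then a (fst y) else b (fst y)) * snd (snd y) $ j))"
    by (auto simp: twist_def vec_eq_iff)
  have c: "continuous_on UNIV (\<lambda>y :: real \<times> (complex^'n) \<times> (complex^'m). (if j = i then a (fst y) else b (fst y)))" for j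
    using a b by (cases "j = i") auto
  show ?thesis unfolding e by (intro continuous_intros a b c)
qed

lemma lie_norm_smult: "lie_norm (c *s z) = lie_norm (cmod c *\<^sub>R z)"
  unfolding scaleR_eq_smult lie_norm_cdot cdot_smult norm_vec_smult by (simp add: norm_mult norm_power)

lemma lie_ball_smult_iff: "c *s z \<in> lie_ball \<longleftrightarrow> cmod c *\<^sub>R z \<in> lie_ball"
  unfolding lie_ball_def lie_norm_smult mem_Collect_eq norm_vec_smult by simp

lemma hartogs_lie_smult:
  assumes "(z, Z) \<in> hartogs_lie \<mu>" "\<mu> > 0" "cmod c \<le> 1" "norm Z' \<le> norm Z"
  shows "(c *s z, Z') \<in> hartogs_lie \<mu>"
  using hartogs_lie_scale[OF assms(1,2) norm_ge_zero assms(3,4)]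
  unfolding hartogs_lie_iff lie_ball_smult_iff lie_norm_smult .

lemma hartogs_lie_smult_iff:
  assumes "cmod c = 1" "norm Z' = norm Z"
  shows "(c *s z, Z') \<in> hartogs_lie \<mu> \<longleftrightarrow> (z, Z) \<in> hartogs_lie \<mu>"
  using assms unfolding hartogs_lie_iff lie_ball_smult_iff lie_norm_smult by simp

lemma twist_mem_iff:
  assumes "cmod a = 1" "cmod b = 1"
  shows "twist i a b x \<in> hartogs_lie \<mu> \<longleftrightarrow> x \<in> hartogs_lie \<mu>"
  using hartogs_lie_smult_iff[OF assms(2) norm_snd_twist[OF assms, of i x], of "fst x" \<mu>]
  by (simp add: twist_def)

lemma norm_vec_nth_le: "cmod (Z $ i) \<le> norm (Z :: complex^'m)"
  by (rule Finite_Cartesian_Product.norm_nth_le)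

lemma bergman_space_integrable:
  fixes U :: "((complex^'n) \<times> (complex^'m)) set"
  assumes U: "open U" "emeasure lborel U < \<infinity>" and f: "f \<in> bergman_space U"
  shows "integrable (restrict_space lborel U) f"
proof -
  let ?M = "restrict_space lborel U"
  have fm: "finite_measure ?M"
  proof
    show "emeasure ?M (space ?M) \<noteq> \<infinity>"
      using U by (simp add: emeasure_restrict_space space_restrict_space borel_open)
  qed
  have sq: "integrable ?M (\<lambda>x. (cmod (f x))\<^sup>2)" and hol: "holomorphic_sev f U"
    using f bergman_space_iff[OF U(1)] by blast+
  have one: "integrable ?M (\<lambda>x. 1 :: real)" using fm by (intro finite_measure.integrable_const)
  show ?thesis
  proof (rule Bochner_Integration.integrable_bound[OF Bochner_Integration.integrable_add[OF sq one]])
    show "f \<in> borel_measurable ?M" by (intro continuous_on_imp_measurable_restrict holomorphic_sev_imp_continuous_on hol)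
    \<comment> \<open>on a domain of finite volume, square integrable functions are integrable\<close>
    have "t \<le> t\<^sup>2 + 1" for t :: real
      using zero_le_power2[of "t - 1 / 2"] by (simp add: power2_eq_square algebra_simps)
    then show "AE x in ?M. norm (f x) \<le> norm ((cmod (f x))\<^sup>2 + 1)" by simp
  qed
qed

context
  fixes i :: "'m::finite" and \<mu> :: real
  assumes mu: "\<mu> > 0"
begin

abbreviation (input) "hdom \<equiv> hartogs_lie \<mu> :: ((complex^3) \<times> (complex^'m)) set"

text \<open>Averaging over rotations of all variables but the i-th coordinate of Z replaces f by its restriction
to the disc {(0, \<zeta> e_i)}, by the mean value property; rotating that coordinate as well then selects
the k-th Taylor coefficient.\<close>
lemma slice_coefficient:
  assumes f: "f \<in> bergman_space hdom"
    and fin: "emeasure lborel hdom < \<infinity>"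
    and M: "M \<ge> 0" "(\<integral>\<^sup>+x. ennreal ((cmod (snd x $ i)) ^ (2 * k)) * indicator hdom x \<partial>lborel) = ennreal M"
  shows "(\<integral>x. f x * cnj (snd x $ i) ^ k \<partial>restrict_space lborel hdom)
     = (deriv ^^ k) (\<lambda>\<zeta>. f (0, axis i \<zeta>)) 0 / fact k * of_real M"
proof -
  have U: "open hdom" by (rule open_hartogs_lie)
  have Um [measurable]: "hdom \<in> sets borel" using U by (rule borel_open)
  have Ui: "hdom \<inter> space lborel \<in> sets lborel" by simp
  have hol: "holomorphic_sev f hdom" using f bergman_space_iff[OF U] by blast
  have Z1: "cmod (snd x $ i) < 1" if "x \<in> hdom" for x
    using hartogs_lie_snd_norm[OF that mu] norm_vec_nth_le[of "snd x" i] by simp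
  define \<phi> where "\<phi> = (\<lambda>\<zeta>. f (0, axis i \<zeta>))"
  have phi: "\<phi> holomorphic_on ball 0 1"
  proof -
    have "(\<lambda>l. f ((0, 0) + cscale l (0, axis i 1))) holomorphic_on ball 0 1"
    proof (rule holomorphic_sev_line[OF hol])
      fix l :: complex assume "l \<in> ball 0 1"
      then have "norm (l *s axis i 1 :: complex^'m) < 1" by (simp add: norm_vec_smult norm_axis_complex)
      then show "(0, 0) + cscale l (0, axis i 1) \<in> hdom" by (simp add: hartogs_lie_base_iff)
    qed simp
    moreover have "l *s axis i 1 = (axis i l :: complex^'m)" for l by (simp add: vec_eq_iff axis_def)
    ultimately show ?thesis unfolding \<phi>_def by simp
  qed
  define g where "g = (\<lambda>x. indicator hdom x *\<^sub>R (f x * cnj (snd x $ i) ^ k))"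
  have mZ: "(\<lambda>x. cnj (snd x $ i) ^ k) \<in> borel_measurable (restrict_space lborel hdom)"
    by (intro continuous_on_imp_measurable_restrict continuous_intros)
  have intf: "integrable (restrict_space lborel hdom) f"
    by (rule bergman_space_integrable[OF U fin f])
  have "integrable (restrict_space lborel hdom) (\<lambda>x. f x * cnj (snd x $ i) ^ k)"
  proof (rule Bochner_Integration.integrable_bound[OF intf])
    show "(\<lambda>x. f x * cnj (snd x $ i) ^ k) \<in> borel_measurable (restrict_space lborel hdom)"
      using borel_measurable_integrable[OF intf] mZ by measurable
    show "AE x in restrict_space lborel hdom. norm (f x * cnj (snd x $ i) ^ k) \<le> norm (f x)"
    proof (rule AE_I2)
      fix x assume "x \<in> space (restrict_space lborel hdom)"
      then have "cmod (snd x $ i) \<le> 1" using Z1[of x] by (simp add: space_restrict_space)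
      then show "norm (f x * cnj (snd x $ i) ^ k) \<le> norm (f x)"
        by (simp add: norm_mult norm_power mult_left_le power_le_one)
    qed
  qed
  then have g: "integrable lborel g"
    unfolding g_def using integrable_restrict_space[OF Ui, of "\<lambda>x. f x * cnj (snd x $ i) ^ k"] by simp
  have "(\<integral>x. f x * cnj (snd x $ i) ^ k \<partial>restrict_space lborel hdom) = (\<integral>x. g x \<partial>lborel)"
    unfolding g_def by (rule integral_restrict_space[OF Ui])
  also have "(\<integral>x. g x \<partial>lborel) = (\<integral>x. (LINT t:{0..1}|lborel. g (twist i 1 (unit_circle t) x)) \<partial>lborel)"
    by (rule integral_rotation_average(2)[OF g, symmetric])
       (auto intro!: linear_twist norm_twist continuous_twist[of "\<lambda>t. 1" unit_circle] continuous_unit_circle)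
  also have avg1: "(\<lambda>x. LINT t:{0..1}|lborel. g (twist i 1 (unit_circle t) x))
      = (\<lambda>x. indicator hdom x *\<^sub>R (\<phi> (snd x $ i) * cnj (snd x $ i) ^ k))" (is "_ = ?g2")
  proof
    fix x :: "(complex^3) \<times> (complex^'m)"
    obtain z Z where x: "x = (z, Z)" by (cases x)
    show "(LINT t:{0..1}|lborel. g (twist i 1 (unit_circle t) x)) = ?g2 x"
    proof (cases "x \<in> hdom")
      case False
      then show ?thesis by (simp add: g_def twist_mem_iff)
    next
      case True
      \<comment> \<open>the orbit of x is the unit circle of the complex line a + c b, whose centre a lies on the slice\<close>
      define a b where "a = (0 :: complex^3, axis i (Z $ i))" "b = (z, \<chi> j. if j = i then 0 else Z $ j)"
      define T where "T = (\<lambda>c. a + cscale c b) -` hdom"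
      have line: "a + cscale c b = (c *s z, \<chi> j. (if j = i then 1 else c) * Z $ j)" for c
        by (simp add: a_b_def vec_eq_iff axis_def)
      have lin: "bounded_linear (\<lambda>c. cscale c b)"
        unfolding linear_conv_bounded_linear[symmetric]
        by (rule linearI) (auto simp: cscale_def vec_eq_iff algebra_simps)
      have "continuous_on UNIV (\<lambda>c. a + cscale c b)"
        using lin by (intro continuous_intros) (auto intro: linear_continuous_on)
      then have T: "open T" unfolding T_def by (intro open_vimage U)
      have h: "(\<lambda>c. f (a + cscale c b)) holomorphic_on T"
        by (rule holomorphic_sev_line[OF hol T]) (simp add: T_def)
      have sub: "cball 0 1 \<subseteq> T"
      proof
        fix c :: complex assume "c \<in> cball 0 1"
        then have c: "cmod c \<le> 1" by simp
        have "(norm (\<chi> j. (if j = i then 1 else c) * Z $ j))\<^sup>2 \<le> (norm Z)\<^sup>2"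
          unfolding norm_vec_sq using c by (intro sum_mono power_mono) (auto simp: norm_mult mult_left_le_one_le)
        then have "norm (\<chi> j. (if j = i then 1 else c) * Z $ j) \<le> norm Z" by (rule power2_le_imp_le) simp
        then show "c \<in> T" unfolding T_def vimage_eq line
          using True mu c unfolding x by (intro hartogs_lie_smult[of z Z])
      qed
      have "g (twist i 1 (unit_circle t) x) = f (a + cscale (unit_circle t) b) * cnj (unit_circle t) ^ 0 * cnj (Z $ i) ^ k" for t
        using True unfolding g_def line by (simp add: twist_mem_iff) (simp add: twist_def x)
      then have "(LINT t:{0..1}|lborel. g (twist i 1 (unit_circle t) x))
          = (LINT t:{0..1}|lborel. f (a + cscale (unit_circle t) b) * cnj (unit_circle t) ^ 0) * cnj (Z $ i) ^ k"
        by (simp only: set_integral_mult_left)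
      also have "(LINT t:{0..1}|lborel. f (a + cscale (unit_circle t) b) * cnj (unit_circle t) ^ 0) = f (a + cscale 0 b)"
        unfolding circle_mean_coeff[OF h sub] by simp
      also have "f (a + cscale 0 b) = \<phi> (Z $ i)"
        by (simp add: a_b_def \<phi>_def zero_prod_def[symmetric])
      finally show ?thesis using True by (simp add: x)
    qed
  qed
  also have "(\<integral>x. ?g2 x \<partial>lborel) = (\<integral>x. (LINT t:{0..1}|lborel. ?g2 (twist i (unit_circle t) 1 x)) \<partial>lborel)"
  proof (rule integral_rotation_average(2)[symmetric])
    show "integrable lborel ?g2"
      unfolding avg1[symmetric]
      by (rule integral_rotation_average(1)[OF g])
         (auto intro!: linear_twist norm_twist continuous_twist[of "\<lambda>t. 1" unit_circle] continuous_unit_circle)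
  qed (auto intro!: linear_twist norm_twist continuous_twist[of unit_circle "\<lambda>t. 1"] continuous_unit_circle)
  also have "(\<lambda>x. LINT t:{0..1}|lborel. ?g2 (twist i (unit_circle t) 1 x))
      = (\<lambda>x. (deriv ^^ k) \<phi> 0 / fact k * of_real (cmod (snd x $ i) ^ (2 * k) * indicator hdom x))"
  proof
    fix x :: "(complex^3) \<times> (complex^'m)"
    show "(LINT t:{0..1}|lborel. ?g2 (twist i (unit_circle t) 1 x))
        = (deriv ^^ k) \<phi> 0 / fact k * of_real (cmod (snd x $ i) ^ (2 * k) * indicator hdom x)"
    proof (cases "x \<in> hdom")
      case False
      then show ?thesis by (simp add: twist_mem_iff)
    next
      case True
      define w where "w = snd x $ i"
      have w: "cmod w < 1" unfolding w_def by (rule Z1[OF True])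
      define T where "T = (\<lambda>c. w * c) -` ball 0 1"
      have T: "open T" unfolding T_def by (intro open_vimage continuous_intros) auto
      have h: "(\<lambda>c. \<phi> (w * c)) holomorphic_on T"
        using holomorphic_on_compose_gen[OF _ phi, of "\<lambda>c. w * c" T] unfolding T_def o_def
        by (auto intro: holomorphic_intros)
      have sub: "cball 0 1 \<subseteq> T"
        unfolding T_def using w by (auto simp: norm_mult) (smt (verit) mult_left_le norm_ge_zero)
      have "?g2 (twist i (unit_circle t) 1 x) = (\<phi> (w * unit_circle t) * cnj (unit_circle t) ^ k) * cnj w ^ k" for t
        using True by (simp add: twist_mem_iff) (simp add: twist_def w_def power_mult_distrib mult_ac)
      then have "(LINT t:{0..1}|lborel. ?g2 (twist i (unit_circle t) 1 x))
          = (LINT t:{0..1}|lborel. \<phi> (w * unit_circle t) * cnj (unit_circle t) ^ k) * cnj w ^ k"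
        by (simp only: set_integral_mult_left)
      also have "(LINT t:{0..1}|lborel. \<phi> (w * unit_circle t) * cnj (unit_circle t) ^ k) = (deriv ^^ k) (\<lambda>c. \<phi> (w * c)) 0 / fact k"
        by (rule circle_mean_coeff[OF h sub])
      also have "(deriv ^^ k) (\<lambda>c. \<phi> (w * c)) 0 = w ^ k * (deriv ^^ k) \<phi> (w * 0)"
        by (rule higher_deriv_compose_linear[OF phi T open_ball]) (use sub in \<open>auto simp: T_def\<close>)
      finally have "(LINT t:{0..1}|lborel. ?g2 (twist i (unit_circle t) 1 x)) = (deriv ^^ k) \<phi> 0 / fact k * (w ^ k * cnj w ^ k)"
        by simp
      also have "w ^ k * cnj w ^ k = of_real (cmod w ^ (2 * k))"
        by (simp only: power_mult_distrib[symmetric] complex_norm_square[symmetric] power_mult of_real_power)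
      finally show ?thesis using True by (simp add: w_def)
    qed
  qed
  also have "(\<integral>x. (deriv ^^ k) \<phi> 0 / fact k * of_real (cmod (snd x $ i) ^ (2 * k) * indicator hdom x) \<partial>lborel)
      = (deriv ^^ k) \<phi> 0 / fact k * of_real (\<integral>x. cmod (snd x $ i) ^ (2 * k) * indicator hdom x \<partial>lborel)"
    by (simp only: integral_mult_right_zero integral_complex_of_real)
  also have "(\<integral>x. cmod (snd x $ i) ^ (2 * k) * indicator hdom x \<partial>lborel) = M"
  proof -
    have m: "(\<lambda>x. cmod (snd x $ i) ^ (2 * k) * indicator hdom x) \<in> borel_measurable (borel :: ((complex^3) \<times> (complex^'m)) measure)"
      by (intro borel_measurable_times borel_measurable_continuous_onI continuous_intros borel_measurable_indicator Um)
    have "(\<integral>x. cmod (snd x $ i) ^ (2 * k) * indicator hdom x \<partial>lborel)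
        = enn2real (\<integral>\<^sup>+x. ennreal (cmod (snd x $ i) ^ (2 * k) * indicator hdom x) \<partial>lborel)"
      by (rule integral_eq_nn_integral) (use m in auto)
    also have "(\<integral>\<^sup>+x. ennreal (cmod (snd x $ i) ^ (2 * k) * indicator hdom x) \<partial>lborel) = ennreal M"
      unfolding M(2)[symmetric] by (intro nn_integral_cong) (auto split: split_indicator)
    finally show ?thesis using M(1) by simp
  qed
  finally show ?thesis unfolding \<phi>_def .
qed

text \<open>The monomials in the i-th coordinate of Z are orthogonal, and f only enters through its Taylor
coefficients on the slice, so the kernel is the sum of (cnj \<omega> Z_i)^n divided by the n-th moment.\<close>
lemma base_reproduces:
  obtains C :: real where "C > 0"
    "\<And>\<omega>. cmod \<omega> < 1 \<Longrightarrow> reproduces hdom (0, axis i \<omega>) (\<lambda>x. ker_sum CARD('m) \<mu> (cnj \<omega> * snd x $ i) / of_real C)"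
proof -
  obtain C :: real where C: "C > 0"
    "\<And>\<mu> k. \<mu> > 0 \<Longrightarrow> (\<integral>\<^sup>+x. ennreal ((cmod (snd x $ i)) ^ (2 * k)) * indicator (hartogs_lie \<mu>) x \<partial>(lborel :: ((complex^3) \<times> (complex^'m)) measure))
        = ennreal (C * fact k / (fact (k + CARD('m)) * hua_poly (\<mu> * real (k + CARD('m)))))"
    using hartogs_moment by blast
  let ?M = "restrict_space lborel hdom"
  have U: "open hdom" by (rule open_hartogs_lie)
  define M where "M = (\<lambda>k. C * fact k / (fact (k + CARD('m)) * hua_poly (\<mu> * real (k + CARD('m)))))"
  have Mk: "M k * ker_coeff CARD('m) \<mu> k = C" for k
  proof -
    have "hua_poly (\<mu> * real (k + CARD('m))) > 0" using mu by (simp add: hua_poly_def add_nonneg_pos)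
    then show ?thesis by (simp add: M_def ker_coeff_def)
  qed
  have M0: "M k \<ge> 0" for k
    using C(1) mu by (simp add: M_def hua_poly_def)
  have Mint: "(\<integral>\<^sup>+x. ennreal ((cmod (snd x $ i)) ^ (2 * k)) * indicator hdom x \<partial>lborel) = ennreal (M k)" for k
    unfolding M_def by (rule C(2)[OF mu])
  have fin: "emeasure lborel hdom < \<infinity>"
    using Mint[of 0] U by (simp add: borel_open)
  have finM: "finite_measure ?M"
  proof
    show "emeasure ?M (space ?M) \<noteq> \<infinity>"
      using U fin by (simp add: emeasure_restrict_space space_restrict_space borel_open)
  qed
  have Z1: "cmod (snd x $ i) < 1" if "x \<in> hdom" for x
    using hartogs_lie_snd_norm[OF that mu] norm_vec_nth_le[of "snd x" i] by simp
  show ?thesis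
  proof (rule that[OF C(1)])
    fix \<omega> :: complex assume w: "cmod \<omega> < 1"
    define k where "k = (\<lambda>x :: (complex^3) \<times> (complex^'m). ker_sum CARD('m) \<mu> (cnj \<omega> * snd x $ i) / of_real C)"
    have arg: "cmod (cnj \<omega> * snd x $ i) \<le> cmod \<omega>" if "x \<in> hdom" for x
      using Z1[OF that] by (simp add: norm_mult mult_left_le)
    have hs: "ker_sum CARD('m) \<mu> holomorphic_on ball 0 1"
      by (rule power_series_holomorphic[where a = "\<lambda>n. of_real (ker_coeff CARD('m) \<mu> n)"]) (use ker_sum_sums in simp)
    have hk: "holomorphic_sev k hdom"
    proof -
      have 1: "holomorphic_sev (\<lambda>x. cnj \<omega> * snd x $ i) hdom" by (intro holomorphic_sev_intros)
      have "holomorphic_sev (\<lambda>x. ker_sum CARD('m) \<mu> (cnj \<omega> * snd x $ i)) hdom"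
      proof (rule holomorphic_sev_compose_field[OF 1])
        fix x assume "x \<in> hdom"
        then have "cnj \<omega> * snd x $ i \<in> ball 0 1" using arg[of x] w by simp
        then show "(ker_sum CARD('m) \<mu> has_field_derivative deriv (ker_sum CARD('m) \<mu>) (cnj \<omega> * snd x $ i)) (at (cnj \<omega> * snd x $ i))"
          by (rule holomorphic_derivI[OF hs open_ball])
      qed
      then show ?thesis unfolding k_def by (intro holomorphic_sev_divide holomorphic_sev_const) (use C in auto)
    qed
    define B where "B = (\<Sum>n. ker_coeff CARD('m) \<mu> n * cmod \<omega> ^ n) / C"
    have bound: "cmod (k x) \<le> B" if "x \<in> hdom" for x
      unfolding k_def B_def using ker_sum_bound[OF mu arg[OF that] w] C(1) by (simp add: norm_divide divide_right_mono)
    have km: "k \<in> borel_measurable ?M"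
      by (intro continuous_on_imp_measurable_restrict holomorphic_sev_imp_continuous_on hk)
    have kspace: "k \<in> bergman_space hdom"
      unfolding bergman_space_iff[OF U]
    proof
      show "integrable ?M (\<lambda>x. (cmod (k x))\<^sup>2)"
      proof (rule finite_measure.integrable_const_bound[OF finM, of _ "B\<^sup>2"])
        show "AE x in ?M. norm ((cmod (k x))\<^sup>2) \<le> B\<^sup>2"
          by (rule AE_I2) (use bound in \<open>auto simp: space_restrict_space intro!: power_mono\<close>)
      qed (use km in measurable)
    qed (rule hk)
    have rep: "f (0, axis i \<omega>) = (LINT z:hdom|lborel. f z * cnj (k z))" if f: "f \<in> bergman_space hdom" for f
    proof -
      have intf: "integrable ?M f" by (rule bergman_space_integrable[OF U fin f])
      have fm [measurable]: "f \<in> borel_measurable ?M" using intf by (rule borel_measurable_integrable)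
      have Zm [measurable]: "(\<lambda>x. snd x $ i) \<in> borel_measurable ?M"
        by (intro continuous_on_imp_measurable_restrict continuous_intros)
      have cZm: "(\<lambda>x. cnj (snd x $ i) ^ n) \<in> borel_measurable ?M" for n
        by (intro continuous_on_imp_measurable_restrict continuous_intros)
      define a where "a = (\<lambda>n. (deriv ^^ n) (\<lambda>\<zeta>. f (0, axis i \<zeta>)) 0 / fact n)"
      define c where "c = (\<lambda>n. ker_coeff CARD('m) \<mu> n / C)"
      have c0: "c n \<ge> 0" for n unfolding c_def using ker_coeff_pos[OF mu, of "CARD('m)" n] C(1) by simp
      define F where "F = (\<lambda>n x. of_real (c n) * \<omega> ^ n * (f x * cnj (snd x $ i) ^ n))"
      have Fint: "integrable ?M (F n)" for n
        unfolding F_def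
      proof (rule integrable_mult_right, rule Bochner_Integration.integrable_bound[OF intf])
        show "(\<lambda>x. f x * cnj (snd x $ i) ^ n) \<in> borel_measurable ?M" using cZm[of n] by measurable
        show "AE x in ?M. norm (f x * cnj (snd x $ i) ^ n) \<le> norm (f x)"
        proof (rule AE_I2)
          fix x assume "x \<in> space ?M"
          then have "cmod (snd x $ i) \<le> 1" using Z1[of x] by (simp add: space_restrict_space)
          then show "norm (f x * cnj (snd x $ i) ^ n) \<le> norm (f x)"
            by (simp add: norm_mult norm_power mult_left_le power_le_one)
        qed
      qed
      have Fbound: "norm (F n x) \<le> c n * cmod \<omega> ^ n * norm (f x)" if "x \<in> hdom" for n x
      proof -
        have "cmod (snd x $ i) ^ n \<le> 1" using Z1[OF that] by (simp add: power_le_one)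
        then have "c n * cmod \<omega> ^ n * (cmod (f x) * cmod (snd x $ i) ^ n) \<le> c n * cmod \<omega> ^ n * (cmod (f x) * 1)"
          using c0 by (intro mult_left_mono mult_nonneg_nonneg) auto
        then show ?thesis using c0[of n] by (simp add: F_def norm_mult norm_power)
      qed
      have csum: "summable (\<lambda>n. c n * cmod \<omega> ^ n)"
        unfolding c_def using summable_divide[OF ker_coeff_summable[of "cmod \<omega>" "CARD('m)" \<mu>], of C] w by simp
      have Fsums: "F n x = f x * cnj (of_real (ker_coeff CARD('m) \<mu> n) * (cnj \<omega> * snd x $ i) ^ n / of_real C)" for n x
        by (simp add: F_def c_def power_mult_distrib)
      have Fk: "(\<lambda>n. F n x) sums (f x * cnj (k x))" if "x \<in> hdom" for x
      proof -
        have "cmod (cnj \<omega> * snd x $ i) < 1" using arg[OF that] w by simp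
        then have "(\<lambda>n. of_real (ker_coeff CARD('m) \<mu> n) * (cnj \<omega> * snd x $ i) ^ n / of_real C) sums k x"
          unfolding k_def by (intro sums_divide ker_sum_sums)
        then have "(\<lambda>n. cnj (of_real (ker_coeff CARD('m) \<mu> n) * (cnj \<omega> * snd x $ i) ^ n / of_real C)) sums cnj (k x)"
          by (simp only: sums_cnj)
        then show ?thesis unfolding Fsums by (rule sums_mult)
      qed
      have s1: "AE x in ?M. summable (\<lambda>n. norm (F n x))"
      proof (rule AE_I2)
        fix x assume "x \<in> space ?M"
        then have x: "x \<in> hdom" by (simp add: space_restrict_space)
        show "summable (\<lambda>n. norm (F n x))"
          by (rule summable_comparison_test'[OF summable_mult2[OF csum], of 0]) (use Fbound[OF x] in simp)
      qed
      have s2: "summable (\<lambda>n. \<integral>x. norm (F n x) \<partial>?M)"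
      proof (rule summable_comparison_test'[OF summable_mult2[OF csum, of "\<integral>x. norm (f x) \<partial>?M"], of 0])
        fix n
        have "(\<integral>x. norm (F n x) \<partial>?M) \<le> (\<integral>x. c n * cmod \<omega> ^ n * norm (f x) \<partial>?M)"
          by (rule integral_mono) (use Fint intf Fbound in \<open>auto simp: space_restrict_space\<close>)
        then show "norm (\<integral>x. norm (F n x) \<partial>?M) \<le> c n * cmod \<omega> ^ n * (\<integral>x. norm (f x) \<partial>?M)"
          by simp
      qed
      have "(LINT z:hdom|lborel. f z * cnj (k z)) = (\<integral>x. f x * cnj (k x) \<partial>?M)"
        by (rule set_integral_restrict_space[OF U])
      also have "\<dots> = (\<integral>x. (\<Sum>n. F n x) \<partial>?M)"
        by (rule Bochner_Integration.integral_cong) (use Fk in \<open>auto simp: space_restrict_space sums_unique\<close>)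
      also have "\<dots> = (\<Sum>n. \<integral>x. F n x \<partial>?M)"
        by (rule integral_suminf[OF Fint s1 s2])
      also have "(\<lambda>n. \<integral>x. F n x \<partial>?M) = (\<lambda>n. a n * \<omega> ^ n)"
      proof
        fix n
        have "(\<integral>x. F n x \<partial>?M) = of_real (c n) * \<omega> ^ n * (\<integral>x. f x * cnj (snd x $ i) ^ n \<partial>?M)"
          unfolding F_def by (rule integral_mult_right_zero)
        also have "(\<integral>x. f x * cnj (snd x $ i) ^ n \<partial>?M) = a n * of_real (M n)"
          unfolding a_def by (rule slice_coefficient[OF f fin M0 Mint])
        also have "of_real (c n) * \<omega> ^ n * (a n * of_real (M n)) = a n * \<omega> ^ n * of_real (M n * ker_coeff CARD('m) \<mu> n / C)"
          by (simp add: c_def)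
        also have "M n * ker_coeff CARD('m) \<mu> n / C = 1" using Mk[of n] C(1) by simp
        finally show "(\<integral>x. F n x \<partial>?M) = a n * \<omega> ^ n" by simp
      qed
      also have "(\<Sum>n. a n * \<omega> ^ n) = f (0, axis i \<omega>)"
      proof -
        have hol: "holomorphic_sev f hdom" using f bergman_space_iff[OF U] by blast
        have "(\<lambda>l. f ((0, 0) + cscale l (0, axis i 1))) holomorphic_on ball 0 1"
        proof (rule holomorphic_sev_line[OF hol])
          fix l :: complex assume "l \<in> ball 0 1"
          then have "norm (l *s axis i 1 :: complex^'m) < 1" by (simp add: norm_vec_smult norm_axis_complex)
          then show "(0, 0) + cscale l (0, axis i 1) \<in> hdom" by (simp add: hartogs_lie_base_iff)
        qed simp
        moreover have "l *s axis i 1 = (axis i l :: complex^'m)" for l by (simp add: vec_eq_iff axis_def)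
        ultimately have "(\<lambda>\<zeta>. f (0, axis i \<zeta>)) holomorphic_on ball 0 1" by simp
        from holomorphic_power_series[OF this, of \<omega>] w show ?thesis
          unfolding a_def by (simp add: sums_iff)
      qed
      finally show ?thesis ..
    qed
    show "reproduces hdom (0, axis i \<omega>) (\<lambda>x. ker_sum CARD('m) \<mu> (cnj \<omega> * snd x $ i) / of_real C)"
      unfolding reproduces_def k_def[symmetric] using kspace rep by blast
  qed
qed

section \<open>Transport of the kernel and conclusion\<close>

text \<open>The form in which zero-freeness passes backwards along automorphisms, from F y to y.\<close>
definition kernel_via_series :: "(complex^3) \<times> (complex^'m) \<Rightarrow> bool" where
  "kernel_via_series y \<longleftrightarrow> (\<exists>k. reproduces hdom y k \<and> ((\<forall>X. cmod X < 1 \<longrightarrow> ker_sum CARD('m) \<mu> X \<noteq> 0) \<longrightarrow> (\<forall>x\<in>hdom. k x \<noteq> 0)))"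

lemma kernel_via_series_pullback:
  assumes aut: "bihol_aut hdom F G J" and y: "y \<in> hdom" and g: "kernel_via_series (F y)"
  shows "kernel_via_series y"
proof -
  obtain k where k: "reproduces hdom (F y) k" "(\<forall>X. cmod X < 1 \<longrightarrow> ker_sum CARD('m) \<mu> X \<noteq> 0) \<Longrightarrow> \<forall>x\<in>hdom. k x \<noteq> 0"
    using g unfolding kernel_via_series_def by blast
  have F: "\<And>x. x \<in> hdom \<Longrightarrow> F x \<in> hdom" "\<And>x. x \<in> hdom \<Longrightarrow> J x \<noteq> 0"
    using aut unfolding bihol_aut_def by blast+
  show ?thesis
    unfolding kernel_via_series_def
  proof (intro exI conjI impI ballI)
    show "reproduces hdom y (\<lambda>x. k (F x) * J x * cnj (J y))"
      by (rule reproduces_pullback[OF open_hartogs_lie aut y k(1)])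
    fix x assume "\<forall>X. cmod X < 1 \<longrightarrow> ker_sum CARD('m) \<mu> X \<noteq> 0" and x: "x \<in> hdom"
    then show "k (F x) * J x * cnj (J y) \<noteq> 0" using k(2) F y by auto
  qed
qed

lemma kernel_via_series_base:
  assumes w: "cmod \<omega> < 1"
  shows "kernel_via_series (0, axis i \<omega>)"
proof -
  obtain C where C: "C > 0" "reproduces hdom (0, axis i \<omega>) (\<lambda>x. ker_sum CARD('m) \<mu> (cnj \<omega> * snd x $ i) / of_real C)"
    using base_reproduces w by blast
  have "cmod (cnj \<omega> * snd x $ i) < 1" if "x \<in> hdom" for x
  proof -
    have "cmod (snd x $ i) < 1"
      using hartogs_lie_snd_norm[OF that mu] norm_vec_nth_le[of "snd x" i] by simp
    then show ?thesis using w mult_strict_mono'[of "cmod \<omega>" 1 "cmod (snd x $ i)" 1] by (simp add: norm_mult)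
  qed
  then show ?thesis unfolding kernel_via_series_def using C by (intro exI[of _ "\<lambda>x. ker_sum CARD('m) \<mu> (cnj \<omega> * snd x $ i) / of_real C"]) auto
qed

lemma clin_id: "clin (\<lambda>x. x)" by (simp add: clin_def)

lemma bihol_aut_reflect_fibre: "bihol_aut hdom (\<lambda>x. (fst x, reflect v (snd x))) (\<lambda>x. (fst x, reflect v (snd x))) (\<lambda>x. 1)"
  by (rule bihol_aut_linear[OF open_hartogs_lie, of "\<lambda>x. x" "\<lambda>x. x" "reflect v" "reflect v"])
     (simp_all add: clin_id clin_reflect reflect_reflect norm_reflect hartogs_lie_iff)

lemma bihol_aut_reflect_base: "bihol_aut hdom (\<lambda>x. (reflect (cvec v) (fst x), snd x)) (\<lambda>x. (reflect (cvec v) (fst x), snd x)) (\<lambda>x. 1)"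
  by (rule bihol_aut_linear[OF open_hartogs_lie, of "reflect (cvec v)" "reflect (cvec v)" "\<lambda>x. x" "\<lambda>x. x"])
     (simp_all add: clin_id clin_reflect reflect_reflect norm_reflect hartogs_lie_iff lie_ball_def lie_norm_cdot cdot_reflect_real)

lemma bihol_aut_phase:
  assumes c: "cmod c = 1"
  shows "bihol_aut hdom (\<lambda>x. (c *s fst x, snd x)) (\<lambda>x. (inverse c *s fst x, snd x)) (\<lambda>x. 1)"
proof -
  have "c \<noteq> 0" using c by auto
  then show ?thesis
    by (intro bihol_aut_linear[OF open_hartogs_lie, of "(*s) c" "(*s) (inverse c)" "\<lambda>x. x" "\<lambda>x. x"])
       (simp_all add: clin_id clin_smult norm_vec_smult c hartogs_lie_smult_iff[OF c])
qed

text \<open>Every point reaches a base point (0, \<omega> e_i): bring z to normal form with p and q real, move p to 0,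
exchange p and q, move the other entry to 0, and finally reflect in the fibre.\<close>
lemma kernel_via_series_all:
  assumes "(z, Z) \<in> hdom" shows "kernel_via_series (z, Z)"
proof -
  define P where "P = (\<lambda>z. \<forall>Z. (z, Z) \<in> hdom \<longrightarrow> kernel_via_series (z, Z))"
  have mem: "F y \<in> hdom" if "bihol_aut hdom F G J" "y \<in> hdom" for F G J y
    using that unfolding bihol_aut_def by blast
  have refl: "P z" if "P (reflect (cvec v) z)" for v z
    unfolding P_def
  proof (intro allI impI)
    fix Z assume h: "(z, Z) \<in> hdom"
    have "(reflect (cvec v) z, Z) \<in> hdom" using mem[OF bihol_aut_reflect_base h, of v] by simp
    then show "kernel_via_series (z, Z)"
      using kernel_via_series_pullback[OF bihol_aut_reflect_base h, of v] that by (simp add: P_def)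
  qed
  have phase: "P z" if c: "cmod c = 1" and "P (c *s z)" for c z
    unfolding P_def
  proof (intro allI impI)
    fix Z assume h: "(z, Z) \<in> hdom"
    have "(c *s z, Z) \<in> hdom" using mem[OF bihol_aut_phase[OF c] h] by simp
    then show "kernel_via_series (z, Z)"
      using kernel_via_series_pullback[OF bihol_aut_phase[OF c] h] that by (simp add: P_def)
  qed
  have trans: "P (lie_pt (of_real a) 0 q)" if "P (lie_pt 0 0 q)" for a q
    unfolding P_def
  proof (intro allI impI)
    fix Z assume h: "(lie_pt (of_real a) 0 q, Z) \<in> hdom"
    have a: "\<bar>a\<bar> < 1" using hartogs_lie_coord_p[OF h] by simp
    have m: "hartogs_moebius \<mu> a (lie_pt (of_real a) 0 q, Z) \<in> hdom" by (rule hartogs_moebius_mem[OF a h])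
    have "fst (hartogs_moebius \<mu> a (lie_pt (of_real a) 0 q, Z)) = lie_pt 0 0 q"
      by (simp add: hartogs_moebius_def lie_moebius_axis[OF a])
    then have "kernel_via_series (hartogs_moebius \<mu> a (lie_pt (of_real a) 0 q, Z))"
      using that m unfolding P_def by (metis prod.collapse)
    then show "kernel_via_series (lie_pt (of_real a) 0 q, Z)"
      by (rule kernel_via_series_pullback[OF bihol_aut_hartogs_moebius[OF a] h])
  qed
  have zero: "P (lie_pt 0 0 0)"
    unfolding P_def
  proof (intro allI impI)
    fix Z assume h: "(lie_pt 0 0 0, Z) \<in> hdom"
    have z0: "lie_pt 0 0 0 = 0" by (simp add: lie_pt_def vec_eq_iff forall_3)
    have Z: "norm Z < 1" using h unfolding z0 hartogs_lie_base_iff .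
    obtain v \<omega> where v: "reflect v Z = axis i \<omega>" "cmod \<omega> = norm Z"
      using exists_reflection_to_axis by blast
    have "kernel_via_series (0, reflect v Z)" unfolding v(1) by (rule kernel_via_series_base) (use v Z in simp)
    then show "kernel_via_series (lie_pt 0 0 0, Z)"
      using kernel_via_series_pullback[OF bihol_aut_reflect_fibre h, of v] by (simp add: z0)
  qed
  have base: "P (lie_pt (of_real a) 0 (of_real b))" for a b
  proof (rule trans)
    have "P (lie_pt (of_real b) 0 0)" by (rule trans[OF zero])
    then show "P (lie_pt 0 0 (of_real b))"
      using refl[of "axis 2 1" "lie_pt 0 0 (of_real b)"] by (simp add: lie_pt_swap)
  qed
  have "P z" by (rule lie_ball_normal_form[of P, OF phase refl base])
  then show ?thesis using assms unfolding P_def by blast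
qed

text \<open>At base points the kernel itself is the series, and its argument cnj \<omega> \<zeta> takes every value in the
disc, so each zero of the series is a zero of the kernel.\<close>
lemma Lu_Qikeng_iff_series: "Lu_Qikeng_domain hdom \<longleftrightarrow> (\<forall>X. cmod X < 1 \<longrightarrow> ker_sum CARD('m) \<mu> X \<noteq> 0)"
proof
  have U: "open hdom" by (rule open_hartogs_lie)
  have ex: "\<exists>k. reproduces hdom w k \<and> ((\<forall>X. cmod X < 1 \<longrightarrow> ker_sum CARD('m) \<mu> X \<noteq> 0) \<longrightarrow> (\<forall>x\<in>hdom. k x \<noteq> 0))" if "w \<in> hdom" for w
    using kernel_via_series_all[of "fst w" "snd w"] that unfolding kernel_via_series_def by simp
  define k where "k = (\<lambda>w. SOME k. reproduces hdom w k \<and> ((\<forall>X. cmod X < 1 \<longrightarrow> ker_sum CARD('m) \<mu> X \<noteq> 0) \<longrightarrow> (\<forall>x\<in>hdom. k x \<noteq> 0)))"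
  have k: "reproduces hdom w (k w)" "(\<forall>X. cmod X < 1 \<longrightarrow> ker_sum CARD('m) \<mu> X \<noteq> 0) \<Longrightarrow> (\<forall>x\<in>hdom. k w x \<noteq> 0)" if "w \<in> hdom" for w
    using someI_ex[OF ex[OF that]] unfolding k_def by blast+
  {
    assume "\<forall>X. cmod X < 1 \<longrightarrow> ker_sum CARD('m) \<mu> X \<noteq> 0"
    then have "bergman_kernel hdom z w \<noteq> 0" if "z \<in> hdom" "w \<in> hdom" for z w
      using bergman_kernel_eqI[of hdom k z w, OF U k(1) that] k(2) that by simp
    moreover have "(0, 0) \<in> hdom" by (simp add: hartogs_lie_base_iff)
    ultimately show "Lu_Qikeng_domain hdom"
      unfolding Lu_Qikeng_domain_def using U connected_hartogs_lie[OF mu] by blast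
  }
  assume L: "Lu_Qikeng_domain hdom"
  show "\<forall>X. cmod X < 1 \<longrightarrow> ker_sum CARD('m) \<mu> X \<noteq> 0"
  proof (intro allI impI notI)
    fix X :: complex assume X: "cmod X < 1" "ker_sum CARD('m) \<mu> X = 0"
    \<comment> \<open>split X evenly into two factors, both of modulus less than 1\<close>
    define \<omega> where "\<omega> = complex_of_real (sqrt (cmod X))"
    define \<zeta> where "\<zeta> = sgn X * of_real (sqrt (cmod X))"
    have prod: "cnj \<omega> * \<zeta> = X"
      by (cases "X = 0") (simp_all add: \<omega>_def \<zeta>_def sgn_div_norm scaleR_conv_of_real mult_ac flip: of_real_mult)
    have w: "cmod \<omega> < 1" using X(1) by (simp add: \<omega>_def)
    have z: "cmod \<zeta> < 1" using X(1) by (cases "X = 0") (simp_all add: \<zeta>_def norm_mult norm_sgn)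
    obtain C where C: "C > 0" "reproduces hdom (0, axis i \<omega>) (\<lambda>x. ker_sum CARD('m) \<mu> (cnj \<omega> * snd x $ i) / of_real C)"
      using base_reproduces w by blast
    \<comment> \<open>by uniqueness of the kernel the series may be prescribed at this point\<close>
    define k' where "k' = k ((0, axis i \<omega>) := (\<lambda>x. ker_sum CARD('m) \<mu> (cnj \<omega> * snd x $ i) / of_real C))"
    have k': "reproduces hdom w (k' w)" if "w \<in> hdom" for w
      using k(1)[OF that] C(2) by (auto simp: k'_def)
    have mem: "(0, axis i \<zeta>) \<in> hdom" "(0, axis i \<omega>) \<in> hdom"
      using w z by (simp_all add: hartogs_lie_base_iff norm_axis_complex)
    have "bergman_kernel hdom (0, axis i \<zeta>) (0, axis i \<omega>) = k' (0, axis i \<omega>) (0, axis i \<zeta>)"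
      by (rule bergman_kernel_eqI[OF U k' mem])
    also have "\<dots> = 0" using X(2) prod by (simp add: k'_def axis_def)
    finally show False using L mem unfolding Lu_Qikeng_domain_def by blast
  qed
qed

lemma series_zero_free_iff: "(\<forall>X. cmod X < 1 \<longrightarrow> ker_sum CARD('m) \<mu> X \<noteq> 0) \<longleftrightarrow> q_poly CARD('m) \<mu> \<ge> 0"
proof
  assume q: "q_poly CARD('m) \<mu> \<ge> 0"
  show "\<forall>X. cmod X < 1 \<longrightarrow> ker_sum CARD('m) \<mu> X \<noteq> 0"
  proof (intro allI impI)
    fix X :: complex assume X: "cmod X < 1"
    have "1 - X \<noteq> 0" using X by auto
    moreover have "P_poly CARD('m) \<mu> (1 / (1 - X)) \<noteq> 0"
      by (rule P_poly_no_zero[OF _ mu q X]) (simp add: Suc_leI)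
    ultimately show "ker_sum CARD('m) \<mu> X \<noteq> 0" unfolding ker_sum_def by simp
  qed
next
  assume nz: "\<forall>X. cmod X < 1 \<longrightarrow> ker_sum CARD('m) \<mu> X \<noteq> 0"
  show "q_poly CARD('m) \<mu> \<ge> 0"
  proof (rule ccontr)
    assume "\<not> q_poly CARD('m) \<mu> \<ge> 0"
    then obtain r where r: "- 1 < r" "r < 1" "P_poly CARD('m) \<mu> (1 / (1 - complex_of_real r)) = 0"
      using P_poly_zero[OF mu] by (metis not_le)
    then have "ker_sum CARD('m) \<mu> (of_real r) = 0" by (simp add: ker_sum_def)
    then show False using nz r by (metis abs_less_iff minus_less_iff norm_of_real)
  qed
qed

lemma Lu_Qikeng_iff: "Lu_Qikeng_domain hdom \<longleftrightarrow> q_poly CARD('m) \<mu> \<ge> 0"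
  using Lu_Qikeng_iff_series series_zero_free_iff by simp

end

theorem mainTheorem5:
  shows "(CARD('m::finite) \<ge> 6 \<longrightarrow>
            (\<forall>\<mu>>0. Lu_Qikeng_domain (hartogs_lie \<mu> :: ((complex^3) \<times> (complex^'m)) set)))
       \<and> (1 \<le> CARD('m) \<and> CARD('m) \<le> 5 \<longrightarrow>
            (\<exists>!\<mu>. \<mu> > 0 \<and> q_poly CARD('m) \<mu> = 0) \<and>
            (\<forall>\<mu>>0. Lu_Qikeng_domain (hartogs_lie \<mu> :: ((complex^3) \<times> (complex^'m)) set)
                      \<longleftrightarrow> \<mu> \<le> mu_root CARD('m)))"
proof (intro conjI impI allI)
  fix \<mu> :: real assume "CARD('m) \<ge> 6" "\<mu> > 0"
  then show "Lu_Qikeng_domain (hartogs_lie \<mu> :: ((complex^3) \<times> (complex^'m)) set)"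
    using Lu_Qikeng_iff q_poly_pos by (metis less_imp_le)
next
  assume m: "1 \<le> CARD('m) \<and> CARD('m) \<le> 5"
  show "\<exists>!\<mu>. \<mu> > 0 \<and> q_poly CARD('m) \<mu> = 0" using q_poly_root(1) m by blast
  fix \<mu> :: real assume "\<mu> > 0"
  then show "Lu_Qikeng_domain (hartogs_lie \<mu> :: ((complex^3) \<times> (complex^'m)) set) \<longleftrightarrow> \<mu> \<le> mu_root CARD('m)"
    using Lu_Qikeng_iff q_poly_root(2) m by blast
qed

end
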